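(* Let $(\mathcal{M},\delta,\Delta)$ be a non-commutative fourth moment diffusive structure and let $F=(F_1,\dots,F_n)$ be an $n$-tuple of centered ($\tau(F_i)=0$) self-adjoint non-commutative random variables in $\mathrm{dom}(\delta)$. Then $\left(\Gamma(\Delta^{-1}F_i,F_j)\right)_{i,j=1}^n$ is a free Stein kernel of $F$ with respect to the standard semicircular potential $V_{I_n}=\frac12\sum_{i=1}^nt_i^2$.
   Context: Setting. $\mathcal{M}$ is a finite von Neumann algebra with faithful normal tracial state $\tau$; $\mathcal{H}$ is the complexification of a real separable Hilbert space $\mathcal{K}$ (one may take $\mathcal{K}=L^2_{\mathbb{R}}(\mathbb{R}_+)$, $\ell^2(\mathbb{N})$ or $\mathbb{R}^N$). $\delta:D(\delta)\to L^2(\mathcal{M})\otimes\mathcal{H}\otimes L^2(\mathcal{M}^{op})$ is a closable derivation defined on a weakly dense $*$-subalgebra $D(\delta)$ of $\mathcal{M}$, the bimodule structure being left multiplication on the left leg and right multiplication on the right leg (for $\mathcal{K}=L^2_{\mathbb{R}}(\mathbb{R}_+)$, $\delta(x)=(\delta_t(x))_{t\ge0}$ with $\delta_t(x)\in L^2(\mathcal{M})\bar\otimes L^2(\mathcal{M}^{op})$; for $\mathcal{K}=\mathbb{R}^N$, $\delta=(\delta_1,\dots,\delta_N)$), and $\delta$ is real: $\langle\delta(x),y\delta(z)\rangle=\langle\delta(z^* )y^*,\delta(x^* )\rangle$. Its $L^2$-closure is denoted by the same symbol $\delta$ (or $\bar\delta$), and $\Delta=\delta^*\bar\delta$. A non-commutative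 fourth moment diffusive structure is such a triple $(\mathcal{M},\delta,\Delta)$ for which $\Delta$ has pure point spectrum, given by an increasing sequence $(\lambda_k)_{k\ge0}$ of nonnegative reals, so that $L^2(\mathcal{M})=\bigoplus_{k\ge0}\mathrm{Ker}(\Delta-\lambda_kId)$. $\Delta^{-1}$ denotes the pseudo-inverse of $\Delta$, satisfying $\Delta\Delta^{-1}(F)=F-\tau(F)$. Carré du champ: $\Gamma(x,y)=\langle\delta(x),\delta(y)\rangle_{\mathcal{H}}$, the $L^2(\mathcal{M})$-legs being combined via $(a\otimes b)\sharp(c\otimes d)^*$; i.e. $\Gamma(x,y)=\int_{\mathbb{R}_+}\delta_t(x)\sharp(\delta_t(y))^*dt$ for $\mathcal{K}=L^2_{\mathbb{R}}(\mathbb{R}_+)$ and $\Gamma(x,y)=\sum_k\delta_k(x)\sharp(\delta_k(y))^*$ in coordinates, where $(a\otimes b)^*=a^*\otimes b^*$ and $(a\otimes b)\sharp(c\otimes d)=ac\otimes db$. On $\mathbb{C}\langle t_1,\dots,t_n\rangle$: $\partial_jm=\sum_{m=at_jb}a\otimes b^{op}$ and $D_jm=\sum_{m=at_jb}ba$ on monomials; $DV=(D_1V,\dots,D_nV)$; $\mathcal{J}P=(\partial_jp_i)_{i,j}$. A free Stein kernel of $F$ with respect to $V$ is an $A\in L^2(M_n(\mathcal{M}\bar\otimes\mathcal{M}^{op}),(\tau\otimes\tau^{op})\circ Tr)$ with $\langle[DV](F),P(F)\rangle_2=\langle A,[\mathcal{J}P](F)\rangle_{HS}$ for all $P\in\mathbb{C}\langle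 t_1,\dots,t_n\rangle^n$, where $\langle X,Y\rangle_2=\sum_i\tau(X_i^*Y_i)$ and $\langle A,B\rangle_{HS}=\sum_{i,j}\langle A_{i,j},B_{i,j}\rangle_{\tau\otimes\tau^{op}}$. For $V_{I_n}$, $[DV_{I_n}](F)=F$.
   Formalization: A free Stein kernel must lie in L², but Γ(Δ^{-1}F_i,F_j) is in general only in L¹, so the claim can fail; the Stein identity is proved for Γ in L¹, and Γ is shown to be a free Stein kernel whenever its entries are in L². *)

theory Defs
  imports "HOL-Analysis.Analysis" "HOL-Library.Poly_Mapping"
begin

section \<open>Complex Hilbert spaces and operators\<close>

text \<open>The inner product is linear in its second argument; its real part is the library's
  \<open>inner\<close>, so norm, topology and completeness are those of the library.\<close>

class complex_hilbert = real_inner + complete_space +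
  fixes scaleC :: "complex \<Rightarrow> 'a \<Rightarrow> 'a" (infixr "*\<^sub>C" 75)
    and cinner :: "'a \<Rightarrow> 'a \<Rightarrow> complex"
  assumes scaleC_add_right: "c *\<^sub>C (u + v) = c *\<^sub>C u + c *\<^sub>C v"
    and scaleC_add_left: "(c + d) *\<^sub>C u = c *\<^sub>C u + d *\<^sub>C u"
    and scaleC_scaleC: "c *\<^sub>C (d *\<^sub>C u) = (c * d) *\<^sub>C u"
    and scaleC_of_real: "complex_of_real r *\<^sub>C u = r *\<^sub>R u"
    and cinner_commute: "cinner u v = cnj (cinner v u)"
    and cinner_add_right: "cinner u (v + w) = cinner u v + cinner u w"
    and cinner_scaleC_right: "cinner u (c *\<^sub>C v) = c * cinner u v"
    and Re_cinner: "Re (cinner u v) = inner u v"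

instantiation complex :: complex_hilbert
begin
definition scaleC_complex :: "complex \<Rightarrow> complex \<Rightarrow> complex"
  where "scaleC_complex c z = c * z"
definition cinner_complex :: "complex \<Rightarrow> complex \<Rightarrow> complex"
  where "cinner_complex w z = cnj w * z"
instance
  by standard
    (simp_all add: scaleC_complex_def cinner_complex_def inner_complex_def
      algebra_simps scaleR_conv_of_real)
end

type_synonym 'a bop = "'a \<Rightarrow>\<^sub>L 'a"

text \<open>The library's \<open>blinfun\<close> is only real linear.\<close>

definition complex_linear :: "('a::complex_hilbert) bop \<Rightarrow> bool" where
  "complex_linear T \<longleftrightarrow>
    (\<forall>c v. blinfun_apply T (c *\<^sub>C v) = c *\<^sub>C blinfun_apply T v)"

definition scalar_op :: "complex \<Rightarrow> ('a::complex_hilbert) bop" where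
  "scalar_op c = Blinfun (\<lambda>v. c *\<^sub>C v)"

definition is_adjoint :: "('a::complex_hilbert) bop \<Rightarrow> 'a bop \<Rightarrow> bool" where
  "is_adjoint T S \<longleftrightarrow>
    (\<forall>u v. cinner (blinfun_apply S u) v = cinner u (blinfun_apply T v))"

definition adj :: "('a::complex_hilbert) bop \<Rightarrow> 'a bop" where
  "adj T = (THE S. is_adjoint T S)"

definition commutant :: "('a::complex_hilbert) bop set \<Rightarrow> 'a bop set" where
  "commutant A = {T. complex_linear T \<and> (\<forall>S\<in>A. T o\<^sub>L S = S o\<^sub>L T)}"

definition von_neumann_algebra :: "('a::complex_hilbert) bop set \<Rightarrow> bool" where
  "von_neumann_algebra M \<longleftrightarrow>
    (\<forall>x\<in>M. \<exists>y\<in>M. is_adjoint x y) \<and> commutant (commutant M) = M"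

definition weakly_dense_in :: "('a::complex_hilbert) bop set \<Rightarrow> 'a bop set \<Rightarrow> bool" where
  "weakly_dense_in D M \<longleftrightarrow>
    (\<forall>x\<in>M. \<forall>X. finite X \<longrightarrow> (\<forall>e>0. \<exists>d\<in>D. \<forall>(u, v)\<in>X.
      cmod (cinner u (blinfun_apply x v) - cinner u (blinfun_apply d v)) < e))"

text \<open>Normality is ultraweak continuity, i.e. membership in the predual.\<close>

definition normal_functional ::
    "('a::complex_hilbert) bop set \<Rightarrow> ('a bop \<Rightarrow> complex) \<Rightarrow> bool" where
  "normal_functional M \<phi> \<longleftrightarrow>
    (\<exists>u v. summable (\<lambda>n. (norm (u n))\<^sup>2) \<and> summable (\<lambda>n. (norm (v n))\<^sup>2) \<and>
      (\<forall>x\<in>M. (\<lambda>n::nat. cinner (u n) (blinfun_apply x (v n))) sums \<phi> x))"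

definition faithful_normal_tracial_state ::
    "('a::complex_hilbert) bop set \<Rightarrow> ('a bop \<Rightarrow> complex) \<Rightarrow> bool" where
  "faithful_normal_tracial_state M \<tau> \<longleftrightarrow>
    (\<forall>x\<in>M. \<forall>y\<in>M. \<tau> (x + y) = \<tau> x + \<tau> y) \<and>
    (\<forall>c. \<forall>x\<in>M. \<tau> (scalar_op c o\<^sub>L x) = c * \<tau> x) \<and>
    (\<forall>x\<in>M. \<tau> (adj x o\<^sub>L x) \<in> \<real>\<^sub>\<ge>\<^sub>0) \<and>
    \<tau> id_blinfun = 1 \<and>
    (\<forall>x\<in>M. \<tau> (adj x o\<^sub>L x) = 0 \<longrightarrow> x = 0) \<and>
    (\<forall>x\<in>M. \<forall>y\<in>M. \<tau> (x o\<^sub>L y) = \<tau> (y o\<^sub>L x)) \<and>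
    normal_functional M \<tau>"

section \<open>Spaces determined up to a unique unitary\<close>

text \<open>\<open>L\<^sup>2(M, \<tau>)\<close> is the completion of \<open>M\<close> for \<open>\<tau>(x\<^sup>*y)\<close>, with canonical map \<open>\<iota>\<close>.\<close>

definition l2_space :: "('a::complex_hilbert) bop set \<Rightarrow> ('a bop \<Rightarrow> complex) \<Rightarrow>
    ('a bop \<Rightarrow> 'l::complex_hilbert) \<Rightarrow> bool" where
  "l2_space M \<tau> \<iota> \<longleftrightarrow>
    (\<forall>x\<in>M. \<forall>y\<in>M. \<iota> (x + y) = \<iota> x + \<iota> y) \<and>
    (\<forall>c. \<forall>x\<in>M. \<iota> (scalar_op c o\<^sub>L x) = c *\<^sub>C \<iota> x) \<and>
    (\<forall>x\<in>M. \<forall>y\<in>M. cinner (\<iota> x) (\<iota> y) = \<tau> (adj x o\<^sub>L y)) \<and>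
    closure (\<iota> ` M) = UNIV"

definition complexification ::
    "('r::real_inner \<Rightarrow> 'h::complex_hilbert) \<Rightarrow> bool" where
  "complexification \<kappa> \<longleftrightarrow> linear \<kappa> \<and>
    (\<forall>r s. cinner (\<kappa> r) (\<kappa> s) = complex_of_real (inner r s)) \<and>
    (\<forall>h. \<exists>r s. h = \<kappa> r + \<i> *\<^sub>C \<kappa> s)"

text \<open>Real spans suffice below, as the set of elementary tensors is closed under \<open>*\<^sub>C\<close>.\<close>

definition hilbert_tensor :: "('a::complex_hilbert \<Rightarrow> 'b::complex_hilbert \<Rightarrow>
    't::complex_hilbert) \<Rightarrow> bool" where
  "hilbert_tensor T \<longleftrightarrow>
    (\<forall>a a' b. T (a + a') b = T a b + T a' b) \<and>
    (\<forall>a b b'. T a (b + b') = T a b + T a b') \<and>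
    (\<forall>c a b. T (c *\<^sub>C a) b = c *\<^sub>C T a b \<and> T a (c *\<^sub>C b) = c *\<^sub>C T a b) \<and>
    (\<forall>a b a' b'. cinner (T a b) (T a' b') = cinner a a' * cinner b b') \<and>
    closure (span {T a b | a b. True}) = UNIV"

definition hilbert_tensor3 :: "('a::complex_hilbert \<Rightarrow> 'b::complex_hilbert \<Rightarrow>
    'c::complex_hilbert \<Rightarrow> 'w::complex_hilbert) \<Rightarrow> bool" where
  "hilbert_tensor3 T \<longleftrightarrow>
    (\<forall>a a' h b. T (a + a') h b = T a h b + T a' h b) \<and>
    (\<forall>a h h' b. T a (h + h') b = T a h b + T a h' b) \<and>
    (\<forall>a h b b'. T a h (b + b') = T a h b + T a h b') \<and>
    (\<forall>c a h b. T (c *\<^sub>C a) h b = c *\<^sub>C T a h b \<and> T a (c *\<^sub>C h) b = c *\<^sub>C T a h b \<and>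
      T a h (c *\<^sub>C b) = c *\<^sub>C T a h b) \<and>
    (\<forall>a h b a' h' b'. cinner (T a h b) (T a' h' b') =
      cinner a a' * cinner h h' * cinner b b') \<and>
    closure (span {T a h b | a h b. True}) = UNIV"

section \<open>Derivations and the associated Laplacian\<close>

text \<open>\<open>L\<^sup>2(M\<^sup>o\<^sup>p)\<close> is identified with \<open>L\<^sup>2(M)\<close> by the linear unitary \<open>b\<^sup>o\<^sup>p \<mapsto> b\<close> (\<open>\<tau>\<close> is a trace).
  Accordingly \<open>tens\<close> maps into \<open>L\<^sup>2(M) \<otimes> L\<^sup>2(M\<^sup>o\<^sup>p)\<close>, which is \<open>L\<^sup>2(M \<otimes> M\<^sup>o\<^sup>p, \<tau> \<otimes> \<tau>\<^sup>o\<^sup>p)\<close> for the von Neumann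
  algebra tensor product, and \<open>tens3\<close> maps into \<open>L\<^sup>2(M) \<otimes> H \<otimes> L\<^sup>2(M\<^sup>o\<^sup>p)\<close>, where \<open>H\<close>
  is the complexification \<open>cplx\<close> of the real space \<open>'r\<close>.
  Only the values of \<open>der\<close> on \<open>ddom\<close> are relevant.\<close>

record (overloaded) ('k::complex_hilbert, 'r::"{real_inner, polish_space}", 'h::complex_hilbert,
    'l::complex_hilbert, 't::complex_hilbert, 'w::complex_hilbert) derivation_data =
  alg :: "'k bop set"
  trace :: "'k bop \<Rightarrow> complex"
  l2 :: "'k bop \<Rightarrow> 'l"
  cplx :: "'r \<Rightarrow> 'h"
  tens :: "'l \<Rightarrow> 'l \<Rightarrow> 't"
  tens3 :: "'l \<Rightarrow> 'h \<Rightarrow> 'l \<Rightarrow> 'w"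
  ddom :: "'k bop set"
  der :: "'k bop \<Rightarrow> 'w"

definition bimod :: "('k::complex_hilbert, 'r::{real_inner, polish_space}, 'h::complex_hilbert,
    'l::complex_hilbert, 't::complex_hilbert, 'w::complex_hilbert) derivation_data \<Rightarrow>
    'k bop \<Rightarrow> 'w \<Rightarrow> 'k bop \<Rightarrow> 'w" where
  "bimod S x \<xi> y = blinfun_apply (THE B. \<forall>a\<in>alg S. \<forall>h. \<forall>b\<in>alg S.
      blinfun_apply B (tens3 S (l2 S a) h (l2 S b)) =
      tens3 S (l2 S (x o\<^sub>L a)) h (l2 S (b o\<^sub>L y))) \<xi>"

definition tracial_setting :: "('k::complex_hilbert, 'r::{real_inner, polish_space},
    'h::complex_hilbert, 'l::complex_hilbert, 't::complex_hilbert, 'w::complex_hilbert)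
    derivation_data \<Rightarrow> bool" where
  "tracial_setting S \<longleftrightarrow>
    von_neumann_algebra (alg S) \<and> faithful_normal_tracial_state (alg S) (trace S) \<and>
    l2_space (alg S) (trace S) (l2 S) \<and> complexification (cplx S) \<and>
    hilbert_tensor (tens S) \<and> hilbert_tensor3 (tens3 S)"

definition is_derivation :: "('k::complex_hilbert, 'r::{real_inner, polish_space},
    'h::complex_hilbert, 'l::complex_hilbert, 't::complex_hilbert, 'w::complex_hilbert)
    derivation_data \<Rightarrow> bool" where
  "is_derivation S \<longleftrightarrow>
    ddom S \<subseteq> alg S \<and> weakly_dense_in (ddom S) (alg S) \<and>
    (\<forall>x\<in>ddom S. \<forall>y\<in>ddom S. x + y \<in> ddom S \<and> x o\<^sub>L y \<in> ddom S) \<and>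
    (\<forall>x\<in>ddom S. adj x \<in> ddom S \<and> (\<forall>c. scalar_op c o\<^sub>L x \<in> ddom S)) \<and>
    (\<forall>x\<in>ddom S. \<forall>y\<in>ddom S. der S (x + y) = der S x + der S y) \<and>
    (\<forall>c. \<forall>x\<in>ddom S. der S (scalar_op c o\<^sub>L x) = c *\<^sub>C der S x) \<and>
    (\<forall>x\<in>ddom S. \<forall>y\<in>ddom S.
      der S (x o\<^sub>L y) = bimod S x (der S y) id_blinfun + bimod S id_blinfun (der S x) y)"

definition closable_derivation :: "('k::complex_hilbert, 'r::{real_inner, polish_space},
    'h::complex_hilbert, 'l::complex_hilbert, 't::complex_hilbert, 'w::complex_hilbert)
    derivation_data \<Rightarrow> bool" where
  "closable_derivation S \<longleftrightarrow> is_derivation S \<and>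
    (\<forall>X w. (\<forall>n. X n \<in> ddom S) \<longrightarrow> (\<lambda>n. l2 S (X n)) \<longlonglongrightarrow> 0 \<longrightarrow>
      (\<lambda>n. der S (X n)) \<longlonglongrightarrow> w \<longrightarrow> w = 0)"

definition real_derivation :: "('k::complex_hilbert, 'r::{real_inner, polish_space},
    'h::complex_hilbert, 'l::complex_hilbert, 't::complex_hilbert, 'w::complex_hilbert)
    derivation_data \<Rightarrow> bool" where
  "real_derivation S \<longleftrightarrow> (\<forall>x\<in>ddom S. \<forall>y\<in>ddom S. \<forall>z\<in>ddom S.
    cinner (der S x) (bimod S y (der S z) id_blinfun) =
    cinner (bimod S id_blinfun (der S (adj z)) (adj y)) (der S (adj x)))"

text \<open>Unbounded operators are given by their graphs.\<close>

definition op_app :: "('a \<times> 'b) set \<Rightarrow> 'a \<Rightarrow> 'b" where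
  "op_app G v = (THE w. (v, w) \<in> G)"

definition op_adj :: "('a::complex_hilbert \<times> 'b::complex_hilbert) set \<Rightarrow> ('b \<times> 'a) set" where
  "op_adj G = {(w, u). \<forall>(v, z)\<in>G. cinner w z = cinner u v}"

definition der_closure :: "('k::complex_hilbert, 'r::{real_inner, polish_space},
    'h::complex_hilbert, 'l::complex_hilbert, 't::complex_hilbert, 'w::complex_hilbert)
    derivation_data \<Rightarrow> ('l \<times> 'w) set" where
  "der_closure S = closure ((\<lambda>x. (l2 S x, der S x)) ` ddom S)"

definition laplacian :: "('k::complex_hilbert, 'r::{real_inner, polish_space},
    'h::complex_hilbert, 'l::complex_hilbert, 't::complex_hilbert, 'w::complex_hilbert)
    derivation_data \<Rightarrow> ('l \<times> 'l) set" where
  "laplacian S = der_closure S O op_adj (der_closure S)"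

text \<open>Eigenspaces of \<open>\<Delta>\<close> are mutually orthogonal, \<open>\<Delta>\<close> being symmetric, so density of the span
  of their union is the Hilbert sum decomposition.\<close>

definition pure_point_spectrum :: "('l::complex_hilbert \<times> 'l) set \<Rightarrow> (nat \<Rightarrow> real) \<Rightarrow> bool" where
  "pure_point_spectrum G ev \<longleftrightarrow> strict_mono ev \<and> (\<forall>k. 0 \<le> ev k) \<and>
    closure (span (\<Union>k. {v. (v, ev k *\<^sub>R v) \<in> G})) = UNIV"

text \<open>Moore--Penrose inverse.\<close>

definition pseudo_inverse :: "('l::complex_hilbert \<times> 'l) set \<Rightarrow> 'l \<Rightarrow> 'l" where
  "pseudo_inverse G v = (THE y. (\<forall>z. (z, 0) \<in> G \<longrightarrow> cinner z y = 0) \<and>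
    (\<exists>u. (y, u) \<in> G \<and> (\<forall>r\<in>Range G. cinner r (v - u) = 0)))"

text \<open>The trace extends to \<open>L\<^sup>2(M)\<close> as the inner product with \<open>1\<close>, so the last condition reads
  \<open>\<Delta> \<Delta>\<^sup>-\<^sup>1 v = v - \<tau>(v) 1\<close>.\<close>

definition fourth_moment_diffusive_structure ::
    "('k::complex_hilbert, 'r::{real_inner, polish_space}, 'h::complex_hilbert,
    'l::complex_hilbert, 't::complex_hilbert, 'w::complex_hilbert) derivation_data \<Rightarrow> bool" where
  "fourth_moment_diffusive_structure S \<longleftrightarrow>
    tracial_setting S \<and> closable_derivation S \<and> real_derivation S \<and>
    (\<exists>ev. pure_point_spectrum (laplacian S) ev) \<and>
    (\<forall>v. (pseudo_inverse (laplacian S) v,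
      v - cinner (l2 S id_blinfun) v *\<^sub>C l2 S id_blinfun) \<in> laplacian S)"

section \<open>Carre du champ\<close>

text \<open>A list \<open>[(a\<^sub>1, h\<^sub>1, b\<^sub>1), \<dots>]\<close> stands for the sum of the \<open>a\<^sub>i \<otimes> h\<^sub>i \<otimes> b\<^sub>i\<close>.
  On such sums, the pairing over \<open>H\<close> combined with \<open>(a \<otimes> b) \<sharp> (c \<otimes> d)\<^sup>* = a c\<^sup>* \<otimes> d\<^sup>* b\<close>
  takes values in \<open>M \<otimes> M\<^sup>o\<^sup>p\<close>; it is linear in the first and antilinear in the second argument.\<close>

definition tens3_sum :: "('k::complex_hilbert, 'r::{real_inner, polish_space},
    'h::complex_hilbert, 'l::complex_hilbert, 't::complex_hilbert, 'w::complex_hilbert)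
    derivation_data \<Rightarrow> ('k bop \<times> 'h \<times> 'k bop) list \<Rightarrow> 'w" where
  "tens3_sum S xs = (\<Sum>(a, h, b)\<leftarrow>xs. tens3 S (l2 S a) h (l2 S b))"

definition sharp_sum :: "('k::complex_hilbert, 'r::{real_inner, polish_space},
    'h::complex_hilbert, 'l::complex_hilbert, 't::complex_hilbert, 'w::complex_hilbert)
    derivation_data \<Rightarrow> ('k bop \<times> 'h \<times> 'k bop) list \<Rightarrow> ('k bop \<times> 'h \<times> 'k bop) list \<Rightarrow> 't" where
  "sharp_sum S xs ys = (\<Sum>(a, h, b)\<leftarrow>xs. \<Sum>(c, g, d)\<leftarrow>ys.
    cinner g h *\<^sub>C tens S (l2 S (a o\<^sub>L adj c)) (l2 S (adj d o\<^sub>L b)))"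

text \<open>For general \<open>\<xi>\<close> and \<open>\<eta>\<close> the product is only in \<open>L\<^sup>1(M \<otimes> M\<^sup>o\<^sup>p)\<close>. An element \<open>A\<close> of
  that space is represented by the numbers \<open>(\<tau> \<otimes> \<tau>\<^sup>o\<^sup>p)(A\<^sup>* (a \<otimes> b))\<close> with \<open>a\<close>, \<open>b\<close> in \<open>M\<close>, which
  determine it since such \<open>a \<otimes> b\<close> span a weakly dense subalgebra; for \<open>A\<close> in \<open>L\<^sup>2\<close> they are
  the inner products of \<open>A\<close> with \<open>a \<otimes> b\<close>.
  The product is extended from algebraic tensors by continuity.\<close>

definition sharp_L1 :: "('k::complex_hilbert, 'r::{real_inner, polish_space},
    'h::complex_hilbert, 'l::complex_hilbert, 't::complex_hilbert, 'w::complex_hilbert)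
    derivation_data \<Rightarrow> 'w \<Rightarrow> 'w \<Rightarrow> 'k bop \<Rightarrow> 'k bop \<Rightarrow> complex" where
  "sharp_L1 S \<xi> \<eta> a b = (THE c. \<forall>e>0. \<exists>r>0.
    \<forall>xs \<in> lists (alg S \<times> UNIV \<times> alg S). \<forall>ys \<in> lists (alg S \<times> UNIV \<times> alg S).
      norm (tens3_sum S xs - \<xi>) < r \<longrightarrow> norm (tens3_sum S ys - \<eta>) < r \<longrightarrow>
      cmod (cinner (sharp_sum S xs ys) (tens S (l2 S a) (l2 S b)) - c) < e)"

definition carre_du_champ :: "('k::complex_hilbert, 'r::{real_inner, polish_space},
    'h::complex_hilbert, 'l::complex_hilbert, 't::complex_hilbert, 'w::complex_hilbert)
    derivation_data \<Rightarrow> 'l \<Rightarrow> 'l \<Rightarrow> 'k bop \<Rightarrow> 'k bop \<Rightarrow> complex" where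
  "carre_du_champ S x y =
    sharp_L1 S (op_app (der_closure S) x) (op_app (der_closure S) y)"

definition represents_L1 :: "('k::complex_hilbert, 'r::{real_inner, polish_space},
    'h::complex_hilbert, 'l::complex_hilbert, 't::complex_hilbert, 'w::complex_hilbert)
    derivation_data \<Rightarrow> 't \<Rightarrow> ('k bop \<Rightarrow> 'k bop \<Rightarrow> complex) \<Rightarrow> bool" where
  "represents_L1 S A \<phi> \<longleftrightarrow>
    (\<forall>a\<in>alg S. \<forall>b\<in>alg S. cinner A (tens S (l2 S a) (l2 S b)) = \<phi> a b)"

section \<open>Non-commutative polynomials and free Stein kernels\<close>

text \<open>Words in \<open>t\<^sub>0, \<dots>, t\<^sub>n\<^sub>-\<^sub>1\<close> are lists of indices.\<close>

type_synonym ncpoly = "nat list \<Rightarrow>\<^sub>0 complex"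

definition ncpolys :: "nat \<Rightarrow> ncpoly set" where
  "ncpolys n = {p. Poly_Mapping.keys p \<subseteq> lists {..<n}}"

text \<open>A pair \<open>(u, v)\<close> stands for \<open>u \<otimes> v\<^sup>o\<^sup>p\<close>.\<close>

definition free_diff :: "nat \<Rightarrow> ncpoly \<Rightarrow> nat list \<times> nat list \<Rightarrow>\<^sub>0 complex" where
  "free_diff j p = (\<Sum>w\<in>Poly_Mapping.keys p. \<Sum>k | k < length w \<and> w ! k = j.
    Poly_Mapping.single (take k w, drop (Suc k) w) (Poly_Mapping.lookup p w))"

definition cyclic_diff :: "nat \<Rightarrow> ncpoly \<Rightarrow> ncpoly" where
  "cyclic_diff j p = (\<Sum>w\<in>Poly_Mapping.keys p. \<Sum>k | k < length w \<and> w ! k = j.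
    Poly_Mapping.single (drop (Suc k) w @ take k w) (Poly_Mapping.lookup p w))"

definition semicircular_potential :: "nat \<Rightarrow> ncpoly" where
  "semicircular_potential n = (\<Sum>i<n. Poly_Mapping.single [i, i] (1 / 2))"

definition word_eval :: "(nat \<Rightarrow> ('k::complex_hilbert) bop) \<Rightarrow> nat list \<Rightarrow> 'k bop" where
  "word_eval F w = foldr (\<lambda>i T. F i o\<^sub>L T) w id_blinfun"

definition poly_eval :: "(nat \<Rightarrow> ('k::complex_hilbert) bop) \<Rightarrow> ncpoly \<Rightarrow> 'k bop" where
  "poly_eval F p = (\<Sum>w\<in>Poly_Mapping.keys p.
    scalar_op (Poly_Mapping.lookup p w) o\<^sub>L word_eval F w)"

definition bipoly_eval :: "('k::complex_hilbert, 'r::{real_inner, polish_space},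
    'h::complex_hilbert, 'l::complex_hilbert, 't::complex_hilbert, 'w::complex_hilbert)
    derivation_data \<Rightarrow> (nat \<Rightarrow> 'k bop) \<Rightarrow> (nat list \<times> nat list \<Rightarrow>\<^sub>0 complex) \<Rightarrow> 't" where
  "bipoly_eval S F q = (\<Sum>(u, v)\<in>Poly_Mapping.keys q.
    Poly_Mapping.lookup q (u, v) *\<^sub>C tens S (l2 S (word_eval F u)) (l2 S (word_eval F v)))"

definition L1_pairing :: "('k::complex_hilbert bop \<Rightarrow> 'k bop \<Rightarrow> complex) \<Rightarrow>
    (nat \<Rightarrow> 'k bop) \<Rightarrow> (nat list \<times> nat list \<Rightarrow>\<^sub>0 complex) \<Rightarrow> complex" where
  "L1_pairing \<phi> F q = (\<Sum>(u, v)\<in>Poly_Mapping.keys q.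
    Poly_Mapping.lookup q (u, v) * \<phi> (word_eval F u) (word_eval F v))"

text \<open>An \<open>L\<^sup>2\<close> matrix over \<open>M \<otimes> M\<^sup>o\<^sup>p\<close> is a matrix of elements of \<open>L\<^sup>2(M \<otimes> M\<^sup>o\<^sup>p)\<close>; square
  integrability is built into the type of \<open>A\<close>.\<close>

definition free_stein_kernel :: "('k::complex_hilbert, 'r::{real_inner, polish_space},
    'h::complex_hilbert, 'l::complex_hilbert, 't::complex_hilbert, 'w::complex_hilbert)
    derivation_data \<Rightarrow> nat \<Rightarrow> (nat \<Rightarrow> 'k bop) \<Rightarrow> ncpoly \<Rightarrow> (nat \<Rightarrow> nat \<Rightarrow> 't) \<Rightarrow> bool" where
  "free_stein_kernel S n F V A \<longleftrightarrow> (\<forall>P. (\<forall>i<n. P i \<in> ncpolys n) \<longrightarrow>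
    (\<Sum>i<n. trace S (adj (poly_eval F (cyclic_diff i V)) o\<^sub>L poly_eval F (P i))) =
    (\<Sum>i<n. \<Sum>j<n. cinner (A i j) (bipoly_eval S F (free_diff j (P i)))))"

text \<open>The same identity for a matrix with entries in \<open>L\<^sup>1(M \<otimes> M\<^sup>o\<^sup>p)\<close>, which makes sense since
  \<open>F\<close> is bounded.\<close>

definition free_stein_identity_L1 :: "('k::complex_hilbert, 'r::{real_inner, polish_space},
    'h::complex_hilbert, 'l::complex_hilbert, 't::complex_hilbert, 'w::complex_hilbert)
    derivation_data \<Rightarrow> nat \<Rightarrow> (nat \<Rightarrow> 'k bop) \<Rightarrow> ncpoly \<Rightarrow>
    (nat \<Rightarrow> nat \<Rightarrow> 'k bop \<Rightarrow> 'k bop \<Rightarrow> complex) \<Rightarrow> bool" where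
  "free_stein_identity_L1 S n F V \<Phi> \<longleftrightarrow> (\<forall>P. (\<forall>i<n. P i \<in> ncpolys n) \<longrightarrow>
    (\<Sum>i<n. trace S (adj (poly_eval F (cyclic_diff i V)) o\<^sub>L poly_eval F (P i))) =
    (\<Sum>i<n. \<Sum>j<n. L1_pairing (\<Phi> i j) F (free_diff j (P i))))"

end

theory Submission
  imports Defs
begin

text \<open>Write \<open>\<delta>\<close> for the closed derivation, \<open>\<Delta> = \<delta>\<^sup>*\<delta>\<close>, and \<open>y\<^sub>i = \<Delta>\<^sup>-\<^sup>1 F\<^sub>i\<close>. Since \<open>F\<^sub>i\<close> is centered,
  \<open>\<Delta> y\<^sub>i = F\<^sub>i\<close>, and integration by parts gives for a polynomial \<open>p\<close>
  \<open>\<langle>F\<^sub>i, p(F)\<rangle> = \<langle>\<delta>\<^sup>*\<delta>(y\<^sub>i), p(F)\<rangle> = \<langle>\<delta>(y\<^sub>i), \<delta>(p(F))\<rangle>\<close>.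
  The product rule expands \<open>\<delta>(w(F))\<close>, for a word \<open>w = a t\<^sub>j b\<close>, into the sum over the positions of its
  letters of \<open>a(F) \<delta>(F\<^sub>j) b(F)\<close>, that is, into \<open>\<Sum>\<^sub>j \<partial>\<^sub>j w (F) \<sharp> \<delta>(F\<^sub>j)\<close>. The pairing
  \<open>\<langle>\<delta> y\<^sub>i, a \<delta>(F\<^sub>j) b\<rangle>\<close> is the value of \<open>\<Gamma>(y\<^sub>i, F\<^sub>j)\<close> on \<open>a \<otimes> b\<close> (\<open>sharp_L1_eq\<close>), so this is the Stein
  identity. Words \<open>w \<noteq> []\<close> suffice, because both sides vanish on constants.

  Two points need work. The first is the bimodule: that \<open>a \<otimes> h \<otimes> b \<mapsto> xa \<otimes> h \<otimes> by\<close> is bounded, with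
  norm at most \<open>\<parallel>x\<parallel> \<parallel>y\<parallel>\<close>, is deduced in \<open>norm_act\<close> from the growth of the iterates of a symmetric
  operator (\<open>norm_symmetric_le_growth\<close>).

  The second, and main, point is the product rule itself. The variables \<open>F\<^sub>j\<close> are bounded operators
  in the domain of the closure of \<open>\<delta>\<close>, and a priori they are only \<open>L\<^sup>2\<close>-limits of elements \<open>x\<^sub>n\<close> of
  the original domain, with \<open>\<delta>(x\<^sub>n)\<close> convergent but \<open>\<parallel>x\<^sub>n\<parallel>\<close> unbounded; products of such sequences
  need not converge. For a self-adjoint \<open>x\<close> and \<open>l > 0\<close> put \<open>r = (x + i l)\<^sup>-\<^sup>1\<close>. The function
  \<open>f(t) = i l t / (t + i l)\<close> is bounded by \<open>l\<close>, converges to \<open>t\<close> as \<open>l \<rightarrow> \<infinity>\<close>, and has the factorized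
  difference quotient \<open>(i l)\<^sup>2 / ((s + i l) (t + i l))\<close>, so that
  \<open>\<delta>(f(x)) = (i l)\<^sup>2 r \<delta>(x) r\<close>.
  As \<open>\<parallel>r\<parallel> \<le> 1/l\<close> and \<open>r\<close> depends \<open>L\<^sup>2\<close>-continuously on \<open>x\<close>, this formula passes from the \<open>x\<^sub>n\<close> to
  their limit, and then \<open>l \<rightarrow> \<infinity>\<close> recovers the limit itself (\<open>has_der_selfadjoint\<close>). Hence all \<open>F\<^sub>j\<close> are
  reached by iterated limits along norm-bounded sequences, and along those the product rule is stable
  (\<open>has_der_compose\<close>).

  The approximants \<open>x\<^sub>n\<close> have to be self-adjoint. Replacing them by their real parts is possible because
  \<open>\<parallel>\<delta>(a\<^sup>*)\<parallel> = \<parallel>\<delta>(a)\<parallel>\<close>, which is the reality of \<open>\<delta>\<close> with \<open>1\<close> as middle factor; as \<open>1\<close> need not lie in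
  the domain, it is approximated there, once more through resolvents (\<open>real_at_id\<close>). That the
  domain is \<open>L\<^sup>2\<close>-dense follows from the pure point spectrum of \<open>\<Delta>\<close>.\<close>

section \<open>Complex Hilbert spaces\<close>

instance complex_hilbert \<subseteq> banach ..

lemma cinner_add_left: "cinner (u + v) w = cinner u w + cinner v w"
  for u :: "'a::complex_hilbert"
  by (metis cinner_commute cinner_add_right complex_cnj_add)

lemma cinner_scaleC_left: "cinner (c *\<^sub>C u) v = cnj c * cinner u v"
  for u :: "'a::complex_hilbert"
  by (metis cinner_commute cinner_scaleC_right complex_cnj_mult)

lemma cinner_self: "cinner u u = complex_of_real ((norm u)\<^sup>2)"
  for u :: "'a::complex_hilbert"
proof (rule complex_eqI)
  show "Re (cinner u u) = Re (complex_of_real ((norm u)\<^sup>2))"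
    by (simp add: Re_cinner power2_norm_eq_inner)
  have "Im (cinner u u) = - Im (cinner u u)"
    by (metis cinner_commute cnj.sel(2))
  then show "Im (cinner u u) = Im (complex_of_real ((norm u)\<^sup>2))" by simp
qed

lemma norm_scaleC: "norm (c *\<^sub>C u) = cmod c * norm u"
  for u :: "'a::complex_hilbert"
proof -
  have cc: "c * (cnj c * z) = (complex_of_real (cmod c))\<^sup>2 * z" for z
    using complex_norm_square [of c] by simp
  have "complex_of_real ((norm (c *\<^sub>C u))\<^sup>2) = complex_of_real ((cmod c * norm u)\<^sup>2)"
    unfolding cinner_self [symmetric] cinner_scaleC_left cinner_scaleC_right
    by (simp add: cinner_self power_mult_distrib cc)
  then have "(norm (c *\<^sub>C u))\<^sup>2 = (cmod c * norm u)\<^sup>2" using of_real_eq_iff by blast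
  then show ?thesis by simp
qed

lemma Cauchy_Schwarz_cinner: "cmod (cinner u v) \<le> norm u * norm v"
  for u :: "'a::complex_hilbert"
proof (cases "cinner u v = 0")
  case False
  \<comment> \<open>Rotating \<open>v\<close> by a phase makes the inner product real.\<close>
  define s where "s = cnj (sgn (cinner u v))"
  have s: "cmod s = 1" using False by (simp add: s_def norm_sgn)
  have "s * cinner u v = cinner u v * cnj (cinner u v) / complex_of_real (cmod (cinner u v))"
    by (simp add: s_def sgn_eq)
  also have "\<dots> = complex_of_real (cmod (cinner u v))"
    using False by (simp flip: complex_norm_square add: power2_eq_square)
  finally have "s * cinner u v = complex_of_real (cmod (cinner u v))" .
  then have "cmod (cinner u v) = Re (cinner u (s *\<^sub>C v))"
    by (simp add: cinner_scaleC_right)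
  also have "\<dots> \<le> norm u * norm (s *\<^sub>C v)"
    unfolding Re_cinner by (rule norm_cauchy_schwarz)
  finally show ?thesis by (simp add: norm_scaleC s)
qed simp

lemma bounded_bilinear_cinner:
  "bounded_bilinear (cinner :: 'a::complex_hilbert \<Rightarrow> 'a \<Rightarrow> complex)"
proof
  show "cinner (r *\<^sub>R u) v = r *\<^sub>R cinner u v" for r and u v :: 'a
    using cinner_scaleC_left [of "complex_of_real r" u v]
    by (simp add: scaleC_of_real scaleR_conv_of_real)
  show "cinner u (r *\<^sub>R v) = r *\<^sub>R cinner u v" for r and u v :: 'a
    using cinner_scaleC_right [of u "complex_of_real r" v]
    by (simp add: scaleC_of_real scaleR_conv_of_real)
  show "\<exists>K. \<forall>u v :: 'a. norm (cinner u v) \<le> norm u * norm v * K"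
    by (intro exI [of _ 1] allI) (simp add: Cauchy_Schwarz_cinner)
qed (simp_all add: cinner_add_left cinner_add_right)

interpretation cinner: bounded_bilinear cinner
  by (rule bounded_bilinear_cinner)

lemma bounded_bilinear_scaleC:
  "bounded_bilinear (scaleC :: complex \<Rightarrow> 'a::complex_hilbert \<Rightarrow> 'a)"
proof
  show "(r *\<^sub>R c) *\<^sub>C u = r *\<^sub>R c *\<^sub>C u" for r c and u :: 'a
    using scaleC_scaleC [of "complex_of_real r" c u] by (simp add: scaleC_of_real scaleR_conv_of_real)
  show "c *\<^sub>C r *\<^sub>R u = r *\<^sub>R c *\<^sub>C u" for r c and u :: 'a
    using scaleC_scaleC [of "complex_of_real r" c u] scaleC_scaleC [of c "complex_of_real r" u]
    by (simp add: scaleC_of_real mult.commute)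
  show "\<exists>K. \<forall>c (u :: 'a). norm (c *\<^sub>C u) \<le> norm c * norm u * K"
    by (intro exI [of _ 1]) (simp add: norm_scaleC)
qed (simp_all add: scaleC_add_left scaleC_add_right)

interpretation scaleC: bounded_bilinear scaleC
  by (rule bounded_bilinear_scaleC)

declare cinner.zero_left [simp] cinner.zero_right [simp] scaleC.zero_left [simp]
  scaleC.zero_right [simp]

lemma scaleC_one [simp]: "1 *\<^sub>C u = u" for u :: "'a::complex_hilbert"
  using scaleC_of_real [of 1 u] by simp

lemma cinner_eqI:
  fixes u v :: "'a::complex_hilbert"
  assumes "\<And>w. cinner u w = cinner v w"
  shows "u = v"
proof -
  have "cinner (u - v) (u - v) = 0" using assms by (simp add: cinner.diff_left)
  then show ?thesis by (simp add: cinner_self)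
qed

section \<open>Operators and adjoints\<close>

lemma blinfun_apply_scalar_op [simp]:
  "blinfun_apply (scalar_op c) v = c *\<^sub>C v"
  unfolding scalar_op_def
  by (subst bounded_linear_Blinfun_apply) (simp_all add: scaleC.bounded_linear_right)

lemma norm_scalar_op_le: "norm (scalar_op c :: 'a::complex_hilbert bop) \<le> cmod c"
  by (rule norm_blinfun_bound) (simp_all add: norm_scaleC)

lemma is_adjoint_unique:
  assumes "is_adjoint T S" "is_adjoint T S'"
  shows "S = S'"
  by (rule blinfun_eqI, rule cinner_eqI) (use assms in \<open>simp add: is_adjoint_def\<close>)

lemma adj_eq: "is_adjoint T S \<Longrightarrow> adj T = S"
  unfolding adj_def using is_adjoint_unique by blast

lemma is_adjoint_sym: "is_adjoint T S \<Longrightarrow> is_adjoint S T"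
  unfolding is_adjoint_def by (metis cinner_commute)

lemma is_adjoint_norm_le:
  assumes "is_adjoint T S"
  shows "norm S \<le> norm T"
proof (rule norm_blinfun_bound)
  fix v
  have "(norm (blinfun_apply S v))\<^sup>2 = cmod (cinner v (blinfun_apply T (blinfun_apply S v)))"
    using assms unfolding is_adjoint_def
    by (metis cinner_self norm_of_real abs_of_nonneg zero_le_power2)
  also have "\<dots> \<le> norm v * (norm T * norm (blinfun_apply S v))"
    by (rule order_trans [OF Cauchy_Schwarz_cinner]) (intro mult_left_mono norm_blinfun norm_ge_zero)
  finally have "norm (blinfun_apply S v) * norm (blinfun_apply S v)
      \<le> (norm T * norm v) * norm (blinfun_apply S v)"
    by (simp add: power2_eq_square ac_simps)
  then show "norm (blinfun_apply S v) \<le> norm T * norm v"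
    by (cases "norm (blinfun_apply S v) = 0") auto
qed simp

lemma norm_compose_le:
  assumes "norm S \<le> a" "norm T \<le> b"
  shows "norm (S o\<^sub>L T) \<le> a * b"
proof -
  have "norm (S o\<^sub>L T) \<le> norm S * norm T" by (rule norm_blinfun_compose)
  also have "\<dots> \<le> a * b"
    using assms order_trans [OF norm_ge_zero assms(1)] by (intro mult_mono) auto
  finally show ?thesis .
qed

lemmas op_simps = blinfun.bilinear_simps scaleC.add_left scaleC.add_right scaleC.diff_left
  scaleC.diff_right scaleC.minus_left scaleC.minus_right scaleC_scaleC

lemma compose_assoc: "(A o\<^sub>L B) o\<^sub>L C = A o\<^sub>L (B o\<^sub>L C)"
  by (rule blinfun_eqI) simp

lemma compose_id [simp]: "x o\<^sub>L id_blinfun = x" "id_blinfun o\<^sub>L x = x"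
  by (auto intro: blinfun_eqI)

lemma compose_add: "(A + B) o\<^sub>L C = (A o\<^sub>L C) + (B o\<^sub>L C)" "A o\<^sub>L (C + D) = (A o\<^sub>L C) + (A o\<^sub>L D)"
  by (auto intro!: blinfun_eqI simp: blinfun.bilinear_simps)

lemma compose_diff: "(A - B) o\<^sub>L C = (A o\<^sub>L C) - (B o\<^sub>L C)" "A o\<^sub>L (C - D) = (A o\<^sub>L C) - (A o\<^sub>L D)"
  by (auto intro!: blinfun_eqI simp: blinfun.bilinear_simps)

section \<open>Closures, limits and norm bounds\<close>

lemma subspace_closure:
  fixes S :: "'a::real_normed_vector set"
  assumes "subspace S"
  shows "subspace (closure S)"
proof (rule subspaceI)
  show "0 \<in> closure S" using subspace_0 [OF assms] closure_subset by blast
  show "x + y \<in> closure S" if xy: "x \<in> closure S" "y \<in> closure S" for x y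
  proof -
    obtain f g where "\<And>n. f n \<in> S" "f \<longlonglongrightarrow> x" "\<And>n. g n \<in> S" "g \<longlonglongrightarrow> y"
      using xy unfolding closure_sequential by blast
    then have "\<forall>n. f n + g n \<in> S" "(\<lambda>n. f n + g n) \<longlonglongrightarrow> x + y"
      by (simp_all add: subspace_add [OF assms] tendsto_add)
    then show ?thesis unfolding closure_sequential by (intro exI conjI)
  qed
  show "c *\<^sub>R x \<in> closure S" if x: "x \<in> closure S" for c x
  proof -
    obtain f where "\<And>n. f n \<in> S" "f \<longlonglongrightarrow> x"
      using x unfolding closure_sequential by blast
    then have "\<forall>n. c *\<^sub>R f n \<in> S" "(\<lambda>n. c *\<^sub>R f n) \<longlonglongrightarrow> c *\<^sub>R x"
      by (simp_all add: subspace_scale [OF assms] tendsto_intros)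
    then show ?thesis unfolding closure_sequential by (intro exI conjI)
  qed
qed

lemma closure_imageE:
  fixes f :: "'a \<Rightarrow> 'b::metric_space"
  assumes "y \<in> closure (f ` A)"
  obtains x where "\<And>n::nat. x n \<in> A" "(\<lambda>n. f (x n)) \<longlonglongrightarrow> y"
proof -
  obtain g where g: "\<forall>n. g n \<in> f ` A" "g \<longlonglongrightarrow> y"
    using assms unfolding closure_sequential by (elim exE conjE)
  have "\<forall>n. \<exists>x. x \<in> A \<and> f x = g n"
  proof
    fix n
    show "\<exists>x. x \<in> A \<and> f x = g n" using g(1) [rule_format, of n] by (auto simp: image_iff)
  qed
  then obtain x where "\<forall>n. x n \<in> A \<and> f (x n) = g n" by (rule choice [THEN exE])
  with g(2) show thesis by (intro that [of x]) simp_all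
qed

lemma LIMSEQ_in_closure:
  fixes y :: "'a::metric_space"
  assumes "\<And>n. f n \<in> A" "f \<longlonglongrightarrow> y"
  shows "y \<in> closure A"
  unfolding closure_sequential using assms by (intro exI [of _ f]) simp

lemma tendsto_of_norm_diff_le:
  fixes f :: "nat \<Rightarrow> 'a::real_normed_vector"
  assumes "\<And>n. norm (f n - a) \<le> g n" "g \<longlonglongrightarrow> 0"
  shows "f \<longlonglongrightarrow> a"
  by (rule Lim_null [THEN iffD2], rule Lim_null_comparison [OF _ assms(2)]) (simp add: assms(1))

lemma perturbed_geometric_tendsto_0:
  fixes e :: "nat \<Rightarrow> real"
  assumes q: "0 < q" "q < 1" and pos: "\<And>n. 0 \<le> e n" and step: "\<And>n. e (Suc n) \<le> q * e n + C * q ^ n"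
  shows "e \<longlonglongrightarrow> 0"
proof -
  have bd: "e n * q \<le> q ^ n * (q * e 0 + real n * C)" for n
  proof (induction n)
    case (Suc n)
    have "e (Suc n) * q \<le> (q * e n + C * q ^ n) * q" using step q by (intro mult_right_mono) auto
    also have "\<dots> = q * (e n * q) + C * q ^ Suc n" by (simp add: algebra_simps)
    also have "\<dots> \<le> q * (q ^ n * (q * e 0 + real n * C)) + C * q ^ Suc n"
      using Suc q by (intro add_right_mono mult_left_mono) auto
    also have "\<dots> = q ^ Suc n * (q * e 0 + real (Suc n) * C)" by (simp add: algebra_simps)
    finally show ?case .
  qed simp
  have "(\<lambda>n. (q ^ n * (q * e 0) + (real n * q ^ n) * C) / q) \<longlonglongrightarrow> (0 * (q * e 0) + 0 * C) / q"
    using q by (intro tendsto_intros LIMSEQ_power_zero powser_times_n_limit_0) auto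
  moreover have "norm (e n - 0) \<le> (q ^ n * (q * e 0) + (real n * q ^ n) * C) / q" for n
    using bd [of n] pos [of n] q by (simp add: pos_le_divide_eq algebra_simps)
  ultimately show ?thesis by (intro tendsto_of_norm_diff_le [of e 0]) simp_all
qed

text \<open>Maps given on lists that represent vectors enter as relations, because it is the norm bound
  that makes them independent of the representation. The operator is the closure of the relation;
  completeness makes it everywhere defined.\<close>

lemma bounded_extension_of_dense_relation:
  fixes R :: "('a::banach \<times> 'b::banach) set"
  assumes sub: "subspace R" and bd: "\<And>u v. (u, v) \<in> R \<Longrightarrow> norm v \<le> K * norm u"
    and dense: "closure (fst ` R) = UNIV"
  obtains B :: "'a \<Rightarrow>\<^sub>L 'b" where "\<And>u v. (u, v) \<in> R \<Longrightarrow> blinfun_apply B u = v"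
    and "\<And>u. norm (blinfun_apply B u) \<le> K * norm u"
proof -
  let ?C = "closure R"
  have subC: "subspace ?C" by (rule subspace_closure [OF sub])
  have bdC: "norm v \<le> K * norm u" if "(u, v) \<in> ?C" for u v
  proof -
    have "closed {p :: 'a \<times> 'b. norm (snd p) \<le> K * norm (fst p)}"
      by (intro closed_Collect_le continuous_intros)
    then have "?C \<subseteq> {p. norm (snd p) \<le> K * norm (fst p)}"
      by (intro closure_minimal) (auto dest: bd)
    with that show ?thesis by auto
  qed
  have ex: "\<exists>v. (u, v) \<in> ?C" for u
  proof -
    have "u \<in> closure (fst ` R)" by (simp add: dense)
    then obtain f where f: "\<And>n. f n \<in> fst ` R" "f \<longlonglongrightarrow> u"
      unfolding closure_sequential by blast
    then have "\<forall>n. \<exists>v. (f n, v) \<in> R" by force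
    then obtain g where g: "\<And>n. (f n, g n) \<in> R" by metis
    have "Cauchy f" using f(2) by (rule LIMSEQ_imp_Cauchy)
    have "Cauchy g"
    proof (rule metric_CauchyI)
      fix e :: real assume "e > 0"
      then have e': "e / (\<bar>K\<bar> + 1) > 0" by simp
      obtain M where M: "\<And>m n. m \<ge> M \<Longrightarrow> n \<ge> M \<Longrightarrow> dist (f m) (f n) < e / (\<bar>K\<bar> + 1)"
        using metric_CauchyD [OF \<open>Cauchy f\<close> e'] by blast
      have "dist (g m) (g n) < e" if mn: "m \<ge> M" "n \<ge> M" for m n
      proof -
        have "(f m - f n, g m - g n) \<in> R" using subspace_diff [OF sub g g] by simp
        then have "norm (g m - g n) \<le> K * norm (f m - f n)" by (rule bd)
        also have "\<dots> \<le> (\<bar>K\<bar> + 1) * norm (f m - f n)" by (intro mult_right_mono) auto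
        also have "\<dots> < e" using M [OF mn] by (simp add: dist_norm pos_less_divide_eq mult.commute)
        finally show ?thesis by (simp add: dist_norm)
      qed
      then show "\<exists>M. \<forall>m\<ge>M. \<forall>n\<ge>M. dist (g m) (g n) < e" by blast
    qed
    then obtain v where "g \<longlonglongrightarrow> v" using Cauchy_convergent convergent_def by blast
    with f(2) have "(\<lambda>n. (f n, g n)) \<longlonglongrightarrow> (u, v)" by (rule tendsto_Pair)
    with g have "\<exists>x. (\<forall>n. x n \<in> R) \<and> x \<longlonglongrightarrow> (u, v)"
      by (intro exI [of _ "\<lambda>n. (f n, g n)"]) simp
    then show ?thesis unfolding closure_sequential by blast
  qed
  have uniq: "v = v'" if "(u, v) \<in> ?C" "(u, v') \<in> ?C" for u v v'
  proof -
    have "(0, v - v') \<in> ?C" using subspace_diff [OF subC that] by (simp only: minus_prod_def) simp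
    then have "norm (v - v') \<le> K * norm (0 :: 'a)" by (rule bdC)
    then show ?thesis by simp
  qed
  define h where "h u = (THE v. (u, v) \<in> ?C)" for u
  have h: "(u, h u) \<in> ?C" for u
  proof -
    obtain v where "(u, v) \<in> ?C" using ex by blast
    then show ?thesis unfolding h_def by (rule theI) (rule uniq [OF _ \<open>(u, v) \<in> ?C\<close>])
  qed
  have h_eq: "h u = v" if "(u, v) \<in> ?C" for u v by (rule uniq [OF h that])
  have "bounded_linear h"
  proof (rule bounded_linear_intro)
    show "h (x + y) = h x + h y" for x y
      using subspace_add [OF subC h [of x] h [of y]] by (intro h_eq) simp
    show "h (r *\<^sub>R x) = r *\<^sub>R h x" for r x
      using subspace_scale [OF subC h [of x], of r] by (intro h_eq) simp
    show "norm (h x) \<le> norm x * K" for x using bdC [OF h [of x]] by (simp add: mult.commute)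
  qed
  then have B: "blinfun_apply (Blinfun h) = h" by (rule bounded_linear_Blinfun_apply)
  show thesis
    by (rule that [of "Blinfun h"])
       (simp_all add: B h_eq closure_subset [THEN subsetD] bdC [OF h])
qed

text \<open>A symmetric operator whose powers grow at most like \<open>K\<^sup>N\<close> on a vector is bounded by
  \<open>K\<close> on it: Cauchy--Schwarz makes \<open>N \<mapsto> \<parallel>f\<^sup>N v\<parallel>\<close> logarithmically convex along \<open>N = 2\<^sup>k\<close>. The
  vectors are indexed by a set \<open>I\<close> on which \<open>f\<close> acts, so that the operator need not be known
  to be well defined on vectors.\<close>

lemma norm_symmetric_le_growth:
  fixes \<nu> :: "'i \<Rightarrow> 'a::real_inner"
  assumes sym: "\<And>i j. i \<in> I \<Longrightarrow> j \<in> I \<Longrightarrow> inner (\<nu> (f i)) (\<nu> j) = inner (\<nu> i) (\<nu> (f j))"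
    and maps: "\<And>i. i \<in> I \<Longrightarrow> f i \<in> I" and i: "i \<in> I" and K: "K \<ge> 0"
    and growth: "\<And>N. norm (\<nu> ((f ^^ N) i)) \<le> C * K ^ N"
  shows "norm (\<nu> (f i)) \<le> K * norm (\<nu> i)"
proof (rule ccontr)
  assume "\<not> ?thesis"
  then have gt: "norm (\<nu> (f i)) > K * norm (\<nu> i)" by simp
  have pw: "(f ^^ N) j \<in> I" if "j \<in> I" for N j
    using that by (induction N) (auto intro: maps)
  have sym_pw: "inner (\<nu> ((f ^^ N) j)) (\<nu> k) = inner (\<nu> j) (\<nu> ((f ^^ N) k))"
    if "j \<in> I" "k \<in> I" for N j k
    using that by (induction N arbitrary: j k) (simp_all add: sym pw maps funpow_swap1)
  define s where "s N = norm (\<nu> ((f ^^ N) i))" for N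
  have conv: "(s N)\<^sup>2 \<le> s 0 * s (2 * N)" for N
  proof -
    have "(s N)\<^sup>2 = inner (\<nu> i) (\<nu> ((f ^^ N) ((f ^^ N) i)))"
      unfolding s_def power2_norm_eq_inner by (rule sym_pw) (simp_all add: i pw)
    also have "\<dots> = inner (\<nu> i) (\<nu> ((f ^^ (2 * N)) i))"
      by (simp add: funpow_add mult_2)
    also have "\<dots> \<le> s 0 * s (2 * N)" unfolding s_def by (simp add: norm_cauchy_schwarz)
    finally show ?thesis .
  qed
  have s0: "s 0 > 0"
    using conv [of 1] gt K unfolding s_def
    by (cases "norm (\<nu> i) = 0") auto
  define r where "r = s 1 / s 0"
  have r: "r > K" using gt s0 by (simp add: r_def s_def pos_less_divide_eq)
  have low: "s 0 * r ^ (2 ^ k) \<le> s (2 ^ k)" for k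
  proof (induction k)
    case 0
    then show ?case using s0 by (simp add: r_def)
  next
    case (Suc k)
    have "(s 0 * r ^ (2 ^ k))\<^sup>2 \<le> (s (2 ^ k))\<^sup>2"
      using Suc s0 r K by (intro power_mono) auto
    also have "\<dots> \<le> s 0 * s (2 ^ Suc k)" using conv [of "2 ^ k"] by simp
    finally have "s 0 * (s 0 * r ^ (2 ^ Suc k)) \<le> s 0 * s (2 ^ Suc k)"
      by (simp add: power2_eq_square power_mult_distrib mult_2 power_add ac_simps)
    then show ?case using s0 by simp
  qed
  have up: "s 0 * r ^ (2 ^ k) \<le> C * K ^ (2 ^ k)" for k
    using low [of k] growth [of "2 ^ k"] by (simp add: s_def)
  have K0: "K > 0"
  proof (rule ccontr)
    assume "\<not> K > 0"
    with K have "K = 0" by simp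
    with up [of 0] s0 r show False by (simp add: mult_le_0_iff)
  qed
  obtain n where n: "C / s 0 < (r / K) ^ n"
    using real_arch_pow [of "r / K" "C / s 0"] r K0 by auto
  have "(r / K) ^ n \<le> (r / K) ^ (2 ^ n)"
    using r K0 by (intro power_increasing) (auto intro: less_imp_le)
  also have "\<dots> \<le> C / s 0"
    using up [of n] s0 K0 by (simp add: power_divide divide_simps ac_simps)
  finally show False using n by simp
qed

section \<open>Tracial von Neumann algebras and their bimodules\<close>

locale tracial =
  fixes S :: "('k::complex_hilbert, 'r::{real_inner, polish_space}, 'h::complex_hilbert,
      'l::complex_hilbert, 't::complex_hilbert, 'w::complex_hilbert) derivation_data"
  assumes tracial: "tracial_setting S"
begin

abbreviation "M \<equiv> alg S"
abbreviation "\<tau> \<equiv> trace S"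
abbreviation "\<iota> \<equiv> l2 S"
abbreviation "elem \<equiv> tens3 S"

subsection \<open>The von Neumann algebra\<close>

lemma bicommutant: "commutant (commutant M) = M"
  using tracial by (simp add: tracial_setting_def von_neumann_algebra_def)

lemma complex_linear_M:
  assumes "x \<in> M"
  shows "complex_linear x"
proof -
  have "x \<in> commutant (commutant M)" using assms by (simp only: bicommutant)
  then show ?thesis by (simp add: commutant_def)
qed

lemma M_scaleC: "x \<in> M \<Longrightarrow> blinfun_apply x (c *\<^sub>C v) = c *\<^sub>C blinfun_apply x v"
  using complex_linear_M unfolding complex_linear_def by blast

lemma M_commute:
  assumes "x \<in> M" "y \<in> commutant M"
  shows "blinfun_apply x (blinfun_apply y v) = blinfun_apply y (blinfun_apply x v)"
proof -
  have "x o\<^sub>L y = y o\<^sub>L x"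
    using assms by (simp add: commutant_def)
  then have "blinfun_apply (x o\<^sub>L y) v = blinfun_apply (y o\<^sub>L x) v" by (rule arg_cong)
  then show ?thesis by simp
qed

lemma commutant_scaleC:
  "y \<in> commutant M \<Longrightarrow> blinfun_apply y (c *\<^sub>C v) = c *\<^sub>C blinfun_apply y v"
  by (simp add: commutant_def complex_linear_def)

lemma M_I:
  assumes "\<And>c v. blinfun_apply x (c *\<^sub>C v) = c *\<^sub>C blinfun_apply x v"
    and "\<And>y v. y \<in> commutant M \<Longrightarrow>
      blinfun_apply x (blinfun_apply y v) = blinfun_apply y (blinfun_apply x v)"
  shows "x \<in> M"
proof -
  have "x o\<^sub>L y = y o\<^sub>L x" if "y \<in> commutant M" for y
    by (rule blinfun_eqI) (simp add: assms(2) [OF that])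
  then have "x \<in> commutant (commutant M)"
    using assms(1) by (subst commutant_def) (simp add: complex_linear_def)
  then show ?thesis by (simp only: bicommutant)
qed

lemma id_in_M [simp]: "id_blinfun \<in> M"
  by (rule M_I) simp_all

lemma scalar_in_M [simp]: "scalar_op c \<in> M"
  by (rule M_I) (simp_all add: scaleC_scaleC mult.commute commutant_scaleC)

lemma add_in_M [simp]: "x \<in> M \<Longrightarrow> y \<in> M \<Longrightarrow> x + y \<in> M"
  by (rule M_I) (simp_all add: op_simps M_scaleC M_commute)

lemma diff_in_M [simp]: "x \<in> M \<Longrightarrow> y \<in> M \<Longrightarrow> x - y \<in> M"
  by (rule M_I) (simp_all add: op_simps M_scaleC M_commute)

lemma compose_in_M [simp]: "x \<in> M \<Longrightarrow> y \<in> M \<Longrightarrow> x o\<^sub>L y \<in> M"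
  by (rule M_I) (simp_all add: M_scaleC M_commute)

lemma is_adjoint_adj:
  assumes "x \<in> M"
  shows "is_adjoint x (adj x)" and adj_in_M [simp]: "adj x \<in> M"
proof -
  obtain y where "y \<in> M" "is_adjoint x y"
    using assms tracial by (auto simp: tracial_setting_def von_neumann_algebra_def)
  moreover from this have "adj x = y" by (simp add: adj_eq)
  ultimately show "is_adjoint x (adj x)" "adj x \<in> M" by simp_all
qed

lemma adj_cinner:
  assumes "x \<in> M"
  shows "cinner (blinfun_apply (adj x) u) v = cinner u (blinfun_apply x v)"
    and "cinner (blinfun_apply x u) v = cinner u (blinfun_apply (adj x) v)"
  using is_adjoint_adj(1) [OF assms] is_adjoint_sym [OF is_adjoint_adj(1) [OF assms]]
  by (simp_all add: is_adjoint_def)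

lemma adj_adj [simp]: "x \<in> M \<Longrightarrow> adj (adj x) = x"
  by (rule adj_eq, rule is_adjoint_sym, rule is_adjoint_adj)

lemma adj_id [simp]: "adj (id_blinfun :: 'k bop) = id_blinfun"
  by (intro adj_eq) (simp add: is_adjoint_def)

lemma adj_compose [simp]: "x \<in> M \<Longrightarrow> y \<in> M \<Longrightarrow> adj (x o\<^sub>L y) = adj y o\<^sub>L adj x"
  by (intro adj_eq) (simp add: is_adjoint_def adj_cinner)

lemma adj_add [simp]: "x \<in> M \<Longrightarrow> y \<in> M \<Longrightarrow> adj (x + y) = adj x + adj y"
  by (intro adj_eq) (simp add: is_adjoint_def adj_cinner op_simps cinner_add_left cinner_add_right)

lemma adj_scalar: "adj (scalar_op c :: 'k bop) = scalar_op (cnj c)"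
  by (intro adj_eq) (simp add: is_adjoint_def cinner_scaleC_left cinner_scaleC_right)

lemma adj_diff [simp]: "x \<in> M \<Longrightarrow> y \<in> M \<Longrightarrow> adj (x - y) = adj x - adj y"
  by (intro adj_eq)
    (simp add: is_adjoint_def adj_cinner op_simps cinner.diff_left cinner.diff_right)

lemma scalar_commute: "x \<in> M \<Longrightarrow> x o\<^sub>L scalar_op c = scalar_op c o\<^sub>L x"
  by (rule blinfun_eqI) (simp add: M_scaleC)

lemma norm_adj_le: "x \<in> M \<Longrightarrow> norm (adj x) \<le> norm x"
  by (rule is_adjoint_norm_le) (rule is_adjoint_adj)

subsection \<open>The trace and the square-integrable completion\<close>

lemma \<tau>_commute: "x \<in> M \<Longrightarrow> y \<in> M \<Longrightarrow> \<tau> (x o\<^sub>L y) = \<tau> (y o\<^sub>L x)"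
  using tracial by (simp add: tracial_setting_def faithful_normal_tracial_state_def)

text \<open>Normality enters through norm continuity, which bounds the growth of \<open>\<tau>((x\<^sup>*x)\<^sup>N)\<close>.\<close>

lemma \<tau>_bounded:
  obtains C where "C \<ge> 0" "\<And>x. x \<in> M \<Longrightarrow> cmod (\<tau> x) \<le> C * norm x"
proof -
  have "normal_functional M \<tau>"
    using tracial by (simp add: tracial_setting_def faithful_normal_tracial_state_def)
  then obtain u v where uv: "summable (\<lambda>n. (norm (u n))\<^sup>2)" "summable (\<lambda>n. (norm (v n))\<^sup>2)"
    and \<tau>: "\<And>x. x \<in> M \<Longrightarrow> (\<lambda>n::nat. cinner (u n) (blinfun_apply x (v n))) sums \<tau> x"
    unfolding normal_functional_def by auto
  let ?g = "\<lambda>n. (norm (u n))\<^sup>2 + (norm (v n))\<^sup>2"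
  have g: "summable ?g" using uv by (rule summable_add)
  have "cmod (\<tau> x) \<le> suminf ?g * norm x" if x: "x \<in> M" for x
  proof -
    have le: "cmod (cinner (u n) (blinfun_apply x (v n))) \<le> ?g n * norm x" for n
    proof -
      have "cmod (cinner (u n) (blinfun_apply x (v n))) \<le> norm (u n) * (norm x * norm (v n))"
        by (rule order_trans [OF Cauchy_Schwarz_cinner])
          (intro mult_left_mono norm_blinfun norm_ge_zero)
      also have "\<dots> = (norm (u n) * norm (v n)) * norm x" by simp
      also have "\<dots> \<le> ?g n * norm x"
      proof (rule mult_right_mono)
        have "0 \<le> norm (u n) * norm (v n)" by simp
        then show "norm (u n) * norm (v n) \<le> ?g n"
          using sum_squares_bound [of "norm (u n)" "norm (v n)"] by linarith
      qed simp
      finally show ?thesis .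
    qed
    have sm: "summable (\<lambda>n. cmod (cinner (u n) (blinfun_apply x (v n))))"
      by (rule summable_comparison_test' [OF summable_mult2 [OF g, of "norm x"], of 0])
        (simp add: le)
    have "\<tau> x = suminf (\<lambda>n. cinner (u n) (blinfun_apply x (v n)))"
      using \<tau> [OF x] by (rule sums_unique)
    then have "cmod (\<tau> x) \<le> suminf (\<lambda>n. cmod (cinner (u n) (blinfun_apply x (v n))))"
      using summable_norm [OF sm] by simp
    also have "\<dots> \<le> suminf (\<lambda>n. ?g n * norm x)"
      by (rule suminf_le [OF le sm summable_mult2 [OF g]])
    finally show ?thesis by (simp add: suminf_mult2 [OF g])
  qed
  moreover have "suminf ?g \<ge> 0" using g by (intro suminf_nonneg) auto
  ultimately show thesis using that by blast
qed

lemma l2_add: "x \<in> M \<Longrightarrow> y \<in> M \<Longrightarrow> \<iota> (x + y) = \<iota> x + \<iota> y"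
  and l2_scalar: "x \<in> M \<Longrightarrow> \<iota> (scalar_op c o\<^sub>L x) = c *\<^sub>C \<iota> x"
  and cinner_l2: "x \<in> M \<Longrightarrow> y \<in> M \<Longrightarrow> cinner (\<iota> x) (\<iota> y) = \<tau> (adj x o\<^sub>L y)"
  and l2_dense: "closure (\<iota> ` M) = UNIV"
  using tracial by (auto simp: tracial_setting_def l2_space_def)

lemma l2_diff:
  assumes "x \<in> M" "y \<in> M"
  shows "\<iota> (x - y) = \<iota> x - \<iota> y"
  using l2_add [of "x - y" y] assms by simp

lemma cinner_l2_left: "x \<in> M \<Longrightarrow> a \<in> M \<Longrightarrow> b \<in> M \<Longrightarrow>
    cinner (\<iota> (x o\<^sub>L a)) (\<iota> b) = cinner (\<iota> a) (\<iota> (adj x o\<^sub>L b))"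
  by (simp add: cinner_l2 compose_assoc)

lemma cinner_l2_right: "x \<in> M \<Longrightarrow> a \<in> M \<Longrightarrow> b \<in> M \<Longrightarrow>
    cinner (\<iota> (a o\<^sub>L x)) (\<iota> b) = cinner (\<iota> a) (\<iota> (b o\<^sub>L adj x))"
  by (simp add: cinner_l2 compose_assoc) (metis \<tau>_commute compose_assoc adj_in_M compose_in_M)

lemma norm_l2_adj:
  assumes "x \<in> M"
  shows "norm (\<iota> (adj x)) = norm (\<iota> x)"
proof -
  have "complex_of_real ((norm (\<iota> (adj x)))\<^sup>2) = complex_of_real ((norm (\<iota> x))\<^sup>2)"
    unfolding cinner_self [symmetric] using assms \<tau>_commute [of x "adj x"] by (simp add: cinner_l2)
  then have "(norm (\<iota> (adj x)))\<^sup>2 = (norm (\<iota> x))\<^sup>2" using of_real_eq_iff by blast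
  then show ?thesis by simp
qed

lemma norm_l2_le:
  obtains C where "C \<ge> 0" "\<And>x. x \<in> M \<Longrightarrow> norm (\<iota> x) \<le> C * norm x"
proof -
  obtain C where C: "C \<ge> 0" "\<And>x. x \<in> M \<Longrightarrow> cmod (\<tau> x) \<le> C * norm x"
    using \<tau>_bounded by blast
  have "norm (\<iota> x) \<le> sqrt C * norm x" if x: "x \<in> M" for x
  proof (rule power2_le_imp_le)
    have "(norm (\<iota> x))\<^sup>2 = cmod (\<tau> (adj x o\<^sub>L x))"
      using cinner_self [of "\<iota> x"] x by (metis cinner_l2 norm_of_real abs_of_nonneg zero_le_power2)
    also have "\<dots> \<le> C * norm (adj x o\<^sub>L x)" using x by (intro C) simp
    also have "\<dots> \<le> C * (norm x * norm x)"
      using C(1) x by (intro mult_left_mono norm_compose_le norm_adj_le) auto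
    finally show "(norm (\<iota> x))\<^sup>2 \<le> (sqrt C * norm x)\<^sup>2"
      using C(1) by (simp add: power_mult_distrib) (simp add: power2_eq_square)
  qed (use C(1) in simp)
  then show thesis using that C(1) by (meson real_sqrt_ge_zero)
qed

text \<open>The bound \<open>\<tau>(a\<^sup>*x\<^sup>*xa) \<le> \<parallel>x\<parallel>\<^sup>2 \<tau>(a\<^sup>*a)\<close> comes from the growth of \<open>(x\<^sup>*x)\<^sup>N a\<close>, whose
  \<open>L\<^sup>2\<close>-norm is at most a constant times its operator norm.\<close>

lemma norm_l2_compose_left:
  assumes x: "x \<in> M" and a: "a \<in> M"
  shows "norm (\<iota> (x o\<^sub>L a)) \<le> norm x * norm (\<iota> a)"
proof (rule power2_le_imp_le)
  obtain C where C: "C \<ge> 0" "\<And>x. x \<in> M \<Longrightarrow> norm (\<iota> x) \<le> C * norm x"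
    using norm_l2_le by blast
  define f where "f b = (adj x o\<^sub>L x) o\<^sub>L b" for b :: "'k bop"
  have fM: "f b \<in> M" if "b \<in> M" for b using that x by (simp add: f_def)
  have pw: "(f ^^ N) a \<in> M \<and> norm ((f ^^ N) a) \<le> ((norm x)\<^sup>2) ^ N * norm a" for N
  proof (induction N)
    case (Suc N)
    have "norm (f b) \<le> (norm x * norm x) * norm b" for b
      unfolding f_def using x by (intro norm_compose_le norm_adj_le) auto
    then have "norm (f ((f ^^ N) a)) \<le> (norm x * norm x) * norm ((f ^^ N) a)" .
    also have "\<dots> \<le> (norm x * norm x) * (((norm x)\<^sup>2) ^ N * norm a)"
      using Suc by (intro mult_left_mono) auto
    finally have "norm (f ((f ^^ N) a)) \<le> (norm x * norm x) * (((norm x)\<^sup>2) ^ N * norm a)" .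
    then show ?case using Suc fM by (simp add: power2_eq_square ac_simps)
  qed (simp add: a)
  have "norm (\<iota> (f a)) \<le> (norm x)\<^sup>2 * norm (\<iota> a)"
  proof (rule norm_symmetric_le_growth [where I = M and C = "C * norm a"])
    show "inner (\<iota> (f i)) (\<iota> j) = inner (\<iota> i) (\<iota> (f j))" if "i \<in> M" "j \<in> M" for i j
      using that x unfolding Re_cinner [symmetric] f_def by (simp add: cinner_l2_left compose_assoc)
    show "norm (\<iota> ((f ^^ N) a)) \<le> C * norm a * ((norm x)\<^sup>2) ^ N" for N
    proof -
      have "norm (\<iota> ((f ^^ N) a)) \<le> C * norm ((f ^^ N) a)" using pw by (intro C) blast
      also have "\<dots> \<le> C * (((norm x)\<^sup>2) ^ N * norm a)" using pw C(1) by (intro mult_left_mono) auto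
      finally show ?thesis by (simp add: ac_simps)
    qed
  qed (use a fM in auto)
  moreover have "(norm (\<iota> (x o\<^sub>L a)))\<^sup>2 = cmod (cinner (\<iota> a) (\<iota> (f a)))"
  proof -
    have "cinner (\<iota> (x o\<^sub>L a)) (\<iota> (x o\<^sub>L a)) = cinner (\<iota> a) (\<iota> (f a))"
      using x a by (simp add: cinner_l2_left f_def compose_assoc)
    then show ?thesis by (metis cinner_self norm_of_real abs_of_nonneg zero_le_power2)
  qed
  moreover have "cmod (cinner (\<iota> a) (\<iota> (f a))) \<le> norm (\<iota> a) * norm (\<iota> (f a))"
    by (rule Cauchy_Schwarz_cinner)
  moreover have "norm (\<iota> a) * norm (\<iota> (f a)) \<le> norm (\<iota> a) * ((norm x)\<^sup>2 * norm (\<iota> a))"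
    using calculation(1) by (rule mult_left_mono) simp
  ultimately show "(norm (\<iota> (x o\<^sub>L a)))\<^sup>2 \<le> (norm x * norm (\<iota> a))\<^sup>2"
    by (simp add: power2_eq_square ac_simps)
qed simp

lemma norm_l2_compose_right:
  assumes x: "x \<in> M" and a: "a \<in> M"
  shows "norm (\<iota> (a o\<^sub>L x)) \<le> norm (\<iota> a) * norm x"
proof -
  have "norm (\<iota> (a o\<^sub>L x)) = norm (\<iota> (adj x o\<^sub>L adj a))"
    using norm_l2_adj [of "a o\<^sub>L x"] x a by simp
  also have "\<dots> \<le> norm (adj x) * norm (\<iota> (adj a))"
    using x a by (intro norm_l2_compose_left) auto
  also have "\<dots> \<le> norm x * norm (\<iota> a)"
    using x a by (simp add: norm_l2_adj norm_adj_le mult_right_mono)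
  finally show ?thesis by (simp add: mult.commute)
qed

subsection \<open>The bimodule\<close>

lemma elem_add: "elem (a + a') h b = elem a h b + elem a' h b"
  "elem a (h + h') b = elem a h b + elem a h' b"
  "elem a h (b + b') = elem a h b + elem a h b'"
  and elem_scaleC: "elem (c *\<^sub>C a) h b = c *\<^sub>C elem a h b"
  "elem a (c *\<^sub>C h) b = c *\<^sub>C elem a h b"
  "elem a h (c *\<^sub>C b) = c *\<^sub>C elem a h b"
  and cinner_elem: "cinner (elem a h b) (elem a' h' b') = cinner a a' * cinner h h' * cinner b b'"
  and elem_dense: "closure (span {elem a h b | a h b. True}) = UNIV"
proof -
  have "hilbert_tensor3 (tens3 S)" using tracial by (simp add: tracial_setting_def)
  note * = this [unfolded hilbert_tensor3_def]
  show "elem (a + a') h b = elem a h b + elem a' h b"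
    "elem a (h + h') b = elem a h b + elem a h' b"
    "elem a h (b + b') = elem a h b + elem a h b'"
    "elem (c *\<^sub>C a) h b = c *\<^sub>C elem a h b"
    "elem a (c *\<^sub>C h) b = c *\<^sub>C elem a h b"
    "elem a h (c *\<^sub>C b) = c *\<^sub>C elem a h b"
    "cinner (elem a h b) (elem a' h' b') = cinner a a' * cinner h h' * cinner b b'"
    "closure (span {elem a h b | a h b. True}) = UNIV"
    using * by simp_all
qed

lemma norm_elem: "norm (elem a h b) = norm a * norm h * norm b"
proof -
  have "complex_of_real ((norm (elem a h b))\<^sup>2) = complex_of_real ((norm a * norm h * norm b)\<^sup>2)"
    unfolding cinner_self [symmetric] cinner_elem by (simp add: cinner_self power_mult_distrib)
  then have "(norm (elem a h b))\<^sup>2 = (norm a * norm h * norm b)\<^sup>2" using of_real_eq_iff by blast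
  then show ?thesis by simp
qed

lemma elem_diff: "elem (a - a') h b = elem a h b - elem a' h b"
  "elem a h (b - b') = elem a h b - elem a h b'"
proof -
  show "elem (a - a') h b = elem a h b - elem a' h b"
    using elem_add(1) [of "a - a'" a' h b] by (simp add: algebra_simps)
  show "elem a h (b - b') = elem a h b - elem a h b'"
    using elem_add(3) [of a h "b - b'" b'] by (simp add: algebra_simps)
qed

text \<open>Operators on \<open>L\<^sup>2(M) \<otimes> H \<otimes> L\<^sup>2(M)\<close> are first defined on lists of elementary tensors; that
  they respect equality of the represented vectors is a consequence of \<open>norm_act\<close>.\<close>

abbreviation "tensor_lists \<equiv> lists (M \<times> (UNIV :: 'h set) \<times> M)"

lemma tensor_lists_induct [consumes 1, case_names Nil Cons]:
  assumes "xs \<in> tensor_lists" "P []"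
    and "\<And>a h b xs. a \<in> M \<Longrightarrow> b \<in> M \<Longrightarrow> xs \<in> tensor_lists \<Longrightarrow> P xs \<Longrightarrow> P ((a, h, b) # xs)"
  shows "P xs"
  using assms(1)
proof (induction xs rule: lists.induct)
  case (Cons z zs)
  obtain a h b where "z = (a, h, b)" by (cases z)
  with Cons assms(3) show ?case by auto
qed (rule assms(2))

definition act :: "'k bop \<Rightarrow> 'k bop \<Rightarrow> ('k bop \<times> 'h \<times> 'k bop) list \<Rightarrow> ('k bop \<times> 'h \<times> 'k bop) list"
  where "act x y = map (\<lambda>(a, h, b). (x o\<^sub>L a, h, b o\<^sub>L y))"

lemma act_tensor_lists [simp]: "x \<in> M \<Longrightarrow> y \<in> M \<Longrightarrow> xs \<in> tensor_lists \<Longrightarrow> act x y xs \<in> tensor_lists"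
  by (induction xs) (auto simp: act_def)

lemma tens3_sum_simps [simp]:
  "tens3_sum S [] = 0"
  "tens3_sum S ((a, h, b) # xs) = elem (\<iota> a) h (\<iota> b) + tens3_sum S xs"
  "tens3_sum S (xs @ ys) = tens3_sum S xs + tens3_sum S ys"
  by (simp_all add: tens3_sum_def)

lemma act_simps [simp]:
  "act x y [] = []" "act x y ((a, h, b) # xs) = (x o\<^sub>L a, h, b o\<^sub>L y) # act x y xs"
  "act x y (xs @ ys) = act x y xs @ act x y ys"
  by (simp_all add: act_def)

definition scale_list :: "complex \<Rightarrow> ('k bop \<times> 'h \<times> 'k bop) list \<Rightarrow> ('k bop \<times> 'h \<times> 'k bop) list"
  where "scale_list c = map (\<lambda>(a, h, b). (a, c *\<^sub>C h, b))"

lemma scale_list_simps [simp]: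
  "scale_list c [] = []" "scale_list c ((a, h, b) # xs) = (a, c *\<^sub>C h, b) # scale_list c xs"
  by (simp_all add: scale_list_def)

lemma scale_list_tensor_lists [simp]: "xs \<in> tensor_lists \<Longrightarrow> scale_list c xs \<in> tensor_lists"
  by (induction xs) auto

lemma tens3_sum_scale_list: "tens3_sum S (scale_list c xs) = c *\<^sub>C tens3_sum S xs"
  by (induction xs) (auto simp: elem_scaleC scaleC_add_right)

lemma act_scale_list: "act x y (scale_list c xs) = scale_list c (act x y xs)"
  by (induction xs) auto

lemma cinner_act_elem:
  assumes "x \<in> M" "y \<in> M" "a \<in> M" "b \<in> M" "ys \<in> tensor_lists"
  shows "cinner (elem (\<iota> (x o\<^sub>L a)) h (\<iota> (b o\<^sub>L y))) (tens3_sum S ys) =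
    cinner (elem (\<iota> a) h (\<iota> b)) (tens3_sum S (act (adj x) (adj y) ys))"
proof -
  note left = cinner_l2_left [OF assms(1,3)] and right = cinner_l2_right [OF assms(2,4)]
  show ?thesis using assms(5)
    by (induction ys rule: tensor_lists_induct) (simp_all add: cinner_add_right cinner_elem left right)
qed

lemma cinner_act:
  assumes "x \<in> M" "y \<in> M" "xs \<in> tensor_lists" "ys \<in> tensor_lists"
  shows "cinner (tens3_sum S (act x y xs)) (tens3_sum S ys) =
    cinner (tens3_sum S xs) (tens3_sum S (act (adj x) (adj y) ys))"
  using assms(3)
  by (induction xs rule: tensor_lists_induct) (simp_all add: assms cinner_add_left cinner_act_elem)

lemma act_act: "act x y (act x' y' xs) = act (x o\<^sub>L x') (y' o\<^sub>L y) xs"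
  by (simp add: act_def split_def compose_assoc o_def)

text \<open>Multiplying by \<open>x\<^sup>*x\<close> on the left and by \<open>yy\<^sup>*\<close> on the right is symmetric, and its \<open>N\<close>-th iterate
  multiplies the projective-type norm \<open>cost\<close> of a list by at most \<open>(\<parallel>x\<parallel> \<parallel>y\<parallel>)\<^sup>2\<^sup>N\<close>. Although that
  norm only dominates the Hilbert norm, the growth rate bounds the operator.\<close>

lemma norm_act:
  assumes x: "x \<in> M" and y: "y \<in> M" and xs: "xs \<in> tensor_lists"
  shows "norm (tens3_sum S (act x y xs)) \<le> (norm x * norm y) * norm (tens3_sum S xs)"
proof (rule power2_le_imp_le)
  define cost where
    "cost zs = (\<Sum>(a, h, b)\<leftarrow>zs. norm (\<iota> a) * norm h * norm (\<iota> b))"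
    for zs :: "('k bop \<times> 'h \<times> 'k bop) list"
  define f where "f = act (adj x o\<^sub>L x) (y o\<^sub>L adj y)"
  let ?K = "(norm x * norm y)\<^sup>2"
  have fA: "f zs \<in> tensor_lists" if "zs \<in> tensor_lists" for zs using that x y by (simp add: f_def)
  have le_cost: "norm (tens3_sum S zs) \<le> cost zs" for zs
  proof (induction zs)
    case (Cons z zs)
    obtain a h b where z: "z = (a, h, b)" by (cases z)
    show ?case
      using norm_triangle_ineq [of "elem (\<iota> a) h (\<iota> b)" "tens3_sum S zs"] Cons
      by (simp add: z cost_def norm_elem)
  qed (simp add: cost_def)
  have cost_f: "cost (f zs) \<le> ?K * cost zs" if "zs \<in> tensor_lists" for zs
    using that
  proof (induction zs rule: tensor_lists_induct)
    case (Cons a h b zs)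
    note a = \<open>a \<in> M\<close> and b = \<open>b \<in> M\<close>
    have xx: "norm (adj x o\<^sub>L x) \<le> norm x * norm x" "norm (y o\<^sub>L adj y) \<le> norm y * norm y"
      using x y by (auto intro!: norm_compose_le norm_adj_le)
    have "norm (\<iota> ((adj x o\<^sub>L x) o\<^sub>L a)) \<le> (norm x * norm x) * norm (\<iota> a)"
      by (rule order_trans [OF norm_l2_compose_left])
        (use x a xx in \<open>auto intro: mult_right_mono\<close>)
    moreover have "norm (\<iota> (b o\<^sub>L (y o\<^sub>L adj y))) \<le> norm (\<iota> b) * (norm y * norm y)"
      by (rule order_trans [OF norm_l2_compose_right])
        (use y b xx in \<open>auto intro: mult_left_mono\<close>)
    ultimately have "norm (\<iota> ((adj x o\<^sub>L x) o\<^sub>L a)) * norm h * norm (\<iota> (b o\<^sub>L (y o\<^sub>L adj y))) \<le>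
        ((norm x * norm x) * norm (\<iota> a)) * norm h * (norm (\<iota> b) * (norm y * norm y))"
      by (intro mult_mono) auto
    also have "\<dots> = ?K * (norm (\<iota> a) * norm h * norm (\<iota> b))"
      by (simp add: power2_eq_square)
    finally show ?case using Cons by (simp add: f_def cost_def distrib_left)
  qed (simp add: cost_def f_def)
  have pw: "(f ^^ N) xs \<in> tensor_lists \<and> cost ((f ^^ N) xs) \<le> ?K ^ N * cost xs" for N
  proof (induction N)
    case (Suc N)
    have "cost (f ((f ^^ N) xs)) \<le> ?K * cost ((f ^^ N) xs)" using Suc cost_f by blast
    also have "\<dots> \<le> ?K * (?K ^ N * cost xs)" using Suc by (intro mult_left_mono) auto
    finally show ?case using Suc fA by (simp add: mult.assoc)
  qed (simp add: xs)
  have "norm (tens3_sum S (f xs)) \<le> ?K * norm (tens3_sum S xs)"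
  proof (rule norm_symmetric_le_growth [where I = tensor_lists and C = "cost xs"])
    show "inner (tens3_sum S (f i)) (tens3_sum S j) = inner (tens3_sum S i) (tens3_sum S (f j))"
      if "i \<in> tensor_lists" "j \<in> tensor_lists" for i j
      using that x y unfolding Re_cinner [symmetric] f_def by (simp add: cinner_act)
    show "norm (tens3_sum S ((f ^^ N) xs)) \<le> cost xs * ?K ^ N" for N
      using order_trans [OF le_cost, of "(f ^^ N) xs"] pw [of N] by (simp add: mult.commute)
  qed (use xs fA in auto)
  moreover have "(norm (tens3_sum S (act x y xs)))\<^sup>2 = cmod (cinner (tens3_sum S xs) (tens3_sum S (f xs)))"
  proof -
    have "cinner (tens3_sum S (act x y xs)) (tens3_sum S (act x y xs)) =
        cinner (tens3_sum S xs) (tens3_sum S (f xs))"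
      using x y xs by (simp add: cinner_act act_act f_def)
    then show ?thesis by (metis cinner_self norm_of_real abs_of_nonneg zero_le_power2)
  qed
  moreover have "cmod (cinner (tens3_sum S xs) (tens3_sum S (f xs))) \<le>
      norm (tens3_sum S xs) * norm (tens3_sum S (f xs))"
    by (rule Cauchy_Schwarz_cinner)
  moreover have "norm (tens3_sum S xs) * norm (tens3_sum S (f xs)) \<le>
      norm (tens3_sum S xs) * (?K * norm (tens3_sum S xs))"
    using calculation(1) by (rule mult_left_mono) simp
  ultimately show "(norm (tens3_sum S (act x y xs)))\<^sup>2 \<le>
      ((norm x * norm y) * norm (tens3_sum S xs))\<^sup>2"
    by (simp add: power2_eq_square ac_simps)
qed simp

lemma subspace_tensor_lists: "subspace (tens3_sum S ` tensor_lists)"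
proof (rule subspaceI)
  show "0 \<in> tens3_sum S ` tensor_lists" by (rule image_eqI [of _ _ "[]"]) auto
next
  fix u v assume "u \<in> tens3_sum S ` tensor_lists" "v \<in> tens3_sum S ` tensor_lists"
  then obtain xs ys where *: "xs \<in> tensor_lists" "ys \<in> tensor_lists"
      "u = tens3_sum S xs" "v = tens3_sum S ys" by blast
  then show "u + v \<in> tens3_sum S ` tensor_lists"
    by (intro image_eqI [of _ _ "xs @ ys"]) auto
next
  fix c u assume "u \<in> tens3_sum S ` tensor_lists"
  then obtain xs where *: "xs \<in> tensor_lists" "u = tens3_sum S xs" by blast
  then show "c *\<^sub>R u \<in> tens3_sum S ` tensor_lists"
    by (intro image_eqI [of _ _ "scale_list (complex_of_real c) xs"])
      (auto simp: tens3_sum_scale_list scaleC_of_real)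
qed

lemma l2_sequence:
  obtains f where "\<And>n. f n \<in> M" "(\<lambda>n. \<iota> (f n)) \<longlonglongrightarrow> a"
proof -
  have "a \<in> closure (\<iota> ` M)" by (simp add: l2_dense)
  then show thesis using that by (rule closure_imageE)
qed

lemma elem_tendsto:
  assumes "f \<longlonglongrightarrow> a" "g \<longlonglongrightarrow> b"
  shows "(\<lambda>n. elem (f n) h (g n)) \<longlonglongrightarrow> elem a h b"
proof (rule Lim_null [THEN iffD2], rule Lim_null_comparison)
  show "\<forall>\<^sub>F n in sequentially. norm (elem (f n) h (g n) - elem a h b) \<le>
      norm (f n - a) * norm h * norm (g n) + norm a * norm h * norm (g n - b)"
  proof (intro always_eventually allI)
    fix n
    have "elem (f n) h (g n) - elem a h b = elem (f n - a) h (g n) + elem a h (g n - b)"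
      by (simp add: elem_diff)
    then show "norm (elem (f n) h (g n) - elem a h b) \<le>
        norm (f n - a) * norm h * norm (g n) + norm a * norm h * norm (g n - b)"
      by (metis norm_elem norm_triangle_ineq)
  qed
  have "(\<lambda>n. norm (f n - a) * norm h * norm (g n) + norm a * norm h * norm (g n - b))
      \<longlonglongrightarrow> norm (a - a) * norm h * norm b + norm a * norm h * norm (b - b)"
    by (intro tendsto_intros assms)
  then show "(\<lambda>n. norm (f n - a) * norm h * norm (g n) + norm a * norm h * norm (g n - b))
      \<longlonglongrightarrow> 0" by simp
qed

lemma tensor_lists_dense: "closure (tens3_sum S ` tensor_lists) = UNIV"
proof -
  let ?C = "closure (tens3_sum S ` tensor_lists)"
  have "elem a h b \<in> ?C" for a h b
  proof -
    obtain f where f: "\<And>n. f n \<in> M" "(\<lambda>n. \<iota> (f n)) \<longlonglongrightarrow> a" using l2_sequence by blast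
    obtain g where g: "\<And>n. g n \<in> M" "(\<lambda>n. \<iota> (g n)) \<longlonglongrightarrow> b" using l2_sequence by blast
    have "elem (\<iota> (f n)) h (\<iota> (g n)) \<in> tens3_sum S ` tensor_lists" for n
      using f g by (intro image_eqI [of _ _ "[(f n, h, g n)]"]) auto
    then show ?thesis using elem_tendsto [OF f(2) g(2)] by (rule LIMSEQ_in_closure)
  qed
  then have "span {elem a h b | a h b. True} \<subseteq> ?C"
    by (intro span_minimal subspace_closure subspace_tensor_lists) auto
  then have "closure (span {elem a h b | a h b. True}) \<subseteq> ?C"
    by (rule closure_minimal) simp
  then show ?thesis unfolding elem_dense by blast
qed

lemma tensor_lists_sequence:
  obtains xs where "\<And>n. xs n \<in> tensor_lists" "(\<lambda>n. tens3_sum S (xs n)) \<longlonglongrightarrow> \<xi>"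
proof -
  have "\<xi> \<in> closure (tens3_sum S ` tensor_lists)" by (simp add: tensor_lists_dense)
  then show thesis using that by (rule closure_imageE)
qed

lemma eq_on_tensor_lists:
  assumes "continuous_on UNIV f" "continuous_on UNIV g"
    and "\<And>xs. xs \<in> tensor_lists \<Longrightarrow> f (tens3_sum S xs) = g (tens3_sum S xs)"
  shows "f \<xi> = (g \<xi> :: 'z::t2_space)"
proof -
  obtain xs where xs: "\<And>n. xs n \<in> tensor_lists" "(\<lambda>n. tens3_sum S (xs n)) \<longlonglongrightarrow> \<xi>"
    using tensor_lists_sequence by blast
  have "(\<lambda>n. f (tens3_sum S (xs n))) \<longlonglongrightarrow> f \<xi>" "(\<lambda>n. g (tens3_sum S (xs n))) \<longlonglongrightarrow> g \<xi>"
    using assms(1,2) xs(2) by (auto simp: continuous_on_eq_continuous_at intro: isCont_tendsto_compose)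
  moreover have "(\<lambda>n. f (tens3_sum S (xs n))) = (\<lambda>n. g (tens3_sum S (xs n)))"
    using assms(3) xs(1) by auto
  ultimately show ?thesis using LIMSEQ_unique by metis
qed

text \<open>The operator that \<open>bimod\<close> describes by its values on elementary tensors does exist; elementary
  tensors determine it.\<close>

lemma bimod_exists:
  assumes x: "x \<in> M" and y: "y \<in> M"
  obtains B :: "'w \<Rightarrow>\<^sub>L 'w"
  where "\<And>\<xi>. bimod S x \<xi> y = blinfun_apply B \<xi>"
    and "\<And>xs. xs \<in> tensor_lists \<Longrightarrow> blinfun_apply B (tens3_sum S xs) = tens3_sum S (act x y xs)"
    and "\<And>\<xi>. norm (blinfun_apply B \<xi>) \<le> norm x * norm y * norm \<xi>"
proof -
  define R where "R = (\<lambda>xs. (tens3_sum S xs, tens3_sum S (act x y xs))) ` tensor_lists"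
  have sub: "subspace R"
  proof (rule subspaceI)
    show "0 \<in> R" unfolding R_def by (rule image_eqI [of _ _ "[]"]) (auto simp: zero_prod_def)
  next
    fix u v assume "u \<in> R" "v \<in> R"
    then obtain xs ys where "xs \<in> tensor_lists" "ys \<in> tensor_lists"
        "u = (tens3_sum S xs, tens3_sum S (act x y xs))"
        "v = (tens3_sum S ys, tens3_sum S (act x y ys))" unfolding R_def by blast
    then show "u + v \<in> R" unfolding R_def by (intro image_eqI [of _ _ "xs @ ys"]) auto
  next
    fix c u assume "u \<in> R"
    then obtain xs where "xs \<in> tensor_lists"
        "u = (tens3_sum S xs, tens3_sum S (act x y xs))" unfolding R_def by blast
    then show "c *\<^sub>R u \<in> R" unfolding R_def
      by (intro image_eqI [of _ _ "scale_list (complex_of_real c) xs"])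
        (auto simp: tens3_sum_scale_list act_scale_list scaleC_of_real)
  qed
  have bd: "norm v \<le> (norm x * norm y) * norm u" if "(u, v) \<in> R" for u v
    using that norm_act [OF x y] unfolding R_def by blast
  have "fst ` R = tens3_sum S ` tensor_lists" by (simp add: R_def image_image)
  then have "closure (fst ` R) = UNIV" by (simp add: tensor_lists_dense)
  from bounded_extension_of_dense_relation [OF sub bd this]
  obtain B :: "'w \<Rightarrow>\<^sub>L 'w" where B: "\<And>u v. (u, v) \<in> R \<Longrightarrow> blinfun_apply B u = v"
      "\<And>u. norm (blinfun_apply B u) \<le> norm x * norm y * norm u" by blast
  have B1: "blinfun_apply B (tens3_sum S xs) = tens3_sum S (act x y xs)" if "xs \<in> tensor_lists" for xs
    using that by (intro B(1)) (auto simp: R_def)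
  let ?P = "\<lambda>B. \<forall>a\<in>M. \<forall>h. \<forall>b\<in>M.
      blinfun_apply B (elem (\<iota> a) h (\<iota> b)) = elem (\<iota> (x o\<^sub>L a)) h (\<iota> (b o\<^sub>L y))"
  have PB: "?P B" using B1 [of "[(a, h, b)]" for a h b] by simp
  have "B' = B" if "?P B'" for B'
  proof (rule blinfun_eqI)
    fix \<xi>
    show "blinfun_apply B' \<xi> = blinfun_apply B \<xi>"
    proof (rule eq_on_tensor_lists [where f = "blinfun_apply B'" and g = "blinfun_apply B"])
      fix xs assume "xs \<in> tensor_lists"
      then show "blinfun_apply B' (tens3_sum S xs) = blinfun_apply B (tens3_sum S xs)"
        using that PB
        by (induction xs rule: tensor_lists_induct) (simp_all add: blinfun.bilinear_simps)
    qed (intro continuous_intros continuous_on_id)+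
  qed
  with PB have "(THE B. ?P B) = B" by (intro the_equality)
  then have "bimod S x \<xi> y = blinfun_apply B \<xi>" for \<xi> unfolding bimod_def by (rule arg_cong)
  then show thesis using that B1 B(2) by blast
qed

lemma bimod_tens3_sum:
  assumes "x \<in> M" "y \<in> M" "xs \<in> tensor_lists"
  shows "bimod S x (tens3_sum S xs) y = tens3_sum S (act x y xs)"
  by (rule bimod_exists [OF assms(1,2)]) (simp add: assms(3))

lemma norm_bimod:
  assumes "x \<in> M" "y \<in> M"
  shows "norm (bimod S x \<xi> y) \<le> norm x * norm y * norm \<xi>"
  by (rule bimod_exists [OF assms]) simp

lemma bounded_linear_bimod:
  assumes "x \<in> M" "y \<in> M"
  shows "bounded_linear (\<lambda>\<xi>. bimod S x \<xi> y)"
  by (rule bimod_exists [OF assms]) (simp add: blinfun.bounded_linear_right)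

lemma bimod_diff: "x \<in> M \<Longrightarrow> y \<in> M \<Longrightarrow> bimod S x (\<xi> - \<eta>) y = bimod S x \<xi> y - bimod S x \<eta> y"
  and bimod_sum: "x \<in> M \<Longrightarrow> y \<in> M \<Longrightarrow> bimod S x (\<Sum>i\<in>I. f i) y = (\<Sum>i\<in>I. bimod S x (f i) y)"
  by (rule linear_diff linear_sum,
      erule (1) bounded_linear_bimod [THEN bounded_linear.linear])+

lemma continuous_on_bimod:
  assumes "x \<in> M" "y \<in> M" "continuous_on A f"
  shows "continuous_on A (\<lambda>\<xi>. bimod S x (f \<xi>) y)"
  using bounded_linear.continuous_on [OF bounded_linear_bimod [OF assms(1,2)] assms(3)] .

lemmas bimod_continuous = continuous_on_bimod continuous_on_id
  bounded_bilinear.continuous_on [OF bounded_bilinear_scaleC]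
  bounded_bilinear.continuous_on [OF bounded_bilinear_cinner]

lemma bimod_bimod:
  assumes "x \<in> M" "y \<in> M" "x' \<in> M" "y' \<in> M"
  shows "bimod S x (bimod S x' \<xi> y') y = bimod S (x o\<^sub>L x') \<xi> (y' o\<^sub>L y)"
proof (rule eq_on_tensor_lists [where f = "\<lambda>\<xi>. bimod S x (bimod S x' \<xi> y') y"])
  show "bimod S x (bimod S x' (tens3_sum S xs) y') y =
      bimod S (x o\<^sub>L x') (tens3_sum S xs) (y' o\<^sub>L y)" if "xs \<in> tensor_lists" for xs
    using that assms by (simp add: bimod_tens3_sum act_act)
qed (intro bimod_continuous assms compose_in_M)+

lemma bimod_id [simp]: "bimod S id_blinfun \<xi> id_blinfun = \<xi>"
proof (rule eq_on_tensor_lists [where f = "\<lambda>\<xi>. bimod S id_blinfun \<xi> id_blinfun" and g = "\<lambda>\<xi>. \<xi>"])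
  show "bimod S id_blinfun (tens3_sum S xs) id_blinfun = tens3_sum S xs"
    if "xs \<in> tensor_lists" for xs
    using that by (simp add: bimod_tens3_sum)
      (induction xs rule: tensor_lists_induct, simp_all)
qed (intro bimod_continuous id_in_M)+

lemma bimod_add_left:
  assumes "x \<in> M" "y \<in> M" "z \<in> M"
  shows "bimod S (x + z) \<xi> y = bimod S x \<xi> y + bimod S z \<xi> y"
proof (rule eq_on_tensor_lists [where f = "\<lambda>\<xi>. bimod S (x + z) \<xi> y"])
  show "bimod S (x + z) (tens3_sum S xs) y = bimod S x (tens3_sum S xs) y + bimod S z (tens3_sum S xs) y"
    if "xs \<in> tensor_lists" for xs
    using that assms by (simp add: bimod_tens3_sum)
      (induction xs rule: tensor_lists_induct, simp_all add: compose_add l2_add elem_add)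
qed (intro bimod_continuous continuous_on_add assms add_in_M)+

lemma bimod_add_right:
  assumes "x \<in> M" "y \<in> M" "z \<in> M"
  shows "bimod S x \<xi> (y + z) = bimod S x \<xi> y + bimod S x \<xi> z"
proof (rule eq_on_tensor_lists [where f = "\<lambda>\<xi>. bimod S x \<xi> (y + z)"])
  show "bimod S x (tens3_sum S xs) (y + z) = bimod S x (tens3_sum S xs) y + bimod S x (tens3_sum S xs) z"
    if "xs \<in> tensor_lists" for xs
    using that assms by (simp add: bimod_tens3_sum)
      (induction xs rule: tensor_lists_induct, simp_all add: compose_add l2_add elem_add)
qed (intro bimod_continuous continuous_on_add assms add_in_M)+

lemma bimod_diff_left:
  assumes "x \<in> M" "y \<in> M" "z \<in> M"
  shows "bimod S (x - z) \<xi> y = bimod S x \<xi> y - bimod S z \<xi> y"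
  using bimod_add_left [of "x - z" y z \<xi>] assms by simp

lemma bimod_diff_right:
  assumes "x \<in> M" "y \<in> M" "z \<in> M"
  shows "bimod S x \<xi> (y - z) = bimod S x \<xi> y - bimod S x \<xi> z"
  using bimod_add_right [of x "y - z" z \<xi>] assms by simp

lemma bimod_scaleC:
  assumes "x \<in> M" "y \<in> M"
  shows "bimod S x (c *\<^sub>C \<xi>) y = c *\<^sub>C bimod S x \<xi> y"
proof (rule eq_on_tensor_lists [where f = "\<lambda>\<xi>. bimod S x (c *\<^sub>C \<xi>) y"])
  show "bimod S x (c *\<^sub>C tens3_sum S xs) y = c *\<^sub>C bimod S x (tens3_sum S xs) y"
    if "xs \<in> tensor_lists" for xs
    using that assms
    by (simp add: bimod_tens3_sum tens3_sum_scale_list [symmetric] act_scale_list)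
qed (intro bimod_continuous continuous_on_const assms)+

lemma bimod_scalar_left:
  assumes "x \<in> M" "y \<in> M"
  shows "bimod S (scalar_op c o\<^sub>L x) \<xi> y = c *\<^sub>C bimod S x \<xi> y"
proof (rule eq_on_tensor_lists [where f = "\<lambda>\<xi>. bimod S (scalar_op c o\<^sub>L x) \<xi> y"])
  show "bimod S (scalar_op c o\<^sub>L x) (tens3_sum S xs) y = c *\<^sub>C bimod S x (tens3_sum S xs) y"
    if "xs \<in> tensor_lists" for xs
    using that assms by (simp add: bimod_tens3_sum)
      (induction xs rule: tensor_lists_induct,
        simp_all add: compose_assoc l2_scalar elem_scaleC scaleC_add_right)
qed (intro bimod_continuous continuous_on_const assms compose_in_M scalar_in_M)+

lemma bimod_scalar_right:
  assumes "x \<in> M" "y \<in> M"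
  shows "bimod S x \<xi> (scalar_op c o\<^sub>L y) = c *\<^sub>C bimod S x \<xi> y"
proof (rule eq_on_tensor_lists [where f = "\<lambda>\<xi>. bimod S x \<xi> (scalar_op c o\<^sub>L y)"])
  have comm: "b o\<^sub>L (scalar_op c o\<^sub>L y) = scalar_op c o\<^sub>L (b o\<^sub>L y)" if "b \<in> M" for b
    using scalar_commute [OF that, of c] by (simp flip: compose_assoc)
  show "bimod S x (tens3_sum S xs) (scalar_op c o\<^sub>L y) = c *\<^sub>C bimod S x (tens3_sum S xs) y"
    if "xs \<in> tensor_lists" for xs
    using that assms by (simp add: bimod_tens3_sum)
      (induction xs rule: tensor_lists_induct,
        simp_all add: comm l2_scalar elem_scaleC scaleC_add_right)
qed (intro bimod_continuous continuous_on_const assms compose_in_M scalar_in_M)+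

lemma l2_compose_tendsto:
  assumes X: "\<And>n. X n \<in> M" "x \<in> M" "(\<lambda>n. \<iota> (X n)) \<longlonglongrightarrow> \<iota> x" and a: "a \<in> M"
  shows "(\<lambda>n. \<iota> (X n o\<^sub>L a)) \<longlonglongrightarrow> \<iota> (x o\<^sub>L a)" "(\<lambda>n. \<iota> (a o\<^sub>L X n)) \<longlonglongrightarrow> \<iota> (a o\<^sub>L x)"
proof -
  have lim: "(\<lambda>n. norm (\<iota> (X n) - \<iota> x) * norm a) \<longlonglongrightarrow> 0"
    using tendsto_mult_left_zero [OF tendsto_norm_zero [OF Lim_null [THEN iffD1, OF X(3)]]] .
  have "norm (\<iota> (X n o\<^sub>L a) - \<iota> (x o\<^sub>L a)) \<le> norm (\<iota> (X n) - \<iota> x) * norm a" for n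
    using norm_l2_compose_right [OF a diff_in_M [OF X(1,2)], of n] X(1) [of n] X(2) a
    by (simp add: l2_diff compose_diff)
  then show "(\<lambda>n. \<iota> (X n o\<^sub>L a)) \<longlonglongrightarrow> \<iota> (x o\<^sub>L a)"
    using lim by (rule tendsto_of_norm_diff_le)
  have "norm (\<iota> (a o\<^sub>L X n) - \<iota> (a o\<^sub>L x)) \<le> norm (\<iota> (X n) - \<iota> x) * norm a" for n
    using norm_l2_compose_left [OF a diff_in_M [OF X(1,2)], of n] X(1) [of n] X(2) a
    by (simp add: l2_diff compose_diff mult.commute)
  then show "(\<lambda>n. \<iota> (a o\<^sub>L X n)) \<longlonglongrightarrow> \<iota> (a o\<^sub>L x)"
    using lim by (rule tendsto_of_norm_diff_le)
qed

lemma act_tendsto: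
  assumes X: "\<And>n. X n \<in> M" "x \<in> M" "(\<lambda>n. \<iota> (X n)) \<longlonglongrightarrow> \<iota> x"
    and Y: "\<And>n. Y n \<in> M" "y \<in> M" "(\<lambda>n. \<iota> (Y n)) \<longlonglongrightarrow> \<iota> y"
    and xs: "xs \<in> tensor_lists"
  shows "(\<lambda>n. tens3_sum S (act (X n) (Y n) xs)) \<longlonglongrightarrow> tens3_sum S (act x y xs)"
  using xs
  by (induction xs rule: tensor_lists_induct)
    (simp_all add: tendsto_add elem_tendsto l2_compose_tendsto X Y)

text \<open>On operator-norm bounded sets the \<open>L\<^sup>2\<close>-topology is the strong topology, and there the
  bimodule action is jointly continuous; all limits below are taken in this sense, because
  elements of the domain of a closure are a priori only \<open>L\<^sup>2\<close>-limits.\<close>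

lemma bimod_tendsto:
  assumes X: "\<And>n. X n \<in> M" "x \<in> M" "(\<lambda>n. \<iota> (X n)) \<longlonglongrightarrow> \<iota> x" "\<And>n. norm (X n) \<le> C"
    and Y: "\<And>n. Y n \<in> M" "y \<in> M" "(\<lambda>n. \<iota> (Y n)) \<longlonglongrightarrow> \<iota> y" "\<And>n. norm (Y n) \<le> D"
    and Z: "Z \<longlonglongrightarrow> \<zeta>"
  shows "(\<lambda>n. bimod S (X n) (Z n) (Y n)) \<longlonglongrightarrow> bimod S x \<zeta> y"
proof (rule LIMSEQ_I)
  fix e :: real assume e: "e > 0"
  have CD: "C \<ge> 0" "D \<ge> 0" using order_trans [OF norm_ge_zero X(4)] order_trans [OF norm_ge_zero Y(4)] by auto
  define K where "K = C * D + norm x * norm y + 1"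
  have K: "K > 0" using CD by (simp add: K_def add_nonneg_pos)
  have "\<zeta> \<in> closure (tens3_sum S ` tensor_lists)" by (simp add: tensor_lists_dense)
  moreover have "e / (4 * K) > 0" using e K by simp
  ultimately obtain v where "v \<in> tens3_sum S ` tensor_lists" "dist v \<zeta> < e / (4 * K)"
    unfolding closure_approachable by blast
  then obtain xs where xs: "xs \<in> tensor_lists" and v: "norm (tens3_sum S xs - \<zeta>) < e / (4 * K)"
    by (auto simp: dist_norm)
  let ?v = "tens3_sum S xs"
  have "(\<lambda>n. bimod S (X n) ?v (Y n)) \<longlonglongrightarrow> bimod S x ?v y"
    using act_tendsto [OF X(1-3) Y(1-3) xs] X Y xs by (simp add: bimod_tens3_sum)
  then obtain N1 where N1: "\<And>n. n \<ge> N1 \<Longrightarrow> norm (bimod S (X n) ?v (Y n) - bimod S x ?v y) < e / 4"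
    using LIMSEQ_D [of _ _ "e / 4"] e by fastforce
  obtain N2 where N2: "\<And>n. n \<ge> N2 \<Longrightarrow> norm (Z n - \<zeta>) < e / (4 * K)"
    using LIMSEQ_D [OF Z, of "e / (4 * K)"] e K by fastforce
  have "norm (bimod S (X n) (Z n) (Y n) - bimod S x \<zeta> y) < e" if n: "n \<ge> max N1 N2" for n
  proof -
    have "norm (Z n - ?v) \<le> norm (Z n - \<zeta>) + norm (?v - \<zeta>)"
      by (metis norm_minus_commute norm_triangle_ineq4 diff_diff_eq2 diff_add_cancel)
    also have "\<dots> \<le> e / (2 * K)" using N2 [of n] n v by simp
    finally have Zv: "norm (Z n - ?v) \<le> e / (2 * K)" .
    have "norm (bimod S (X n) (Z n - ?v) (Y n)) \<le> norm (X n) * norm (Y n) * norm (Z n - ?v)"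
      by (rule norm_bimod) (simp_all add: X Y)
    also have "\<dots> \<le> C * D * (e / (2 * K))"
      using X(4) Y(4) CD Zv by (intro mult_mono) auto
    finally have 1: "norm (bimod S (X n) (Z n - ?v) (Y n)) \<le> C * D * (e / (2 * K))" .
    have "norm (bimod S x (?v - \<zeta>) y) \<le> norm x * norm y * norm (?v - \<zeta>)"
      by (rule norm_bimod) (simp_all add: X Y)
    also have "\<dots> \<le> norm x * norm y * (e / (2 * K))"
      using v e K by (intro mult_left_mono) (auto simp: field_simps)
    finally have 2: "norm (bimod S x (?v - \<zeta>) y) \<le> norm x * norm y * (e / (2 * K))" .
    have "C * D * (e / (2 * K)) + norm x * norm y * (e / (2 * K)) = (K - 1) * (e / (2 * K))"
      by (simp only: distrib_right [symmetric]) (simp add: K_def)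
    also have "\<dots> = (K - 1) / K * (e / 2)" by simp
    also have "\<dots> \<le> 1 * (e / 2)" using K e by (intro mult_right_mono) auto
    finally have 3: "C * D * (e / (2 * K)) + norm x * norm y * (e / (2 * K)) \<le> e / 2" by simp
    have "bimod S (X n) (Z n) (Y n) - bimod S x \<zeta> y =
        bimod S (X n) (Z n - ?v) (Y n) + (bimod S (X n) ?v (Y n) - bimod S x ?v y) + bimod S x (?v - \<zeta>) y"
      using X Y by (simp add: bimod_diff)
    then have "norm (bimod S (X n) (Z n) (Y n) - bimod S x \<zeta> y) \<le>
        norm (bimod S (X n) (Z n - ?v) (Y n)) + norm (bimod S (X n) ?v (Y n) - bimod S x ?v y) +
        norm (bimod S x (?v - \<zeta>) y)"
      using norm_triangle_ineq [of "bimod S (X n) (Z n - ?v) (Y n) +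
          (bimod S (X n) ?v (Y n) - bimod S x ?v y)" "bimod S x (?v - \<zeta>) y"]
        norm_triangle_ineq [of "bimod S (X n) (Z n - ?v) (Y n)"
          "bimod S (X n) ?v (Y n) - bimod S x ?v y"] by simp
    also have "\<dots> < e"
    proof -
      have "norm (bimod S (X n) ?v (Y n) - bimod S x ?v y) < e / 4" using n by (intro N1) simp
      with 1 2 3 e show ?thesis by linarith
    qed
    finally show ?thesis .
  qed
  then show "\<exists>no. \<forall>n\<ge>no. norm (bimod S (X n) (Z n) (Y n) - bimod S x \<zeta> y) < e" by blast
qed

subsection \<open>The product with values in \<open>L\<^sup>1\<close>\<close>

lemma cinner_tens: "cinner (tens S a b) (tens S a' b') = cinner a a' * cinner b b'"
  using tracial by (simp add: tracial_setting_def hilbert_tensor_def)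

lemma cinner_sharp_sum:
  assumes a: "a \<in> M" and b: "b \<in> M" and xs: "xs \<in> tensor_lists" and ys: "ys \<in> tensor_lists"
  shows "cinner (sharp_sum S xs ys) (tens S (\<iota> a) (\<iota> b)) =
    cinner (tens3_sum S xs) (tens3_sum S (act a b ys))"
  using xs
proof (induction xs rule: tensor_lists_induct)
  case Nil
  show ?case by (simp add: sharp_sum_def)
next
  case (Cons a' h b' xs)
  have "cinner (\<Sum>(c, g, d)\<leftarrow>ys. cinner g h *\<^sub>C tens S (\<iota> (a' o\<^sub>L adj c)) (\<iota> (adj d o\<^sub>L b')))
      (tens S (\<iota> a) (\<iota> b)) = cinner (elem (\<iota> a') h (\<iota> b')) (tens3_sum S (act a b ys))"
    using ys
  proof (induction ys rule: tensor_lists_induct)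
    case (Cons c g d ys)
    then show ?case using a b \<open>a' \<in> M\<close> \<open>b' \<in> M\<close>
      by (simp add: cinner_add_left cinner_add_right cinner_scaleC_left cinner_tens cinner_elem
          cinner_l2_left [of "adj d"] cinner_l2_right [of "adj c"] cinner_commute [of h g])
  qed simp
  with Cons show ?case by (simp add: sharp_sum_def cinner_add_left)
qed

text \<open>On algebraic tensors the \<open>L\<^sup>1\<close>-valued product tested against \<open>a \<otimes> b\<close> is
  \<open>\<langle>\<xi>, a \<eta> b\<rangle>\<close>, by the trace property. The latter is continuous in the pair, so it is the extension.\<close>

lemma sharp_L1_eq:
  assumes a: "a \<in> M" and b: "b \<in> M"
  shows "sharp_L1 S \<xi> \<eta> a b = cinner \<xi> (bimod S a \<eta> b)"
  unfolding sharp_L1_def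
proof (rule the_equality)
  let ?L = "lists (M \<times> (UNIV :: 'h set) \<times> M)"
  have eq: "cinner (sharp_sum S xs ys) (tens S (\<iota> a) (\<iota> b)) =
      cinner (tens3_sum S xs) (bimod S a (tens3_sum S ys) b)" if "xs \<in> ?L" "ys \<in> ?L" for xs ys
    using that a b by (simp add: cinner_sharp_sum bimod_tens3_sum)
  show "\<forall>e>0. \<exists>r>0. \<forall>xs\<in>?L. \<forall>ys\<in>?L. norm (tens3_sum S xs - \<xi>) < r \<longrightarrow>
      norm (tens3_sum S ys - \<eta>) < r \<longrightarrow>
      cmod (cinner (sharp_sum S xs ys) (tens S (\<iota> a) (\<iota> b)) - cinner \<xi> (bimod S a \<eta> b)) < e"
  proof (intro allI impI)
    fix e :: real assume "e > 0"
    have "continuous_on UNIV (\<lambda>p. cinner (fst p) (bimod S a (snd p) b))"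
      by (intro bimod_continuous continuous_on_fst continuous_on_snd a b)
    then obtain r where r: "r > 0" "\<And>p. dist p (\<xi>, \<eta>) < r \<Longrightarrow>
        dist (cinner (fst p) (bimod S a (snd p) b)) (cinner \<xi> (bimod S a \<eta> b)) < e"
      using \<open>e > 0\<close> unfolding continuous_on_iff by fastforce
    show "\<exists>r>0. \<forall>xs\<in>?L. \<forall>ys\<in>?L. norm (tens3_sum S xs - \<xi>) < r \<longrightarrow>
      norm (tens3_sum S ys - \<eta>) < r \<longrightarrow>
      cmod (cinner (sharp_sum S xs ys) (tens S (\<iota> a) (\<iota> b)) - cinner \<xi> (bimod S a \<eta> b)) < e"
    proof (intro exI [of _ "r / 2"] conjI ballI impI)
      fix xs ys assume L: "xs \<in> ?L" "ys \<in> ?L"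
        and *: "norm (tens3_sum S xs - \<xi>) < r / 2" "norm (tens3_sum S ys - \<eta>) < r / 2"
      have "dist (tens3_sum S xs, tens3_sum S ys) (\<xi>, \<eta>) \<le>
          norm (tens3_sum S xs - \<xi>) + norm (tens3_sum S ys - \<eta>)"
        unfolding dist_norm using norm_Pair_le [of "tens3_sum S xs - \<xi>" "tens3_sum S ys - \<eta>"] by simp
      then have "dist (tens3_sum S xs, tens3_sum S ys) (\<xi>, \<eta>) < r" using * by simp
      from r(2) [OF this]
      show "cmod (cinner (sharp_sum S xs ys) (tens S (\<iota> a) (\<iota> b)) - cinner \<xi> (bimod S a \<eta> b)) < e"
        using L by (simp add: eq dist_norm)
    qed (use r in simp)
  qed
  fix c
  assume c: "\<forall>e>0. \<exists>r>0. \<forall>xs\<in>?L. \<forall>ys\<in>?L. norm (tens3_sum S xs - \<xi>) < r \<longrightarrow>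
      norm (tens3_sum S ys - \<eta>) < r \<longrightarrow>
      cmod (cinner (sharp_sum S xs ys) (tens S (\<iota> a) (\<iota> b)) - c) < e"
  obtain xs where xs: "\<And>n. xs n \<in> ?L" "(\<lambda>n. tens3_sum S (xs n)) \<longlonglongrightarrow> \<xi>"
    using tensor_lists_sequence by blast
  obtain ys where ys: "\<And>n. ys n \<in> ?L" "(\<lambda>n. tens3_sum S (ys n)) \<longlonglongrightarrow> \<eta>"
    using tensor_lists_sequence by blast
  let ?f = "\<lambda>n. cinner (tens3_sum S (xs n)) (bimod S a (tens3_sum S (ys n)) b)"
  have "?f \<longlonglongrightarrow> cinner \<xi> (bimod S a \<eta> b)"
    by (intro cinner.tendsto xs bounded_linear.tendsto [OF bounded_linear_bimod] a b ys)
  moreover have "?f \<longlonglongrightarrow> c"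
  proof (rule LIMSEQ_I)
    fix e :: real assume "e > 0"
    with c obtain r where r: "r > 0" "\<And>xs ys. xs \<in> ?L \<Longrightarrow> ys \<in> ?L \<Longrightarrow>
        norm (tens3_sum S xs - \<xi>) < r \<Longrightarrow> norm (tens3_sum S ys - \<eta>) < r \<Longrightarrow>
        cmod (cinner (sharp_sum S xs ys) (tens S (\<iota> a) (\<iota> b)) - c) < e" by metis
    obtain N1 where "\<And>n. n \<ge> N1 \<Longrightarrow> norm (tens3_sum S (xs n) - \<xi>) < r"
      using LIMSEQ_D [OF xs(2) r(1)] by blast
    moreover obtain N2 where "\<And>n. n \<ge> N2 \<Longrightarrow> norm (tens3_sum S (ys n) - \<eta>) < r"
      using LIMSEQ_D [OF ys(2) r(1)] by blast
    ultimately have "norm (?f n - c) < e" if "n \<ge> max N1 N2" for n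
      using r(2) [OF xs(1) ys(1), of n n] that eq [OF xs(1) ys(1), of n n] by simp
    then show "\<exists>no. \<forall>n\<ge>no. norm (?f n - c) < e" by blast
  qed
  ultimately show "c = cinner \<xi> (bimod S a \<eta> b)" using LIMSEQ_unique by blast
qed

subsection \<open>Resolvents\<close>

lemma norm_selfadjoint_shift:
  assumes "x \<in> M" "adj x = x"
  shows "(norm (blinfun_apply x v + (\<i> * complex_of_real t) *\<^sub>C v))\<^sup>2 =
    (norm (blinfun_apply x v))\<^sup>2 + t\<^sup>2 * (norm v)\<^sup>2"
proof -
  have "cinner (blinfun_apply x v) v = cnj (cinner (blinfun_apply x v) v)"
    using adj_cinner(1) [OF assms(1), of v v] assms(2) cinner_commute [of v "blinfun_apply x v"]
    by simp
  then have "Im (cinner (blinfun_apply x v) v) = 0" by (simp add: complex_eq_iff)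
  then have "inner (blinfun_apply x v) ((\<i> * complex_of_real t) *\<^sub>C v) = 0"
    unfolding Re_cinner [symmetric] by (simp add: cinner_scaleC_right)
  then show ?thesis
    by (simp add: power2_norm_eq_inner inner_add_left inner_add_right inner_commute)
      (simp add: power2_norm_eq_inner [symmetric] norm_scaleC norm_mult power_mult_distrib)
qed

text \<open>With \<open>c = -i/\<kappa>\<close> and \<open>\<alpha> = 1 - l/\<kappa>\<close> one has \<open>1 - (\<alpha> - c x) = c (x + i l)\<close>, and for
  \<open>\<kappa> = (\<parallel>x\<parallel>\<^sup>2 + l\<^sup>2)/l\<close> the operator \<open>\<alpha> - c x\<close> is a strict contraction. So \<open>(x + i l)\<^sup>-\<^sup>1\<close> is
  given by a Neumann series in \<open>x\<close> for every \<open>l > 0\<close>, not only for \<open>l > \<parallel>x\<parallel>\<close>.\<close>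

lemma shift_contraction:
  assumes x: "x \<in> M" "adj x = x" and l: "l > 0"
  obtains c \<alpha> :: complex and q :: real
  where "c \<noteq> 0" "0 < q" "q < 1" "norm (scalar_op \<alpha> - (scalar_op c o\<^sub>L x)) \<le> q"
    "1 - \<alpha> = c * (\<i> * complex_of_real l)"
proof -
  define \<kappa> where "\<kappa> = ((norm x)\<^sup>2 + l\<^sup>2) / l"
  have \<kappa>: "\<kappa> > 0" and kl: "\<kappa> * l = (norm x)\<^sup>2 + l\<^sup>2" using l by (auto simp: \<kappa>_def add_nonneg_pos)
  define c where "c = - \<i> / complex_of_real \<kappa>"
  define \<alpha> where "\<alpha> = complex_of_real (1 - l / \<kappa>)"
  define q where "q = max (1/2) (sqrt (1 - l / \<kappa>))"
  have "l * l \<le> \<kappa> * l" using kl by (simp add: power2_eq_square)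
  then have lk: "l \<le> \<kappa>" using l by simp
  have "norm (scalar_op \<alpha> - (scalar_op c o\<^sub>L x)) \<le> sqrt (1 - l / \<kappa>)"
  proof (rule norm_blinfun_bound)
    fix v
    let ?w = "blinfun_apply x v + (\<i> * complex_of_real (l - \<kappa>)) *\<^sub>C v"
    have "blinfun_apply (scalar_op \<alpha> - (scalar_op c o\<^sub>L x)) v = (\<i> / complex_of_real \<kappa>) *\<^sub>C ?w"
    proof -
      have \<alpha>': "\<i> / complex_of_real \<kappa> * (\<i> * complex_of_real (l - \<kappa>)) = \<alpha>"
        using \<kappa> by (simp add: \<alpha>_def field_simps)
      show ?thesis
        unfolding scaleC_add_right scaleC_scaleC \<alpha>'
        by (simp add: blinfun.bilinear_simps c_def scaleC.minus_left)
    qed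
    then have "norm (blinfun_apply (scalar_op \<alpha> - (scalar_op c o\<^sub>L x)) v) = norm ?w / \<kappa>"
      using \<kappa> by (simp add: norm_scaleC norm_divide)
    also have "\<dots> \<le> sqrt (1 - l / \<kappa>) * norm v"
    proof (rule power2_le_imp_le)
      have "(norm ?w)\<^sup>2 = (norm (blinfun_apply x v))\<^sup>2 + (l - \<kappa>)\<^sup>2 * (norm v)\<^sup>2"
        by (rule norm_selfadjoint_shift [OF x])
      also have "\<dots> \<le> (norm x * norm v)\<^sup>2 + (l - \<kappa>)\<^sup>2 * (norm v)\<^sup>2"
        by (intro add_right_mono power_mono norm_blinfun norm_ge_zero)
      also have "\<dots> = ((norm x)\<^sup>2 + l\<^sup>2 - 2 * (\<kappa> * l) + \<kappa>\<^sup>2) * (norm v)\<^sup>2"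
        by (simp add: power2_eq_square algebra_simps)
      also have "\<dots> = (\<kappa>\<^sup>2 - \<kappa> * l) * (norm v)\<^sup>2" using kl by simp
      finally have "(norm ?w)\<^sup>2 / \<kappa>\<^sup>2 \<le> (\<kappa>\<^sup>2 - \<kappa> * l) * (norm v)\<^sup>2 / \<kappa>\<^sup>2"
        by (rule divide_right_mono) simp
      also have "\<dots> = (1 - l / \<kappa>) * (norm v)\<^sup>2"
        using \<kappa> by (simp add: field_simps power2_eq_square)
      finally show "(norm ?w / \<kappa>)\<^sup>2 \<le> (sqrt (1 - l / \<kappa>) * norm v)\<^sup>2"
        using lk \<kappa> by (simp add: power_divide power_mult_distrib)
    qed (use lk \<kappa> in simp)
    finally show "norm (blinfun_apply (scalar_op \<alpha> - (scalar_op c o\<^sub>L x)) v) \<le> sqrt (1 - l / \<kappa>) * norm v" .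
  qed (use lk \<kappa> in simp)
  then have "norm (scalar_op \<alpha> - (scalar_op c o\<^sub>L x)) \<le> q" by (simp add: q_def)
  moreover have "q < 1" using l \<kappa> by (auto simp: q_def)
  moreover have "1 - \<alpha> = c * (\<i> * complex_of_real l)" by (simp add: c_def \<alpha>_def)
  moreover have "c \<noteq> 0" "q > 0" using \<kappa> by (auto simp: c_def q_def)
  ultimately show thesis using that by blast
qed

text \<open>The norm bound, valid for self-adjoint \<open>x\<close>, is part of the notion because it is uniform in \<open>x\<close>.\<close>

definition is_resolvent :: "'k bop \<Rightarrow> real \<Rightarrow> 'k bop \<Rightarrow> bool" where
  "is_resolvent x l r \<longleftrightarrow> r \<in> M \<and> r o\<^sub>L (x + scalar_op (\<i> * complex_of_real l)) = id_blinfun \<and>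
    (x + scalar_op (\<i> * complex_of_real l)) o\<^sub>L r = id_blinfun \<and> norm r \<le> 1 / l"

lemma resolvent_exists:
  assumes x: "x \<in> M" "adj x = x" and l: "l > 0"
  shows "\<exists>r. is_resolvent x l r"
proof -
  let ?s = "x + scalar_op (\<i> * complex_of_real l)"
  obtain c \<alpha> q where c: "c \<noteq> 0" and q: "0 < q" "q < 1"
    and T: "norm (scalar_op \<alpha> - (scalar_op c o\<^sub>L x)) \<le> q" and \<alpha>: "1 - \<alpha> = c * (\<i> * complex_of_real l)"
    by (rule shift_contraction [OF x l]) (rule that)
  define T where "T = scalar_op \<alpha> - (scalar_op c o\<^sub>L x)"
  have sM: "?s \<in> M" using x by simp
  have Tv: "blinfun_apply T v = v - c *\<^sub>C blinfun_apply ?s v" for v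
  proof -
    have "blinfun_apply T v = \<alpha> *\<^sub>C v - c *\<^sub>C blinfun_apply x v"
      by (simp add: T_def blinfun.bilinear_simps)
    moreover have "\<alpha> = 1 - c * (\<i> * complex_of_real l)" using \<alpha> by (simp add: algebra_simps)
    ultimately show ?thesis
      by (simp add: blinfun.bilinear_simps scaleC_add_right scaleC_scaleC scaleC.diff_left)
  qed
  have "\<exists>!R. scalar_op c + (R o\<^sub>L T) = R"
  proof (rule banach_fix_type [of q])
    show "\<forall>R R'. dist (scalar_op c + (R o\<^sub>L T)) (scalar_op c + (R' o\<^sub>L T)) \<le> q * dist R R'"
    proof (intro allI)
      fix R R' :: "'k bop"
      have "norm ((R - R') o\<^sub>L T) \<le> norm (R - R') * q"
        using T by (intro norm_compose_le) (auto simp: T_def)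
      then show "dist (scalar_op c + (R o\<^sub>L T)) (scalar_op c + (R' o\<^sub>L T)) \<le> q * dist R R'"
        by (simp add: dist_norm compose_diff mult.commute)
    qed
  qed (use q in auto)
  then obtain R where R: "scalar_op c + (R o\<^sub>L T) = R" by blast
  have "\<exists>!R. scalar_op c + (T o\<^sub>L R) = R"
  proof (rule banach_fix_type [of q])
    show "\<forall>R R'. dist (scalar_op c + (T o\<^sub>L R)) (scalar_op c + (T o\<^sub>L R')) \<le> q * dist R R'"
    proof (intro allI)
      fix R R' :: "'k bop"
      have "norm (T o\<^sub>L (R - R')) \<le> q * norm (R - R')"
        using T by (intro norm_compose_le) (auto simp: T_def)
      then show "dist (scalar_op c + (T o\<^sub>L R)) (scalar_op c + (T o\<^sub>L R')) \<le> q * dist R R'"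
        by (simp add: dist_norm compose_diff)
    qed
  qed (use q in auto)
  then obtain R' where R': "scalar_op c + (T o\<^sub>L R') = R'" by blast
  have left: "blinfun_apply R (blinfun_apply ?s v) = v" for v
  proof -
    let ?u = "inverse c *\<^sub>C v"
    have "c *\<^sub>C ?u + blinfun_apply R (blinfun_apply T ?u) = blinfun_apply R ?u"
      using arg_cong [OF R, of "\<lambda>A. blinfun_apply A ?u"] by (simp add: blinfun.bilinear_simps)
    then have "c *\<^sub>C ?u = blinfun_apply R (c *\<^sub>C blinfun_apply ?s ?u)"
      unfolding Tv by (simp add: blinfun.diff_right algebra_simps)
    then show ?thesis using c by (simp only: M_scaleC [OF sM, symmetric]) (simp add: scaleC_scaleC)
  qed
  have right: "blinfun_apply ?s (blinfun_apply R' v) = v" for v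
  proof -
    have "c *\<^sub>C v + blinfun_apply T (blinfun_apply R' v) = blinfun_apply R' v"
      using arg_cong [OF R', of "\<lambda>A. blinfun_apply A v"] by (simp add: blinfun.bilinear_simps)
    then have "c *\<^sub>C v = c *\<^sub>C blinfun_apply ?s (blinfun_apply R' v)"
      unfolding Tv by (simp add: algebra_simps)
    then have "inverse c *\<^sub>C c *\<^sub>C v = inverse c *\<^sub>C c *\<^sub>C blinfun_apply ?s (blinfun_apply R' v)" by simp
    then show ?thesis using c by (simp add: scaleC_scaleC)
  qed
  have "R = R'"
    by (rule blinfun_eqI) (metis left right)
  with right have right: "blinfun_apply ?s (blinfun_apply R v) = v" for v by simp
  have "R \<in> M"
  proof (rule M_I)
    show "blinfun_apply R (a *\<^sub>C v) = a *\<^sub>C blinfun_apply R v" for a v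
      by (metis left right M_scaleC [OF sM])
    show "blinfun_apply R (blinfun_apply y v) = blinfun_apply y (blinfun_apply R v)"
      if "y \<in> commutant M" for y v
      by (metis left right M_commute [OF sM that])
  qed
  moreover have "norm R \<le> 1 / l"
  proof (rule norm_blinfun_bound)
    fix v
    let ?w = "blinfun_apply R v"
    have "(norm v)\<^sup>2 = (norm (blinfun_apply x ?w))\<^sup>2 + l\<^sup>2 * (norm ?w)\<^sup>2"
      using norm_selfadjoint_shift [OF x, of ?w l] right [of v] by (simp add: blinfun.bilinear_simps)
    then have "(l * norm ?w)\<^sup>2 \<le> (norm v)\<^sup>2" by (simp add: power_mult_distrib)
    then have "l * norm ?w \<le> norm v" by (rule power2_le_imp_le) simp
    then show "norm ?w \<le> 1 / l * norm v" using l by (simp add: field_simps)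
  qed (use l in simp)
  moreover have "R o\<^sub>L ?s = id_blinfun" "?s o\<^sub>L R = id_blinfun"
    by (auto intro!: blinfun_eqI simp: left right)
  ultimately show ?thesis unfolding is_resolvent_def by blast
qed

lemma is_resolventD:
  assumes r: "is_resolvent x l r" and x: "x \<in> M"
  shows "r \<in> M" "norm r \<le> 1 / l"
    "r o\<^sub>L x = id_blinfun - (scalar_op (\<i> * complex_of_real l) o\<^sub>L r)"
    "x o\<^sub>L r = id_blinfun - (scalar_op (\<i> * complex_of_real l) o\<^sub>L r)"
proof -
  show rM: "r \<in> M" and "norm r \<le> 1 / l" using r by (auto simp: is_resolvent_def)
  have 1: "(r o\<^sub>L x) + (r o\<^sub>L scalar_op (\<i> * complex_of_real l)) = id_blinfun"
    "(x o\<^sub>L r) + (scalar_op (\<i> * complex_of_real l) o\<^sub>L r) = id_blinfun"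
    using r by (auto simp: is_resolvent_def compose_add)
  then show "x o\<^sub>L r = id_blinfun - (scalar_op (\<i> * complex_of_real l) o\<^sub>L r)"
    by (simp add: eq_diff_eq)
  show "r o\<^sub>L x = id_blinfun - (scalar_op (\<i> * complex_of_real l) o\<^sub>L r)"
    using 1 by (simp add: eq_diff_eq scalar_commute [OF rM])
qed

text \<open>By the resolvent identity \<open>r\<^sub>n - r = r\<^sub>n (x - x\<^sub>n) r\<close>, resolvents are \<open>L\<^sup>2\<close>-Lipschitz in the operator,
  uniformly in its norm.\<close>

lemma resolvent_tendsto:
  assumes X: "\<And>n. X n \<in> M" "x \<in> M" "(\<lambda>n. \<iota> (X n)) \<longlonglongrightarrow> \<iota> x" and l: "l > 0"
    and R: "\<And>n. is_resolvent (X n) l (R n)" and r: "is_resolvent x l r"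
  shows "(\<lambda>n. \<iota> (R n)) \<longlonglongrightarrow> \<iota> r"
proof -
  note RD = is_resolventD [OF R X(1)] and rD = is_resolventD [OF r X(2)]
  have bd: "norm (\<iota> (R n) - \<iota> r) \<le> norm (\<iota> (X n) - \<iota> x) * (1 / l * (1 / l))" for n
  proof -
    have "R n o\<^sub>L (x - X n) o\<^sub>L r = (R n o\<^sub>L (x o\<^sub>L r)) - (R n o\<^sub>L X n o\<^sub>L r)"
      by (simp add: compose_diff compose_assoc)
    also have "\<dots> = (R n o\<^sub>L (id_blinfun - (scalar_op (\<i> * complex_of_real l) o\<^sub>L r))) -
        ((id_blinfun - (scalar_op (\<i> * complex_of_real l) o\<^sub>L R n)) o\<^sub>L r)"
      by (simp only: RD(3) rD(4))
    also have "\<dots> = R n - r"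
      using scalar_commute [OF RD(1), of n]
      by (simp add: compose_diff compose_assoc [symmetric])
    finally have "\<iota> (R n) - \<iota> r = \<iota> (R n o\<^sub>L (x - X n) o\<^sub>L r)"
      using RD(1) rD(1) by (simp add: l2_diff)
    also have "norm \<dots> \<le> norm (\<iota> (R n o\<^sub>L (x - X n))) * norm r"
      using RD(1) rD(1) X by (intro norm_l2_compose_right) auto
    also have "\<dots> \<le> (norm (R n) * norm (\<iota> (x - X n))) * norm r"
      using RD(1) X by (intro mult_right_mono norm_l2_compose_left) auto
    also have "\<dots> \<le> (1 / l * norm (\<iota> (x - X n))) * (1 / l)"
      using RD(2) rD(2) l by (intro mult_mono) auto
    finally show ?thesis using X by (simp add: l2_diff norm_minus_commute)
  qed
  have "(\<lambda>n. norm (\<iota> (X n) - \<iota> x) * (1 / l * (1 / l))) \<longlonglongrightarrow> 0"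
    using tendsto_mult_left_zero [OF tendsto_norm_zero [OF Lim_null [THEN iffD1, OF X(3)]]] .
  with bd show ?thesis by (rule tendsto_of_norm_diff_le)
qed

subsection \<open>Real parts, and density of the domain\<close>

lemma l2_adj_tendsto:
  assumes "\<And>n. X n \<in> M" "x \<in> M" "(\<lambda>n. \<iota> (X n)) \<longlonglongrightarrow> \<iota> x"
  shows "(\<lambda>n. \<iota> (adj (X n))) \<longlonglongrightarrow> \<iota> (adj x)"
proof (rule tendsto_of_norm_diff_le)
  show "norm (\<iota> (adj (X n)) - \<iota> (adj x)) \<le> norm (\<iota> (X n) - \<iota> x)" for n
    using norm_l2_adj [of "X n - x"] assms(1,2) by (simp add: l2_diff)
  show "(\<lambda>n. norm (\<iota> (X n) - \<iota> x)) \<longlonglongrightarrow> 0"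
    using assms(3) by (intro tendsto_norm_zero) (rule Lim_null [THEN iffD1])
qed

definition real_part :: "'k bop \<Rightarrow> 'k bop" where
  "real_part x = scalar_op (1 / 2) o\<^sub>L (x + adj x)"

lemma real_part_in_M [simp]: "x \<in> M \<Longrightarrow> real_part x \<in> M"
  by (simp add: real_part_def)

lemma adj_real_part [simp]: "x \<in> M \<Longrightarrow> adj (real_part x) = real_part x"
  by (simp add: real_part_def adj_scalar scalar_commute add.commute)

text \<open>The real part is \<open>L\<^sup>2\<close>-continuous since \<open>\<tau>\<close> is a trace.\<close>

lemma real_part_tendsto:
  assumes X: "\<And>n. X n \<in> M" "x \<in> M" "(\<lambda>n. \<iota> (X n)) \<longlonglongrightarrow> \<iota> x" and x: "adj x = x"
  shows "(\<lambda>n. \<iota> (real_part (X n))) \<longlonglongrightarrow> \<iota> x"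
proof -
  have "(\<lambda>n. (1 / 2) *\<^sub>C (\<iota> (X n) + \<iota> (adj (X n)))) \<longlonglongrightarrow> (1 / 2) *\<^sub>C (\<iota> x + \<iota> (adj x))"
    by (intro scaleC.tendsto tendsto_const tendsto_add X l2_adj_tendsto)
  moreover have "(1 / 2) *\<^sub>C (\<iota> x + \<iota> (adj x)) = \<iota> x"
    using scaleC_add_left [of "1 / 2" "1 / 2" "\<iota> x"] by (simp add: x scaleC_add_right)
  ultimately show ?thesis using X(1) by (simp add: real_part_def l2_scalar l2_add)
qed

text \<open>An eigenvector of the Laplacian lies in the closed domain of the derivation, so it is a
  limit of vectors of the original domain.\<close>

lemma domain_dense_of_pure_point_spectrum:
  assumes d: "is_derivation S" and pp: "pure_point_spectrum (laplacian S) ev"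
  shows "closure (\<iota> ` ddom S) = UNIV"
proof -
  have sub: "ddom S \<subseteq> M" and add: "\<And>x y. x \<in> ddom S \<Longrightarrow> y \<in> ddom S \<Longrightarrow> x + y \<in> ddom S"
    and scal: "\<And>x c. x \<in> ddom S \<Longrightarrow> scalar_op c o\<^sub>L x \<in> ddom S"
    using d unfolding is_derivation_def by blast+
  have "weakly_dense_in (ddom S) M" using d by (simp add: is_derivation_def)
  then have "\<exists>d\<in>ddom S. \<forall>(u, v)\<in>{}. cmod (cinner u (blinfun_apply id_blinfun v) - cinner u (blinfun_apply d v)) < 1"
    unfolding weakly_dense_in_def using id_in_M zero_less_one finite.emptyI by blast
  then obtain x0 where x0: "x0 \<in> ddom S" by blast
  have subsp: "subspace (\<iota> ` ddom S)"
  proof (rule subspaceI)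
    have "\<iota> (scalar_op 0 o\<^sub>L x0) = 0" using x0 sub by (subst l2_scalar) auto
    then show "0 \<in> \<iota> ` ddom S" using scal [OF x0, of 0] by (metis imageI)
  next
    fix u v assume "u \<in> \<iota> ` ddom S" "v \<in> \<iota> ` ddom S"
    then obtain x y where xy: "x \<in> ddom S" "y \<in> ddom S" "u = \<iota> x" "v = \<iota> y" by blast
    then have "u + v = \<iota> (x + y)" using l2_add [OF subsetD subsetD, OF sub _ sub] by simp
    then show "u + v \<in> \<iota> ` ddom S" using add [OF xy(1,2)] by (metis imageI)
  next
    fix c u assume "u \<in> \<iota> ` ddom S"
    then obtain x where x: "x \<in> ddom S" "u = \<iota> x" by blast
    then have "c *\<^sub>R u = \<iota> (scalar_op (complex_of_real c) o\<^sub>L x)"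
      using sub by (auto simp: l2_scalar scaleC_of_real)
    then show "c *\<^sub>R u \<in> \<iota> ` ddom S" using scal [OF x(1)] by (metis imageI)
  qed
  have dom: "v \<in> closure (\<iota> ` ddom S)" if vu: "(v, u) \<in> laplacian S" for v u
  proof -
    obtain w where "(v, w) \<in> closure ((\<lambda>x. (\<iota> x, der S x)) ` ddom S)"
      using vu by (auto simp: laplacian_def der_closure_def)
    then obtain X :: "nat \<Rightarrow> 'k bop" where X: "\<And>n. X n \<in> ddom S"
      "(\<lambda>n. (\<iota> (X n), der S (X n))) \<longlonglongrightarrow> (v, w)" by (rule closure_imageE) (rule that)
    have "(\<lambda>n. \<iota> (X n)) \<longlonglongrightarrow> v" using tendsto_fst [OF X(2)] by simp
    then show ?thesis by (rule LIMSEQ_in_closure [rotated]) (simp add: X(1))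
  qed
  then have "(\<Union>k. {v. (v, ev k *\<^sub>R v) \<in> laplacian S}) \<subseteq> closure (\<iota> ` ddom S)" by blast
  then have "span (\<Union>k. {v. (v, ev k *\<^sub>R v) \<in> laplacian S}) \<subseteq> closure (\<iota> ` ddom S)"
    by (rule span_minimal) (rule subspace_closure [OF subsp])
  then have "closure (span (\<Union>k. {v. (v, ev k *\<^sub>R v) \<in> laplacian S})) \<subseteq> closure (\<iota> ` ddom S)"
    by (rule closure_minimal) simp
  then show ?thesis using pp unfolding pure_point_spectrum_def by blast
qed

end

section \<open>Real closable derivations\<close>

locale real_closable_derivation = tracial S
  for S :: "('k::complex_hilbert, 'r::{real_inner, polish_space}, 'h::complex_hilbert,
      'l::complex_hilbert, 't::complex_hilbert, 'w::complex_hilbert) derivation_data" +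
  assumes closable: "closable_derivation S" and real: "real_derivation S"
    and dom_dense: "closure (l2 S ` ddom S) = UNIV"
begin

lemma dom_M [simp]: "x \<in> ddom S \<Longrightarrow> x \<in> M"
  and dom_add: "x \<in> ddom S \<Longrightarrow> y \<in> ddom S \<Longrightarrow> x + y \<in> ddom S"
  and dom_compose: "x \<in> ddom S \<Longrightarrow> y \<in> ddom S \<Longrightarrow> x o\<^sub>L y \<in> ddom S"
  and dom_adj: "x \<in> ddom S \<Longrightarrow> adj x \<in> ddom S"
  and dom_scalar: "x \<in> ddom S \<Longrightarrow> scalar_op c o\<^sub>L x \<in> ddom S"
  and der_add: "x \<in> ddom S \<Longrightarrow> y \<in> ddom S \<Longrightarrow> der S (x + y) = der S x + der S y"
  and der_scalar: "x \<in> ddom S \<Longrightarrow> der S (scalar_op c o\<^sub>L x) = c *\<^sub>C der S x"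
  and der_compose: "x \<in> ddom S \<Longrightarrow> y \<in> ddom S \<Longrightarrow>
    der S (x o\<^sub>L y) = bimod S x (der S y) id_blinfun + bimod S id_blinfun (der S x) y"
proof -
  have "is_derivation S" using closable by (simp add: closable_derivation_def)
  note d = this [unfolded is_derivation_def]
  show "x \<in> ddom S \<Longrightarrow> x \<in> M" using d by blast
  show "x \<in> ddom S \<Longrightarrow> y \<in> ddom S \<Longrightarrow> x + y \<in> ddom S" using d by blast
  show "x \<in> ddom S \<Longrightarrow> y \<in> ddom S \<Longrightarrow> x o\<^sub>L y \<in> ddom S" using d by blast
  show "x \<in> ddom S \<Longrightarrow> adj x \<in> ddom S" using d by blast
  show "x \<in> ddom S \<Longrightarrow> scalar_op c o\<^sub>L x \<in> ddom S" using d by blast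
  show "x \<in> ddom S \<Longrightarrow> y \<in> ddom S \<Longrightarrow> der S (x + y) = der S x + der S y" using d by blast
  show "x \<in> ddom S \<Longrightarrow> der S (scalar_op c o\<^sub>L x) = c *\<^sub>C der S x" using d by blast
  show "x \<in> ddom S \<Longrightarrow> y \<in> ddom S \<Longrightarrow>
    der S (x o\<^sub>L y) = bimod S x (der S y) id_blinfun + bimod S id_blinfun (der S x) y" using d by blast
qed

lemma diff_scalar: "x - y = x + (scalar_op (- 1) o\<^sub>L y)" for x y :: "'k bop"
  by (rule blinfun_eqI) (simp add: blinfun.bilinear_simps scaleC.minus_left)

lemma dom_diff: "x \<in> ddom S \<Longrightarrow> y \<in> ddom S \<Longrightarrow> x - y \<in> ddom S"
  unfolding diff_scalar by (intro dom_add dom_scalar)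

lemma der_diff: "x \<in> ddom S \<Longrightarrow> y \<in> ddom S \<Longrightarrow> der S (x - y) = der S x - der S y"
  unfolding diff_scalar by (simp add: der_add der_scalar dom_scalar scaleC.minus_left)

lemma dom_zero: "0 \<in> ddom S"
proof -
  have "ddom S \<noteq> {}" using dom_dense by auto
  then obtain x where "x \<in> ddom S" by blast
  from dom_diff [OF this this] show ?thesis by simp
qed

lemma der_closure_sequence:
  assumes "(v, w) \<in> der_closure S"
  obtains X where "\<And>n. X n \<in> ddom S" "(\<lambda>n. \<iota> (X n)) \<longlonglongrightarrow> v" "(\<lambda>n. der S (X n)) \<longlonglongrightarrow> w"
proof (rule closure_imageE [OF assms [unfolded der_closure_def]])
  fix X :: "nat \<Rightarrow> 'k bop"
  assume "\<And>n. X n \<in> ddom S" "(\<lambda>n. (\<iota> (X n), der S (X n))) \<longlonglongrightarrow> (v, w)"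
  then show thesis
    using tendsto_fst [of "\<lambda>n. (\<iota> (X n), der S (X n))"] tendsto_snd [of "\<lambda>n. (\<iota> (X n), der S (X n))"]
    by (intro that [of X]) fastforce+
qed

text \<open>This is closability: the closure of the graph of \<open>\<delta>\<close> is again a graph.\<close>

lemma der_closure_unique:
  assumes "(v, w) \<in> der_closure S" "(v, w') \<in> der_closure S"
  shows "w = w'"
proof -
  obtain X where X: "\<And>n. X n \<in> ddom S" "(\<lambda>n. \<iota> (X n)) \<longlonglongrightarrow> v" "(\<lambda>n. der S (X n)) \<longlonglongrightarrow> w"
    using assms(1) by (rule der_closure_sequence) (rule that)
  obtain Y where Y: "\<And>n. Y n \<in> ddom S" "(\<lambda>n. \<iota> (Y n)) \<longlonglongrightarrow> v" "(\<lambda>n. der S (Y n)) \<longlonglongrightarrow> w'"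
    using assms(2) by (rule der_closure_sequence) (rule that)
  have "\<forall>n. X n - Y n \<in> ddom S" using X Y by (simp add: dom_diff)
  moreover have "(\<lambda>n. \<iota> (X n - Y n)) \<longlonglongrightarrow> 0"
    using tendsto_diff [OF X(2) Y(2)] X(1) Y(1) by (simp add: l2_diff)
  moreover have "(\<lambda>n. der S (X n - Y n)) \<longlonglongrightarrow> w - w'"
    using tendsto_diff [OF X(3) Y(3)] X(1) Y(1) by (simp add: der_diff)
  ultimately have "w - w' = 0"
    using closable [unfolded closable_derivation_def] by (elim conjE) (drule spec [of _ "\<lambda>n. X n - Y n"], blast)
  then show ?thesis by simp
qed

lemma op_app_der_closure: "(v, w) \<in> der_closure S \<Longrightarrow> op_app (der_closure S) v = w"
  unfolding op_app_def using der_closure_unique by (intro the_equality)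

subsection \<open>The product rule on bounded elements of the closed domain\<close>

text \<open>\<open>has_der x \<xi>\<close> says that \<open>x\<close> lies in the closed domain with derivative \<open>\<xi>\<close>, and that this
  is seen by iterated limits along operator-norm bounded sequences. Boundedness is what makes the
  product rule pass to the limit; iteration is needed because resolvents of a fixed parameter \<open>l\<close>
  are handled before \<open>l\<close> tends to infinity, when the bound, of order \<open>l\<close>, is lost.\<close>

inductive has_der :: "'k bop \<Rightarrow> 'w \<Rightarrow> bool" where
  dom: "x \<in> ddom S \<Longrightarrow> has_der x (der S x)"
| lim: "(\<And>n. has_der (X n) (\<Xi> n)) \<Longrightarrow> (\<And>n::nat. norm (X n) \<le> C) \<Longrightarrow> x \<in> M \<Longrightarrow>
    (\<lambda>n. \<iota> (X n)) \<longlonglongrightarrow> \<iota> x \<Longrightarrow> \<Xi> \<longlonglongrightarrow> \<xi> \<Longrightarrow> has_der x \<xi>"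

lemma has_der_M: "has_der x \<xi> \<Longrightarrow> x \<in> M"
  by (induction rule: has_der.induct) simp_all

lemma has_der_closure: "has_der x \<xi> \<Longrightarrow> (\<iota> x, \<xi>) \<in> der_closure S"
proof (induction rule: has_der.induct)
  case (dom x)
  then show ?case unfolding der_closure_def by (intro subsetD [OF closure_subset] imageI)
next
  case (lim X \<Xi> C x \<xi>)
  have "(\<iota> x, \<xi>) \<in> closure (der_closure S)"
    using lim.IH tendsto_Pair [OF lim.hyps(4,5)] by (rule LIMSEQ_in_closure)
  then show ?case by (simp add: der_closure_def)
qed

lemma has_der_scalar: "has_der x \<xi> \<Longrightarrow> has_der (scalar_op c o\<^sub>L x) (c *\<^sub>C \<xi>)"
proof (induction rule: has_der.induct)
  case (dom x)
  then show ?case using has_der.dom [OF dom_scalar [OF dom, of c]] by (simp add: der_scalar)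
next
  case (lim X \<Xi> C x \<xi>)
  have M: "X n \<in> M" for n using lim.hyps(1) has_der_M by blast
  show ?case
  proof (rule has_der.lim)
    show "has_der (scalar_op c o\<^sub>L X n) (c *\<^sub>C \<Xi> n)" for n by (rule lim.IH)
    show "norm (scalar_op c o\<^sub>L X n) \<le> cmod c * C" for n
      using lim.hyps(2) by (intro norm_compose_le norm_scalar_op_le)
    show "(\<lambda>n. \<iota> (scalar_op c o\<^sub>L X n)) \<longlonglongrightarrow> \<iota> (scalar_op c o\<^sub>L x)"
      by (intro l2_compose_tendsto M lim.hyps scalar_in_M)
    show "(\<lambda>n. c *\<^sub>C \<Xi> n) \<longlonglongrightarrow> c *\<^sub>C \<xi>"
      by (intro scaleC.tendsto tendsto_const lim.hyps)
  qed (use lim.hyps in simp)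
qed

text \<open>The product rule passes to the limit in one factor at a time, first in the left factor, against
  \<open>y\<close> in the domain, then in the right one.\<close>

lemma has_der_compose_dom:
  assumes "has_der x \<xi>" and y: "y \<in> ddom S"
  shows "has_der (x o\<^sub>L y) (bimod S x (der S y) id_blinfun + bimod S id_blinfun \<xi> y)"
  using assms(1)
proof (induction rule: has_der.induct)
  case (dom x)
  then show ?case using has_der.dom [OF dom_compose [OF dom y]] y by (simp add: der_compose)
next
  case (lim X \<Xi> C x \<xi>)
  have M: "X n \<in> M" for n using lim.hyps(1) has_der_M by blast
  show ?case
  proof (rule has_der.lim)
    show "has_der (X n o\<^sub>L y) (bimod S (X n) (der S y) id_blinfun + bimod S id_blinfun (\<Xi> n) y)" for n
      by (rule lim.IH)
    show "norm (X n o\<^sub>L y) \<le> C * norm y" for n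
      using lim.hyps(2) by (intro norm_compose_le) auto
    show "(\<lambda>n. \<iota> (X n o\<^sub>L y)) \<longlonglongrightarrow> \<iota> (x o\<^sub>L y)"
      by (intro l2_compose_tendsto M lim.hyps dom_M y)
    show "(\<lambda>n. bimod S (X n) (der S y) id_blinfun + bimod S id_blinfun (\<Xi> n) y)
        \<longlonglongrightarrow> bimod S x (der S y) id_blinfun + bimod S id_blinfun \<xi> y"
    proof (rule tendsto_add)
      show "(\<lambda>n. bimod S (X n) (der S y) id_blinfun) \<longlonglongrightarrow> bimod S x (der S y) id_blinfun"
        by (rule bimod_tendsto [where C = C and D = "norm (id_blinfun :: 'k bop)"])
          (simp_all add: M lim.hyps)
      show "(\<lambda>n. bimod S id_blinfun (\<Xi> n) y) \<longlonglongrightarrow> bimod S id_blinfun \<xi> y"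
        by (intro bounded_linear.tendsto [OF bounded_linear_bimod] lim.hyps id_in_M dom_M y)
    qed
  qed (use lim.hyps y in simp)
qed

lemma has_der_compose:
  assumes x: "has_der x \<xi>" and "has_der y \<eta>"
  shows "has_der (x o\<^sub>L y) (bimod S x \<eta> id_blinfun + bimod S id_blinfun \<xi> y)"
  using assms(2)
proof (induction rule: has_der.induct)
  case (dom y)
  then show ?case using x by (intro has_der_compose_dom)
next
  case (lim Y \<Xi> C y \<eta>)
  have M: "Y n \<in> M" for n using lim.hyps(1) has_der_M by blast
  have xM: "x \<in> M" using x by (rule has_der_M)
  show ?case
  proof (rule has_der.lim)
    show "has_der (x o\<^sub>L Y n) (bimod S x (\<Xi> n) id_blinfun + bimod S id_blinfun \<xi> (Y n))" for n
      by (rule lim.IH)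
    show "norm (x o\<^sub>L Y n) \<le> norm x * C" for n
      using lim.hyps(2) by (intro norm_compose_le) auto
    show "(\<lambda>n. \<iota> (x o\<^sub>L Y n)) \<longlonglongrightarrow> \<iota> (x o\<^sub>L y)"
      by (intro l2_compose_tendsto M lim.hyps xM)
    show "(\<lambda>n. bimod S x (\<Xi> n) id_blinfun + bimod S id_blinfun \<xi> (Y n))
        \<longlonglongrightarrow> bimod S x \<eta> id_blinfun + bimod S id_blinfun \<xi> y"
    proof (rule tendsto_add)
      show "(\<lambda>n. bimod S id_blinfun \<xi> (Y n)) \<longlonglongrightarrow> bimod S id_blinfun \<xi> y"
        by (rule bimod_tendsto [where D = C and C = "norm (id_blinfun :: 'k bop)"])
          (simp_all add: M lim.hyps)
      show "(\<lambda>n. bimod S x (\<Xi> n) id_blinfun) \<longlonglongrightarrow> bimod S x \<eta> id_blinfun"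
        by (intro bounded_linear.tendsto [OF bounded_linear_bimod] lim.hyps id_in_M xM)
    qed
  qed (use lim.hyps xM in simp)
qed

subsection \<open>Resolvents of elements of the domain\<close>

text \<open>The partial sums \<open>Z\<^sub>n\<close> of the Neumann series of \<open>x (x + i l)\<^sup>-\<^sup>1\<close> are polynomials in \<open>x\<close> with zero
  constant term, so they stay in the domain, which need not contain \<open>1\<close>. Differentiating their
  recursion \<open>Z\<^sub>n\<^sub>+\<^sub>1 = c x + Z\<^sub>n T\<close> yields an affine recursion for \<open>\<delta>(Z\<^sub>n)\<close> with the same contraction
  \<open>T\<close> and a geometrically convergent inhomogeneity. The limit \<open>D\<close> is its fixed point.\<close>

lemma resolvent_approximation:
  assumes x: "x \<in> ddom S" "adj x = x" and l: "l > 0" and r: "is_resolvent x l r"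
  obtains Z where "\<And>n. Z n \<in> ddom S" "Z \<longlonglongrightarrow> (x o\<^sub>L r)"
    "(\<lambda>n. der S (Z n)) \<longlonglongrightarrow> (\<i> * complex_of_real l) *\<^sub>C bimod S r (der S x) r"
proof -
  have xM: "x \<in> M" using x by simp
  note rD = is_resolventD [OF r xM]
  let ?il = "\<i> * complex_of_real l"
  obtain c \<alpha> q where q: "0 < q" "q < 1"
    and Tq: "norm (scalar_op \<alpha> - (scalar_op c o\<^sub>L x)) \<le> q" and \<alpha>: "1 - \<alpha> = c * ?il"
    by (rule shift_contraction [OF xM x(2) l]) (rule that)
  define T where "T = scalar_op \<alpha> - (scalar_op c o\<^sub>L x)"
  have TM: "T \<in> M" by (simp add: T_def xM)
  define z where "z = x o\<^sub>L r"
  have zM: "z \<in> M" using xM rD by (simp add: z_def)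
  define D where "D = ?il *\<^sub>C bimod S r (der S x) r"
  define Z where "Z n = ((\<lambda>y. (scalar_op c o\<^sub>L x) + (y o\<^sub>L T)) ^^ n) 0" for n
  have Z0: "Z 0 = 0" and ZS: "Z (Suc n) = (scalar_op c o\<^sub>L x) + (Z n o\<^sub>L T)" for n
    by (simp_all add: Z_def)
  have yT: "y o\<^sub>L T = (scalar_op \<alpha> o\<^sub>L y) - (scalar_op c o\<^sub>L (y o\<^sub>L x))" if "y \<in> M" for y
    using scalar_commute [OF that, of \<alpha>] scalar_commute [OF that, of c]
    by (simp add: T_def compose_diff flip: compose_assoc)
  have Zdom: "Z n \<in> ddom S" for n
  proof (induction n)
    case (Suc n)
    then show ?case using x by (simp add: ZS yT dom_add dom_diff dom_scalar dom_compose)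
  qed (simp add: Z0 dom_zero)
  have ZM: "Z n \<in> M" for n using Zdom by simp
  \<comment> \<open>\<open>z = x (x + i l)\<^sup>-\<^sup>1\<close> is the fixed point of the affine contraction iterated by \<open>Z\<close>.\<close>
  have z_fix: "z = (scalar_op c o\<^sub>L x) + (z o\<^sub>L T)"
  proof (rule blinfun_eqI)
    fix v
    have zx: "blinfun_apply z (blinfun_apply x v) = blinfun_apply x v - ?il *\<^sub>C blinfun_apply z v"
      using arg_cong [OF rD(3), of "\<lambda>A. blinfun_apply x (blinfun_apply A v)"]
      by (simp add: z_def blinfun.bilinear_simps M_scaleC [OF xM])
    have "blinfun_apply ((scalar_op c o\<^sub>L x) + (z o\<^sub>L T)) v = (\<alpha> + c * ?il) *\<^sub>C blinfun_apply z v"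
      by (simp add: T_def blinfun.bilinear_simps M_scaleC [OF zM] zx scaleC.diff_right
          scaleC_add_left scaleC_scaleC)
    then show "blinfun_apply z v = blinfun_apply ((scalar_op c o\<^sub>L x) + (z o\<^sub>L T)) v"
      using \<alpha> by (simp add: algebra_simps flip: \<alpha>)
  qed
  have Zz: "norm (Z n - z) \<le> norm z * q ^ n" for n
  proof (induction n)
    case (Suc n)
    have "Z (Suc n) - z = ((scalar_op c o\<^sub>L x) + (Z n o\<^sub>L T)) - ((scalar_op c o\<^sub>L x) + (z o\<^sub>L T))"
      using z_fix ZS by simp
    also have "\<dots> = (Z n - z) o\<^sub>L T" by (simp add: compose_diff)
    also have "norm \<dots> \<le> (norm z * q ^ n) * q"
      using Suc Tq by (intro norm_compose_le) (simp_all add: T_def)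
    finally show ?case by (simp add: ac_simps)
  qed (simp add: Z0)
  \<comment> \<open>This fixed point equation uses \<open>r x = x r = 1 - i l r\<close>.\<close>
  have D_fix: "D = c *\<^sub>C der S x + (bimod S id_blinfun D T - c *\<^sub>C bimod S z (der S x) id_blinfun)"
  proof -
    have 1: "bimod S id_blinfun D x = ?il *\<^sub>C bimod S r (der S x) id_blinfun - ?il *\<^sub>C D"
      using rD xM by (simp add: D_def bimod_scaleC bimod_bimod bimod_diff_right
          bimod_scalar_right scaleC.diff_right)
    have 2: "bimod S z (der S x) id_blinfun = der S x - ?il *\<^sub>C bimod S r (der S x) id_blinfun"
      using rD xM by (simp add: z_def bimod_diff_left bimod_scalar_left)
    have 3: "bimod S id_blinfun D T = \<alpha> *\<^sub>C D - c *\<^sub>C bimod S id_blinfun D x"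
      using bimod_scalar_right [of id_blinfun id_blinfun D \<alpha>] xM
      by (simp add: T_def bimod_diff_right bimod_scalar_right)
    have "c *\<^sub>C der S x + (bimod S id_blinfun D T - c *\<^sub>C bimod S z (der S x) id_blinfun) =
        (\<alpha> + c * ?il) *\<^sub>C D"
      unfolding 3 1 2 by (simp add: scaleC.diff_right scaleC_add_left scaleC_scaleC)
    also have "\<alpha> + c * ?il = 1" unfolding \<alpha> [symmetric] by simp
    finally show ?thesis by simp
  qed
  have der_ZS: "der S (Z (Suc n)) = c *\<^sub>C der S x +
      (bimod S id_blinfun (der S (Z n)) T - c *\<^sub>C bimod S (Z n) (der S x) id_blinfun)" for n
  proof -
    have 3: "bimod S id_blinfun (der S (Z n)) T =
        \<alpha> *\<^sub>C der S (Z n) - c *\<^sub>C bimod S id_blinfun (der S (Z n)) x"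
      using bimod_scalar_right [of id_blinfun id_blinfun "der S (Z n)" \<alpha>] xM
      by (simp add: T_def bimod_diff_right bimod_scalar_right)
    show ?thesis
      using x Zdom [of n] unfolding ZS yT [OF ZM] 3
      by (simp add: der_add der_diff der_scalar der_compose dom_add dom_diff dom_scalar dom_compose
          scaleC_add_right)
  qed
  have "(\<lambda>n. norm (der S (Z n) - D)) \<longlonglongrightarrow> 0"
  proof (rule perturbed_geometric_tendsto_0 [OF q, where C = "cmod c * norm z * norm (der S x)"])
    fix n
    let ?E = "der S (Z n) - D"
    have "der S (Z (Suc n)) - D = bimod S id_blinfun ?E T - c *\<^sub>C bimod S (Z n - z) (der S x) id_blinfun"
      by (subst D_fix) (simp add: der_ZS bimod_diff bimod_diff_left TM ZM zM scaleC.diff_right)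
    also have "norm \<dots> \<le> norm (bimod S id_blinfun ?E T) + cmod c * norm (bimod S (Z n - z) (der S x) id_blinfun)"
      using norm_triangle_ineq4 [of "bimod S id_blinfun ?E T"] by (simp add: norm_scaleC [symmetric])
    also have "\<dots> \<le> q * norm ?E + cmod c * norm z * norm (der S x) * q ^ n"
    proof (rule add_mono)
      have idn: "norm (id_blinfun :: 'k bop) \<le> 1" by (rule norm_blinfun_bound) auto
      have "norm (bimod S id_blinfun ?E T) \<le> norm (id_blinfun :: 'k bop) * norm T * norm ?E"
        by (rule norm_bimod) (simp_all add: TM)
      also have "\<dots> \<le> (1 * q) * norm ?E"
        using idn Tq q by (intro mult_right_mono mult_mono) (auto simp: T_def)
      finally show "norm (bimod S id_blinfun ?E T) \<le> q * norm ?E" by simp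
      have "norm (bimod S (Z n - z) (der S x) id_blinfun) \<le>
          norm (Z n - z) * norm (id_blinfun :: 'k bop) * norm (der S x)"
        by (rule norm_bimod) (simp_all add: ZM zM)
      also have "\<dots> \<le> ((norm z * q ^ n) * 1) * norm (der S x)"
        using idn Zz q by (intro mult_right_mono mult_mono) auto
      finally have "cmod c * norm (bimod S (Z n - z) (der S x) id_blinfun) \<le>
          cmod c * (((norm z * q ^ n) * 1) * norm (der S x))"
        by (rule mult_left_mono) simp
      then show "cmod c * norm (bimod S (Z n - z) (der S x) id_blinfun) \<le>
          cmod c * norm z * norm (der S x) * q ^ n" by (simp add: ac_simps)
    qed
    finally show "norm (der S (Z (Suc n)) - D) \<le> q * norm ?E + cmod c * norm z * norm (der S x) * q ^ n" .
  qed simp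
  then have derZ: "(\<lambda>n. der S (Z n)) \<longlonglongrightarrow> D"
    by (rule tendsto_of_norm_diff_le [rotated]) simp
  have "(\<lambda>n. norm z * q ^ n) \<longlonglongrightarrow> 0"
    using q by (intro tendsto_mult_right_zero LIMSEQ_power_zero) auto
  with Zz have "Z \<longlonglongrightarrow> z" by (rule tendsto_of_norm_diff_le)
  with derZ Zdom show thesis using that unfolding D_def z_def by blast
qed

lemma l2_tendsto_of_norm:
  assumes "\<And>n. Z n \<in> M" "z \<in> M" "Z \<longlonglongrightarrow> z"
  shows "(\<lambda>n. \<iota> (Z n)) \<longlonglongrightarrow> \<iota> z"
proof -
  obtain C where C: "C \<ge> 0" "\<And>x. x \<in> M \<Longrightarrow> norm (\<iota> x) \<le> C * norm x" by (rule norm_l2_le) (rule that)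
  have "norm (\<iota> (Z n) - \<iota> z) \<le> C * norm (Z n - z)" for n
    using C(2) [of "Z n - z"] assms by (simp add: l2_diff)
  moreover have "(\<lambda>n. C * norm (Z n - z)) \<longlonglongrightarrow> 0"
    using assms(3) by (intro tendsto_mult_right_zero tendsto_norm_zero) (rule Lim_null [THEN iffD1])
  ultimately show ?thesis by (rule tendsto_of_norm_diff_le)
qed

lemma norm_bounded_of_tendsto:
  assumes "Z \<longlonglongrightarrow> (z :: 'k bop)"
  obtains C where "\<And>n::nat. norm (Z n) \<le> C"
  using assms by (metis Bseq_def convergent_imp_Bseq convergentI)

lemma has_der_resolvent:
  assumes x: "x \<in> ddom S" "adj x = x" and l: "l > 0" and r: "is_resolvent x l r"
  shows "has_der (x o\<^sub>L r) ((\<i> * complex_of_real l) *\<^sub>C bimod S r (der S x) r)"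
proof -
  have rM: "r \<in> M" using is_resolventD(1) [OF r] x by simp
  obtain Z where Z: "\<And>n. Z n \<in> ddom S" "Z \<longlonglongrightarrow> (x o\<^sub>L r)"
    "(\<lambda>n. der S (Z n)) \<longlonglongrightarrow> (\<i> * complex_of_real l) *\<^sub>C bimod S r (der S x) r"
    by (rule resolvent_approximation [OF assms]) (rule that)
  obtain C where C: "\<And>n. norm (Z n) \<le> C" using Z(2) by (rule norm_bounded_of_tendsto) (rule that)
  show ?thesis
  proof (rule has_der.lim)
    show "has_der (Z n) (der S (Z n))" for n using Z(1) by (rule has_der.dom)
    show "(\<lambda>n. \<iota> (Z n)) \<longlonglongrightarrow> \<iota> (x o\<^sub>L r)"
      using Z x rM by (intro l2_tendsto_of_norm) auto
  qed (use C Z x rM in auto)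
qed

subsection \<open>The derivation intertwines the involutions isometrically\<close>

lemma dom_real_part: "x \<in> ddom S \<Longrightarrow> real_part x \<in> ddom S"
  by (simp add: real_part_def dom_scalar dom_add dom_adj)

text \<open>The identity that makes \<open>\<delta>\<close> real, at the middle factor \<open>y\<close>. It is stable under bounded limits in
  \<open>y\<close>, which carries it from the domain to \<open>y = 1\<close>.\<close>

definition real_at :: "'k bop \<Rightarrow> bool" where
  "real_at y \<longleftrightarrow> (\<forall>x\<in>ddom S. \<forall>z\<in>ddom S.
    cinner (der S x) (bimod S y (der S z) id_blinfun) =
    cinner (bimod S id_blinfun (der S (adj z)) (adj y)) (der S (adj x)))"

lemma real_at_dom: "y \<in> ddom S \<Longrightarrow> real_at y"
  using real by (simp add: real_derivation_def real_at_def)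

lemma real_at_lim:
  assumes Y: "\<And>n::nat. real_at (Y n)" "\<And>n. Y n \<in> M" "y \<in> M" "(\<lambda>n. \<iota> (Y n)) \<longlonglongrightarrow> \<iota> y"
    "\<And>n. norm (Y n) \<le> C"
  shows "real_at y"
  unfolding real_at_def
proof (intro ballI)
  fix x z assume xz: "x \<in> ddom S" "z \<in> ddom S"
  have "(\<lambda>n. bimod S (Y n) (der S z) id_blinfun) \<longlonglongrightarrow> bimod S y (der S z) id_blinfun"
    by (rule bimod_tendsto [where C = C and D = "norm (id_blinfun :: 'k bop)"]) (simp_all add: Y)
  then have 1: "(\<lambda>n. cinner (der S x) (bimod S (Y n) (der S z) id_blinfun)) \<longlonglongrightarrow>
      cinner (der S x) (bimod S y (der S z) id_blinfun)"
    by (intro cinner.tendsto tendsto_const)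
  have adjC: "norm (adj (Y n)) \<le> C" for n using norm_adj_le [OF Y(2)] Y(5) by (rule order_trans)
  have "(\<lambda>n. bimod S id_blinfun (der S (adj z)) (adj (Y n))) \<longlonglongrightarrow>
      bimod S id_blinfun (der S (adj z)) (adj y)"
    by (rule bimod_tendsto [where D = C and C = "norm (id_blinfun :: 'k bop)"])
      (simp_all add: Y adjC l2_adj_tendsto)
  then have 2: "(\<lambda>n. cinner (bimod S id_blinfun (der S (adj z)) (adj (Y n))) (der S (adj x))) \<longlonglongrightarrow>
      cinner (bimod S id_blinfun (der S (adj z)) (adj y)) (der S (adj x))"
    by (intro cinner.tendsto tendsto_const)
  show "cinner (der S x) (bimod S y (der S z) id_blinfun) =
      cinner (bimod S id_blinfun (der S (adj z)) (adj y)) (der S (adj x))"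
    using 1 2 Y(1) xz unfolding real_at_def by (auto intro: LIMSEQ_unique)
qed

lemma real_at_scalar:
  assumes "real_at y" "y \<in> M"
  shows "real_at (scalar_op c o\<^sub>L y)"
  using assms
  by (simp add: real_at_def bimod_scalar_left adj_scalar scalar_commute bimod_scalar_right
      cinner_scaleC_left cinner_scaleC_right)

text \<open>The unit need not belong to the domain, but self-adjoint \<open>y\<^sub>n\<close> of the domain converge to it
  in \<open>L\<^sup>2\<close>. Then the bounded elements \<open>y\<^sub>n (y\<^sub>n + i)\<^sup>-\<^sup>1\<close> converge to \<open>(1 + i)\<^sup>-\<^sup>1\<close>, and they are norm
  limits of elements of the domain.\<close>

lemma real_at_id: "real_at id_blinfun"
proof -
  have "\<iota> id_blinfun \<in> closure (\<iota> ` ddom S)" by (simp add: dom_dense)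
  then obtain X where X: "\<And>n::nat. X n \<in> ddom S" "(\<lambda>n. \<iota> (X n)) \<longlonglongrightarrow> \<iota> id_blinfun"
    by (rule closure_imageE) (rule that)
  define Y where "Y n = real_part (X n)" for n
  have Yd: "Y n \<in> ddom S" and Y: "Y n \<in> M" "adj (Y n) = Y n" for n
    using X(1) by (simp_all add: Y_def dom_real_part)
  have Y1: "(\<lambda>n. \<iota> (Y n)) \<longlonglongrightarrow> \<iota> id_blinfun"
    unfolding Y_def using X by (intro real_part_tendsto) simp_all
  have "\<forall>n. \<exists>r. is_resolvent (Y n) 1 r" using Y by (simp add: resolvent_exists)
  then obtain R where R: "\<And>n. is_resolvent (Y n) 1 (R n)" by metis
  obtain r where r: "is_resolvent (id_blinfun :: 'k bop) 1 r"
    using resolvent_exists [of id_blinfun 1] by auto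
  note RD = is_resolventD [OF R Y(1)] and rD = is_resolventD [OF r id_in_M]
  have YR: "real_at (Y n o\<^sub>L R n)" for n
  proof -
    obtain Z where Z: "\<And>n. Z n \<in> ddom S" "Z \<longlonglongrightarrow> (Y n o\<^sub>L R n)"
      by (rule resolvent_approximation [OF Yd Y(2) zero_less_one R]) (rule that)
    obtain C where C: "\<And>n. norm (Z n) \<le> C" using Z(2) by (rule norm_bounded_of_tendsto) (rule that)
    show ?thesis
    proof (rule real_at_lim)
      show "real_at (Z k)" for k using Z(1) by (rule real_at_dom)
      show "(\<lambda>k. \<iota> (Z k)) \<longlonglongrightarrow> \<iota> (Y n o\<^sub>L R n)"
        using Z Y RD by (intro l2_tendsto_of_norm) auto
    qed (use C Z Y RD in auto)
  qed
  have "real_at (id_blinfun o\<^sub>L r)"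
  proof (rule real_at_lim [OF YR])
    have "(\<lambda>n. \<iota> id_blinfun - \<i> *\<^sub>C \<iota> (R n)) \<longlonglongrightarrow> \<iota> id_blinfun - \<i> *\<^sub>C \<iota> r"
      by (intro tendsto_diff tendsto_const scaleC.tendsto resolvent_tendsto [OF Y(1) id_in_M Y1 _ R r]) simp
    then show "(\<lambda>n. \<iota> (Y n o\<^sub>L R n)) \<longlonglongrightarrow> \<iota> (id_blinfun o\<^sub>L r)"
      unfolding RD(4) rD(4) using RD(1) rD(1) by (simp add: l2_diff l2_scalar)
    show "norm (Y n o\<^sub>L R n) \<le> norm (id_blinfun :: 'k bop) + 1 * 1" for n
    proof -
      have "norm (scalar_op (\<i> * complex_of_real 1) o\<^sub>L R n) \<le> 1 * 1"
        using RD(2) [of n] by (intro norm_compose_le order_trans [OF norm_scalar_op_le]) auto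
      then show ?thesis
        unfolding RD(4)
        using norm_triangle_ineq4 [of "id_blinfun :: 'k bop" "scalar_op (\<i> * complex_of_real 1) o\<^sub>L R n"]
        by linarith
    qed
  qed (use Y RD rD in auto)
  then have "real_at (scalar_op (1 + \<i>) o\<^sub>L r)" using rD(1) by (simp add: real_at_scalar)
  moreover have "scalar_op (1 + \<i>) o\<^sub>L r = id_blinfun"
  proof (rule blinfun_eqI)
    fix v
    have "blinfun_apply r v = v - \<i> *\<^sub>C blinfun_apply r v"
      using arg_cong [OF rD(4), of "\<lambda>A. blinfun_apply A v"] by (simp add: blinfun.bilinear_simps)
    then show "blinfun_apply (scalar_op (1 + \<i>) o\<^sub>L r) v = blinfun_apply id_blinfun v"
      by (simp add: scaleC_add_left algebra_simps)
  qed
  ultimately show ?thesis by simp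
qed

lemma norm_der_adj:
  assumes a: "a \<in> ddom S"
  shows "norm (der S (adj a)) = norm (der S a)"
proof -
  have "cinner (der S a) (der S a) = cinner (der S (adj a)) (der S (adj a))"
    using real_at_id a by (simp add: real_at_def)
  then have "complex_of_real ((norm (der S a))\<^sup>2) = complex_of_real ((norm (der S (adj a)))\<^sup>2)"
    by (simp only: cinner_self)
  then have "(norm (der S a))\<^sup>2 = (norm (der S (adj a)))\<^sup>2" using of_real_eq_iff by blast
  then show ?thesis by simp
qed

text \<open>Real parts of an approximating sequence work: their derivatives converge because
  \<open>\<parallel>\<delta>(a\<^sup>*)\<parallel> = \<parallel>\<delta>(a)\<parallel>\<close> carries the Cauchy property over to the adjoints, and the limit is right because the closure of \<open>\<delta>\<close> is single-valued.\<close>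

lemma selfadjoint_sequence:
  assumes x: "x \<in> M" "adj x = x" and G: "(\<iota> x, \<xi>) \<in> der_closure S"
  obtains X where "\<And>n. X n \<in> ddom S" "\<And>n. adj (X n) = X n" "(\<lambda>n. \<iota> (X n)) \<longlonglongrightarrow> \<iota> x"
    "(\<lambda>n. der S (X n)) \<longlonglongrightarrow> \<xi>"
proof -
  obtain A where A: "\<And>n. A n \<in> ddom S" "(\<lambda>n. \<iota> (A n)) \<longlonglongrightarrow> \<iota> x" "(\<lambda>n. der S (A n)) \<longlonglongrightarrow> \<xi>"
    using G by (rule der_closure_sequence) (rule that)
  have "norm (der S (adj (A m)) - der S (adj (A n))) = norm (der S (A m) - der S (A n))" for m n
    using norm_der_adj [OF dom_diff [OF A(1) A(1)], of m n] A(1)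
    by (simp add: der_diff dom_adj)
  then have "Cauchy (\<lambda>n. der S (adj (A n)))"
    using LIMSEQ_imp_Cauchy [OF A(3)] by (simp add: Cauchy_def dist_norm)
  then obtain \<xi>' where \<xi>': "(\<lambda>n. der S (adj (A n))) \<longlonglongrightarrow> \<xi>'"
    using Cauchy_convergent convergent_def by blast
  define X where "X n = real_part (A n)" for n
  have X: "X n \<in> ddom S" "adj (X n) = X n" for n using A(1) by (simp_all add: X_def dom_real_part)
  have Xx: "(\<lambda>n. \<iota> (X n)) \<longlonglongrightarrow> \<iota> x" unfolding X_def using A x by (intro real_part_tendsto) auto
  have "(\<lambda>n. (1 / 2) *\<^sub>C (der S (A n) + der S (adj (A n)))) \<longlonglongrightarrow> (1 / 2) *\<^sub>C (\<xi> + \<xi>')"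
    by (intro scaleC.tendsto tendsto_const tendsto_add A \<xi>')
  then have derX: "(\<lambda>n. der S (X n)) \<longlonglongrightarrow> (1 / 2) *\<^sub>C (\<xi> + \<xi>')"
    using A(1) by (simp add: X_def real_part_def der_scalar der_add dom_add dom_adj)
  have "(\<iota> x, (1 / 2) *\<^sub>C (\<xi> + \<xi>')) \<in> der_closure S"
    unfolding der_closure_def using tendsto_Pair [OF Xx derX]
    by (rule LIMSEQ_in_closure [rotated]) (simp add: X)
  with G have "(1 / 2) *\<^sub>C (\<xi> + \<xi>') = \<xi>" by (rule der_closure_unique [symmetric])
  with derX X Xx show thesis using that by auto
qed

text \<open>For self-adjoint \<open>x\<^sub>n\<close> of the domain approximating \<open>x\<close>, the bounded elements
  \<open>i l x\<^sub>n (x\<^sub>n + i l)\<^sup>-\<^sup>1\<close> have derivative \<open>(i l)\<^sup>2 (x\<^sub>n + i l)\<^sup>-\<^sup>1 \<delta>(x\<^sub>n) (x\<^sub>n + i l)\<^sup>-\<^sup>1\<close>, which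
  depends continuously on \<open>(x\<^sub>n, \<delta>(x\<^sub>n))\<close> in \<open>L\<^sup>2\<close>. As \<open>l\<close> grows, the limits tend to \<open>x\<close> in norm and
  their derivatives to \<open>\<xi>\<close>, since \<open>s = i l (x + i l)\<^sup>-\<^sup>1\<close> tends to \<open>1\<close>.\<close>

lemma has_der_selfadjoint:
  assumes x: "x \<in> M" "adj x = x" and G: "(\<iota> x, \<xi>) \<in> der_closure S"
  shows "has_der x \<xi>"
proof -
  obtain X where X: "\<And>n. X n \<in> ddom S" "\<And>n. adj (X n) = X n" "(\<lambda>n. \<iota> (X n)) \<longlonglongrightarrow> \<iota> x"
    "(\<lambda>n. der S (X n)) \<longlonglongrightarrow> \<xi>" by (rule selfadjoint_sequence [OF assms]) (rule that)
  have XM: "X n \<in> M" for n using X(1) by simp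
  have xr: "has_der (x o\<^sub>L r) ((\<i> * complex_of_real l) *\<^sub>C bimod S r \<xi> r)"
    if l: "l > 0" and r: "is_resolvent x l r" for l r
  proof -
    let ?il = "\<i> * complex_of_real l"
    have "\<forall>n. \<exists>r. is_resolvent (X n) l r" using XM X(2) l by (simp add: resolvent_exists)
    then obtain R where R: "\<And>n. is_resolvent (X n) l (R n)" by metis
    note RD = is_resolventD [OF R XM] and rD = is_resolventD [OF r x(1)]
    have Rr: "(\<lambda>n. \<iota> (R n)) \<longlonglongrightarrow> \<iota> r" by (rule resolvent_tendsto [OF XM x(1) X(3) l R r])
    show ?thesis
    proof (rule has_der.lim)
      show "has_der (X n o\<^sub>L R n) (?il *\<^sub>C bimod S (R n) (der S (X n)) (R n))" for n
        by (rule has_der_resolvent [OF X(1,2) l R])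
      show "norm (X n o\<^sub>L R n) \<le> norm (id_blinfun :: 'k bop) + l * (1 / l)" for n
      proof -
        have "norm (scalar_op ?il o\<^sub>L R n) \<le> l * (1 / l)"
          using RD(2) [of n] l
          by (intro norm_compose_le order_trans [OF norm_scalar_op_le]) (auto simp: norm_mult)
        then show ?thesis
          unfolding RD(4) using norm_triangle_ineq4 [of "id_blinfun :: 'k bop" "scalar_op ?il o\<^sub>L R n"]
          by linarith
      qed
      have "(\<lambda>n. \<iota> id_blinfun - ?il *\<^sub>C \<iota> (R n)) \<longlonglongrightarrow> \<iota> id_blinfun - ?il *\<^sub>C \<iota> r"
        by (intro tendsto_diff tendsto_const scaleC.tendsto Rr)
      then show "(\<lambda>n. \<iota> (X n o\<^sub>L R n)) \<longlonglongrightarrow> \<iota> (x o\<^sub>L r)"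
        unfolding RD(4) rD(4) using RD(1) rD(1) by (simp add: l2_diff l2_scalar)
      show "(\<lambda>n. ?il *\<^sub>C bimod S (R n) (der S (X n)) (R n)) \<longlonglongrightarrow> ?il *\<^sub>C bimod S r \<xi> r"
        by (intro scaleC.tendsto tendsto_const
            bimod_tendsto [OF RD(1) rD(1) Rr RD(2) RD(1) rD(1) Rr RD(2) X(4)])
    qed (use x rD in simp)
  qed
  define l where "l k = real (Suc k)" for k
  have l: "l k > 0" for k by (simp add: l_def)
  have "\<forall>k. \<exists>r. is_resolvent x (l k) r" using x l by (simp add: resolvent_exists)
  then obtain r where r: "\<And>k. is_resolvent x (l k) (r k)" by metis
  note rD = is_resolventD [OF r x(1)]
  define s where "s k = scalar_op (\<i> * complex_of_real (l k)) o\<^sub>L r k" for k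
  have sM: "s k \<in> M" for k by (simp add: s_def rD)
  have s_bd: "norm (s k) \<le> 1" for k
  proof -
    have "norm (s k) \<le> l k * (1 / l k)" unfolding s_def
      using rD(2) [of k] l [of k]
      by (intro norm_compose_le order_trans [OF norm_scalar_op_le]) (auto simp: norm_mult)
    then show ?thesis using l [of k] by simp
  qed
  have "norm (s k - id_blinfun) \<le> norm x * inverse (l k)" for k
  proof -
    have "s k - id_blinfun = - (x o\<^sub>L r k)" unfolding s_def rD(4) by simp
    then have "norm (s k - id_blinfun) = norm (x o\<^sub>L r k)" by simp
    also have "\<dots> \<le> norm x * (1 / l k)" by (intro norm_compose_le rD) simp
    finally show ?thesis by (simp add: inverse_eq_divide)
  qed
  moreover have "(\<lambda>k. norm x * inverse (l k)) \<longlonglongrightarrow> 0"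
    unfolding l_def by (intro tendsto_mult_right_zero LIMSEQ_inverse_real_of_nat)
  ultimately have "s \<longlonglongrightarrow> id_blinfun" by (rule tendsto_of_norm_diff_le)
  then have s1: "(\<lambda>k. \<iota> (s k)) \<longlonglongrightarrow> \<iota> id_blinfun" by (intro l2_tendsto_of_norm sM id_in_M)
  show ?thesis
  proof (rule has_der.lim)
    show "has_der (x o\<^sub>L s k) (bimod S (s k) \<xi> (s k))" for k
    proof -
      let ?il = "\<i> * complex_of_real (l k)"
      have "scalar_op ?il o\<^sub>L (x o\<^sub>L r k) = x o\<^sub>L s k"
        using scalar_commute [OF x(1), of ?il] by (simp add: s_def flip: compose_assoc)
      moreover have "?il *\<^sub>C ?il *\<^sub>C bimod S (r k) \<xi> (r k) = bimod S (s k) \<xi> (s k)"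
        using rD(1) by (simp add: s_def bimod_scalar_left bimod_scalar_right)
      ultimately show ?thesis using has_der_scalar [OF xr [OF l r], of ?il k] by simp
    qed
    show "norm (x o\<^sub>L s k) \<le> norm x * 1" for k using s_bd by (intro norm_compose_le) auto
    show "(\<lambda>k. \<iota> (x o\<^sub>L s k)) \<longlonglongrightarrow> \<iota> x"
      using l2_compose_tendsto(2) [OF sM id_in_M s1 x(1)] by simp
    show "(\<lambda>k. bimod S (s k) \<xi> (s k)) \<longlonglongrightarrow> \<xi>"
      using bimod_tendsto [OF sM id_in_M s1 s_bd sM id_in_M s1 s_bd tendsto_const] by simp
  qed (rule x)
qed

end

section \<open>Non-commutative polynomials\<close>

lemma sum_keys_superset:
  fixes c :: "'a \<Rightarrow> complex"
  assumes "finite A" "Poly_Mapping.keys q \<subseteq> A"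
  shows "(\<Sum>p\<in>Poly_Mapping.keys q. Poly_Mapping.lookup q p * c p) = (\<Sum>p\<in>A. Poly_Mapping.lookup q p * c p)"
  using assms by (intro sum.mono_neutral_left) (auto simp: in_keys_iff)

lemma L1_pairing_add: "L1_pairing \<phi> F (p + q) = L1_pairing \<phi> F p + L1_pairing \<phi> F q"
proof -
  let ?A = "Poly_Mapping.keys p \<union> Poly_Mapping.keys q"
  let ?c = "\<lambda>(u, v). \<phi> (word_eval F u) (word_eval F v)"
  have *: "L1_pairing \<phi> F r = (\<Sum>w\<in>?A. Poly_Mapping.lookup r w * ?c w)"
    if "Poly_Mapping.keys r \<subseteq> ?A" for r
    unfolding L1_pairing_def using sum_keys_superset [OF _ that, of ?c] by (simp add: split_def)
  have "Poly_Mapping.keys (p + q) \<subseteq> ?A" by (rule Poly_Mapping.keys_add)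
  then show ?thesis by (simp add: * lookup_add distrib_right sum.distrib)
qed

lemma L1_pairing_sum: "L1_pairing \<phi> F (\<Sum>i\<in>I. f i) = (\<Sum>i\<in>I. L1_pairing \<phi> F (f i))"
  by (induction I rule: infinite_finite_induct) (simp_all add: L1_pairing_add L1_pairing_def [of _ _ 0])

lemma L1_pairing_single:
  "L1_pairing \<phi> F (Poly_Mapping.single (u, v) c) = c * \<phi> (word_eval F u) (word_eval F v)"
  by (cases "c = 0") (simp_all add: L1_pairing_def)

lemma L1_pairing_free_diff:
  "L1_pairing \<phi> F (free_diff j p) = (\<Sum>w\<in>Poly_Mapping.keys p. \<Sum>k | k < length w \<and> w ! k = j.
    Poly_Mapping.lookup p w * \<phi> (word_eval F (take k w)) (word_eval F (drop (Suc k) w)))"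
  by (simp add: free_diff_def L1_pairing_sum L1_pairing_single)

text \<open>Each position of a word is met by exactly one of the free difference quotients, the one for
  the letter that stands there.\<close>

lemma sum_L1_pairing_free_diff:
  assumes "p \<in> ncpolys n"
  shows "(\<Sum>j<n. L1_pairing (\<phi> j) F (free_diff j p)) =
    (\<Sum>w\<in>Poly_Mapping.keys p. Poly_Mapping.lookup p w *
      (\<Sum>k<length w. \<phi> (w ! k) (word_eval F (take k w)) (word_eval F (drop (Suc k) w))))"
proof -
  let ?h = "\<lambda>w k. Poly_Mapping.lookup p w *
    \<phi> (w ! k) (word_eval F (take k w)) (word_eval F (drop (Suc k) w))"
  have "(\<Sum>j<n. L1_pairing (\<phi> j) F (free_diff j p)) =
      (\<Sum>j<n. \<Sum>w\<in>Poly_Mapping.keys p. \<Sum>k | k < length w \<and> w ! k = j. ?h w k)"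
    unfolding L1_pairing_free_diff by (intro sum.cong) auto
  also have "\<dots> = (\<Sum>w\<in>Poly_Mapping.keys p. \<Sum>j<n. \<Sum>k | k < length w \<and> w ! k = j. ?h w k)"
    by (rule sum.swap)
  also have "\<dots> = (\<Sum>w\<in>Poly_Mapping.keys p. \<Sum>k<length w. ?h w k)"
  proof (rule sum.cong [OF refl])
    fix w assume "w \<in> Poly_Mapping.keys p"
    then have "w \<in> lists {..<n}" using assms by (auto simp: ncpolys_def)
    then have "(\<lambda>k. w ! k) ` {..<length w} \<subseteq> {..<n}" by (auto simp: in_lists_conv_set)
    then show "(\<Sum>j<n. \<Sum>k | k < length w \<and> w ! k = j. ?h w k) = (\<Sum>k<length w. ?h w k)"
      using sum.group [of "{..<length w}" "{..<n}" "\<lambda>k. w ! k" "?h w"] by simp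
  qed
  finally show ?thesis by (simp add: sum_distrib_left)
qed

text \<open>Both occurrences of \<open>t\<^sub>i\<close> in \<open>t\<^sub>i\<^sup>2 / 2\<close> contribute \<open>t\<^sub>i / 2\<close>.\<close>

lemma cyclic_diff_semicircular_potential:
  assumes "i < n"
  shows "cyclic_diff i (semicircular_potential n) = Poly_Mapping.single [i] 1"
proof -
  have lk: "Poly_Mapping.lookup (semicircular_potential n) w = (if \<exists>m<n. w = [m, m] then 1 / 2 else 0)" for w
  proof (cases "\<exists>m<n. w = [m, m]")
    case True
    then obtain m where m: "m < n" "w = [m, m]" by blast
    have "Poly_Mapping.lookup (semicircular_potential n) w = (\<Sum>i<n. if i = m then 1 / 2 else 0)"
      unfolding semicircular_potential_def lookup_sum
      by (intro sum.cong) (auto simp: m lookup_single when_def)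
    then show ?thesis using True m(1) by simp
  next
    case False
    then have "Poly_Mapping.lookup (semicircular_potential n) w = (\<Sum>i<n. 0)"
      unfolding semicircular_potential_def lookup_sum
      by (intro sum.cong) (auto simp: lookup_single when_def)
    then show ?thesis using False by simp
  qed
  have keys: "Poly_Mapping.keys (semicircular_potential n) = (\<lambda>m. [m, m]) ` {..<n}"
    by (auto simp: keys.rep_eq lk split: if_splits)
  have "cyclic_diff i (semicircular_potential n) = (\<Sum>m<n. \<Sum>k | k < 2 \<and> [m, m] ! k = i.
      Poly_Mapping.single (drop (Suc k) [m, m] @ take k [m, m]) (1 / 2))"
    unfolding cyclic_diff_def keys
    by (subst sum.reindex) (auto simp: inj_on_def lk numeral_2_eq_2 intro!: sum.cong)
  also have "\<dots> = (\<Sum>m<n. if m = i then Poly_Mapping.single [i] 1 else 0)"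
  proof (rule sum.cong [OF refl])
    fix m
    have ps: "{k. k < 2 \<and> [m, m] ! k = i} = (if m = i then {0, 1} else {})"
      by (auto simp: numeral_2_eq_2 less_Suc_eq nth_Cons' split: if_splits)
    show "(\<Sum>k | k < 2 \<and> [m, m] ! k = i. Poly_Mapping.single (drop (Suc k) [m, m] @ take k [m, m]) (1 / 2))
        = (if m = i then Poly_Mapping.single [i] (1 :: complex) else 0)"
      unfolding ps by (simp flip: single_add)
  qed
  finally show ?thesis using assms by simp
qed

lemma poly_eval_variable: "poly_eval F (Poly_Mapping.single [i] 1) = F i"
proof -
  have "scalar_op 1 o\<^sub>L x = x" for x :: "'a bop"
    by (rule blinfun_eqI) simp
  moreover have "x o\<^sub>L id_blinfun = x" for x :: "'a bop"
    by (rule blinfun_eqI) simp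
  ultimately show ?thesis by (simp add: poly_eval_def word_eval_def)
qed

lemma cinner_bipoly_eval:
  "cinner A (bipoly_eval S F q) = L1_pairing (\<lambda>a b. cinner A (tens S (l2 S a) (l2 S b))) F q"
  by (simp add: bipoly_eval_def L1_pairing_def cinner.sum_right cinner_scaleC_right split_def)

lemma word_eval_Nil [simp]: "word_eval F [] = id_blinfun"
  and word_eval_Cons [simp]: "word_eval F (i # w) = F i o\<^sub>L word_eval F w"
  by (simp_all add: word_eval_def)

context tracial
begin

lemma word_eval_in_M:
  assumes "\<And>i. i < n \<Longrightarrow> F i \<in> M" "set w \<subseteq> {..<n}"
  shows "word_eval F w \<in> M"
  using assms(2) by (induction w) (simp_all add: assms(1))

lemma l2_sum:
  assumes "\<And>a. a \<in> A \<Longrightarrow> f a \<in> M"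
  shows "(\<Sum>a\<in>A. f a) \<in> M \<and> \<iota> (\<Sum>a\<in>A. f a) = (\<Sum>a\<in>A. \<iota> (f a))"
  using assms
proof (induction A rule: infinite_finite_induct)
  case (insert a A)
  then show ?case by (simp add: l2_add)
qed (use diff_in_M [OF id_in_M id_in_M] l2_diff [OF id_in_M id_in_M] in simp_all)

lemma cinner_l2_poly_eval:
  assumes F: "\<And>i. i < n \<Longrightarrow> F i \<in> M" and p: "p \<in> ncpolys n"
  shows "poly_eval F p \<in> M"
    and "cinner v (\<iota> (poly_eval F p)) =
      (\<Sum>w\<in>Poly_Mapping.keys p. Poly_Mapping.lookup p w * cinner v (\<iota> (word_eval F w)))"
proof -
  have w: "word_eval F w \<in> M" if "w \<in> Poly_Mapping.keys p" for w
    using p that by (intro word_eval_in_M [OF F]) (auto simp: ncpolys_def in_lists_conv_set)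
  then have "poly_eval F p \<in> M \<and> \<iota> (poly_eval F p) =
      (\<Sum>w\<in>Poly_Mapping.keys p. \<iota> (scalar_op (Poly_Mapping.lookup p w) o\<^sub>L word_eval F w))"
    unfolding poly_eval_def by (intro l2_sum) simp
  then show "poly_eval F p \<in> M" and "cinner v (\<iota> (poly_eval F p)) =
      (\<Sum>w\<in>Poly_Mapping.keys p. Poly_Mapping.lookup p w * cinner v (\<iota> (word_eval F w)))"
    using w by (simp_all add: l2_scalar cinner.sum_right cinner_scaleC_right)
qed

end

section \<open>Free Stein kernels\<close>

context real_closable_derivation
begin

lemma has_der_word:
  assumes F: "\<And>i. i < n \<Longrightarrow> has_der (F i) (\<xi> i)" and w: "w \<noteq> []" "set w \<subseteq> {..<n}"
  shows "has_der (word_eval F w)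
    (\<Sum>k<length w. bimod S (word_eval F (take k w)) (\<xi> (w ! k)) (word_eval F (drop (Suc k) w)))"
  using w
proof (induction w)
  case (Cons i w)
  have FM: "F j \<in> M" if "j < n" for j using F [OF that] by (rule has_der_M)
  have i: "i < n" and sw: "set w \<subseteq> {..<n}" using Cons.prems by auto
  let ?d = "\<lambda>w k. bimod S (word_eval F (take k w)) (\<xi> (w ! k)) (word_eval F (drop (Suc k) w))"
  have tk: "word_eval F (take k w) \<in> M" and dr: "word_eval F (drop k w) \<in> M" for k
    using sw by (auto intro!: word_eval_in_M [OF FM] dest: in_set_takeD in_set_dropD)
  have shift: "(\<Sum>k<length (i # w). ?d (i # w) k) =
      bimod S id_blinfun (\<xi> i) (word_eval F w) + bimod S (F i) (\<Sum>k<length w. ?d w k) id_blinfun"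
    using FM [OF i] tk dr by (simp add: sum.lessThan_Suc_shift bimod_sum bimod_bimod del: sum.lessThan_Suc)
  show ?case
  proof (cases "w = []")
    case True
    then show ?thesis using F [OF i] by simp
  next
    case False
    then have "has_der (word_eval F w) (\<Sum>k<length w. ?d w k)" using Cons.IH sw by blast
    from has_der_compose [OF F [OF i] this] show ?thesis
      unfolding shift by (simp add: add.commute)
  qed
qed simp

text \<open>Integration by parts against \<open>\<omega> = \<delta>(\<Delta>\<^sup>-\<^sup>1 F\<^sub>i)\<close>, for which \<open>\<delta>\<^sup>*\<omega> = F\<^sub>i\<close>. The empty word is treated apart:
  centering makes its left-hand side vanish.\<close>

lemma stein_identity_word:
  assumes F: "\<And>i. i < n \<Longrightarrow> has_der (F i) (\<xi> i)" and w: "set w \<subseteq> {..<n}"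
    and adjoint: "(\<omega>, \<iota> (F i)) \<in> op_adj (der_closure S)"
    and centered: "cinner (\<iota> (F i)) (\<iota> id_blinfun) = 0"
  shows "cinner (\<iota> (F i)) (\<iota> (word_eval F w)) = (\<Sum>k<length w.
    cinner \<omega> (bimod S (word_eval F (take k w)) (\<xi> (w ! k)) (word_eval F (drop (Suc k) w))))"
proof (cases "w = []")
  case True
  then show ?thesis by (simp add: centered)
next
  case False
  have "(\<iota> (word_eval F w),
      \<Sum>k<length w. bimod S (word_eval F (take k w)) (\<xi> (w ! k)) (word_eval F (drop (Suc k) w)))
      \<in> der_closure S"
    by (rule has_der_closure [OF has_der_word [OF F False w]])
  with adjoint show ?thesis by (fastforce simp: op_adj_def cinner.sum_right [symmetric])
qed

end

theorem theorem15:
  fixes S :: "('k::complex_hilbert, 'r::{real_inner, polish_space}, 'h::complex_hilbert,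
      'l::complex_hilbert, 't::complex_hilbert, 'w::complex_hilbert) derivation_data"
    and n :: nat and F :: "nat \<Rightarrow> 'k bop"
  assumes "fourth_moment_diffusive_structure S"
    and "\<And>i. i < n \<Longrightarrow> F i \<in> alg S"
    and "\<And>i. i < n \<Longrightarrow> is_adjoint (F i) (F i)"
    and "\<And>i. i < n \<Longrightarrow> trace S (F i) = 0"
    and "\<And>i. i < n \<Longrightarrow> l2 S (F i) \<in> Domain (der_closure S)"
  shows "let \<Gamma> = (\<lambda>i j. carre_du_champ S
          (pseudo_inverse (laplacian S) (l2 S (F i))) (l2 S (F j)))
    in free_stein_identity_L1 S n F (semicircular_potential n) \<Gamma> \<and>
      (\<forall>A. (\<forall>i<n. \<forall>j<n. represents_L1 S (A i j) (\<Gamma> i j)) \<longrightarrow>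
        free_stein_kernel S n F (semicircular_potential n) A)"
proof -
  interpret tracial S
    using assms(1) by unfold_locales (simp add: fourth_moment_diffusive_structure_def)
  obtain ev where "pure_point_spectrum (laplacian S) ev"
    using assms(1) by (auto simp: fourth_moment_diffusive_structure_def)
  moreover have closable: "closable_derivation S" and real: "real_derivation S"
    using assms(1) by (simp_all add: fourth_moment_diffusive_structure_def)
  moreover from closable have "is_derivation S" by (simp add: closable_derivation_def)
  ultimately interpret real_closable_derivation S
    by unfold_locales (simp_all add: domain_dense_of_pure_point_spectrum)
  let ?G = "der_closure S"
  let ?\<Gamma> = "\<lambda>i j. carre_du_champ S (pseudo_inverse (laplacian S) (\<iota> (F i))) (\<iota> (F j))"
  note FM = assms(2)
  have adjF: "adj (F i) = F i" if "i < n" for i using assms(3) [OF that] by (rule adj_eq)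
  define \<xi> where "\<xi> i = op_app ?G (\<iota> (F i))" for i
  have \<xi>: "(\<iota> (F i), \<xi> i) \<in> ?G" if "i < n" for i
    using assms(5) [OF that] op_app_der_closure unfolding \<xi>_def by auto
  have hd: "has_der (F i) (\<xi> i)" if "i < n" for i
    by (rule has_der_selfadjoint [OF FM [OF that] adjF [OF that] \<xi> [OF that]])
  define \<omega> where "\<omega> i = op_app ?G (pseudo_inverse (laplacian S) (\<iota> (F i)))" for i
  \<comment> \<open>Centering turns \<open>\<Delta> \<Delta>\<^sup>-\<^sup>1 F\<^sub>i = F\<^sub>i - \<tau>(F\<^sub>i)\<close> into \<open>\<delta>\<^sup>*\<delta>(\<Delta>\<^sup>-\<^sup>1 F\<^sub>i) = F\<^sub>i\<close>.\<close>
  have \<omega>: "(\<omega> i, \<iota> (F i)) \<in> op_adj ?G" if i: "i < n" for i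
  proof -
    have "cinner (\<iota> id_blinfun) (\<iota> (F i)) = 0" using FM [OF i] assms(4) [OF i] by (simp add: cinner_l2)
    then have "(pseudo_inverse (laplacian S) (\<iota> (F i)), \<iota> (F i)) \<in> laplacian S"
      using assms(1) unfolding fourth_moment_diffusive_structure_def
      by (metis scaleC.zero_left diff_zero)
    then obtain w where "(pseudo_inverse (laplacian S) (\<iota> (F i)), w) \<in> ?G" "(w, \<iota> (F i)) \<in> op_adj ?G"
      by (auto simp: laplacian_def)
    then show ?thesis unfolding \<omega>_def by (simp add: op_app_der_closure)
  qed
  have \<Gamma>: "?\<Gamma> i j a b = cinner (\<omega> i) (bimod S a (\<xi> j) b)" if "a \<in> M" "b \<in> M" for i j a b
    unfolding carre_du_champ_def \<omega>_def \<xi>_def by (rule sharp_L1_eq [OF that])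
  have words: "cinner (\<iota> (F i)) (\<iota> (word_eval F w)) =
      (\<Sum>k<length w. ?\<Gamma> i (w ! k) (word_eval F (take k w)) (word_eval F (drop (Suc k) w)))"
    if i: "i < n" and w: "set w \<subseteq> {..<n}" for i w
  proof -
    have "cinner (\<iota> (F i)) (\<iota> id_blinfun) = 0"
      using FM [OF i] assms(4) [OF i] by (simp add: cinner_l2 adjF [OF i])
    from stein_identity_word [where F = F and \<xi> = \<xi> and n = n, OF hd w \<omega> [OF i] this]
    have "cinner (\<iota> (F i)) (\<iota> (word_eval F w)) = (\<Sum>k<length w.
        cinner (\<omega> i) (bimod S (word_eval F (take k w)) (\<xi> (w ! k)) (word_eval F (drop (Suc k) w))))" .
    moreover have "word_eval F (take k w) \<in> M" "word_eval F (drop k w) \<in> M" for k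
      using w by (auto intro!: word_eval_in_M [OF FM] dest: in_set_takeD in_set_dropD)
    ultimately show ?thesis by (simp add: \<Gamma>)
  qed
  have stein: "\<tau> (adj (poly_eval F (cyclic_diff i (semicircular_potential n))) o\<^sub>L poly_eval F p) =
      (\<Sum>j<n. L1_pairing (?\<Gamma> i j) F (free_diff j p))" if i: "i < n" and p: "p \<in> ncpolys n" for i p
  proof -
    have "\<tau> (adj (poly_eval F (cyclic_diff i (semicircular_potential n))) o\<^sub>L poly_eval F p) =
        cinner (\<iota> (F i)) (\<iota> (poly_eval F p))"
      using FM [OF i] cinner_l2_poly_eval(1) [OF FM p]
      by (simp add: cyclic_diff_semicircular_potential [OF i] poly_eval_variable cinner_l2)
    also have "\<dots> = (\<Sum>w\<in>Poly_Mapping.keys p. Poly_Mapping.lookup p w *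
        cinner (\<iota> (F i)) (\<iota> (word_eval F w)))"
      by (rule cinner_l2_poly_eval(2) [OF FM p])
    also have "\<dots> = (\<Sum>w\<in>Poly_Mapping.keys p. Poly_Mapping.lookup p w *
        (\<Sum>k<length w. ?\<Gamma> i (w ! k) (word_eval F (take k w)) (word_eval F (drop (Suc k) w))))"
    proof (rule sum.cong [OF refl])
      fix w assume "w \<in> Poly_Mapping.keys p"
      then have "set w \<subseteq> {..<n}" using p by (auto simp: ncpolys_def in_lists_conv_set)
      then show "Poly_Mapping.lookup p w * cinner (\<iota> (F i)) (\<iota> (word_eval F w)) =
          Poly_Mapping.lookup p w *
          (\<Sum>k<length w. ?\<Gamma> i (w ! k) (word_eval F (take k w)) (word_eval F (drop (Suc k) w)))"
        by (simp add: words [OF i])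
    qed
    also have "\<dots> = (\<Sum>j<n. L1_pairing (?\<Gamma> i j) F (free_diff j p))"
      by (rule sum_L1_pairing_free_diff [OF p, symmetric])
    finally show ?thesis .
  qed
  have kernel: "cinner (A i j) (bipoly_eval S F (free_diff j p)) = L1_pairing (?\<Gamma> i j) F (free_diff j p)"
    if A: "represents_L1 S (A i j) (?\<Gamma> i j)" and p: "p \<in> ncpolys n" for A :: "nat \<Rightarrow> nat \<Rightarrow> 't" and i j p
    unfolding cinner_bipoly_eval L1_pairing_free_diff
  proof (intro sum.cong refl)
    fix w k assume "w \<in> Poly_Mapping.keys p" and "k \<in> {k. k < length w \<and> w ! k = j}"
    then have w: "set w \<subseteq> {..<n}" using p by (auto simp: ncpolys_def in_lists_conv_set)
    have "word_eval F (take k w) \<in> M" "word_eval F (drop (Suc k) w) \<in> M"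
      using w by (auto intro!: word_eval_in_M [OF FM] dest: in_set_takeD in_set_dropD)
    then show "Poly_Mapping.lookup p w *
        cinner (A i j) (tens S (\<iota> (word_eval F (take k w))) (\<iota> (word_eval F (drop (Suc k) w)))) =
        Poly_Mapping.lookup p w * ?\<Gamma> i j (word_eval F (take k w)) (word_eval F (drop (Suc k) w))"
      using A by (simp add: represents_L1_def)
  qed
  show ?thesis
    unfolding Let_def free_stein_identity_L1_def free_stein_kernel_def
    by (simp add: stein kernel)
qed

end
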